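(* A Nakayama algebra $A$ is quasi-hereditary if and only if $\mathscr{X}_A\neq\emptyset$.
   Context: $K$ is an algebraically closed field and $n\ge 2$. $Q_n$ denotes either the linear quiver $A_n$ with vertices $1,\dots,n$ and arrows $\alpha_j:j\to j+1$ ($1\le j\le n-1$), or the cyclic quiver $\widetilde{A}_n$ with vertices $1,\dots,n$ and arrows $\alpha_j:j\to j+1$ ($1\le j\le n-1$) and $\alpha_n:n\to 1$. A Nakayama algebra means a finite-dimensional algebra $A=KQ_n/I$ with $I$ an admissible two-sided ideal; $I$ is generated by a minimal set of paths, and writing $I=\langle g_1,\dots,g_k\rangle$ always means that $\{g_1,\dots,g_k\}$ is this minimal set of paths. Vertices are read modulo $n$ in the cyclic case. Paths compose from right to left, and modules are such that the indecomposable projective $P(j)$ with top $j$ is uniserial with composition factors $j,j+1,j+2,\dots$ from top to socle. The simple module at vertex $x$ is denoted by $x$, and $\mathcal{S}$ is the set of all simple $A$-modules, i.e. of vertices ($|\mathcal{S}|=n$). Length of a path means number of arrows plus $1$. For a path $g=\alpha_{d(g)-1}\cdots\alpha_{h(g)}$ of length $\ell_g\ge 3$ from vertex $h(g)$ (the hook) to vertex $d(g)=h(g)+\ell_g-1$ (the denouement), $Hod(g)$ is the multiset $\{h(g),h(g)+1,\dots,d(g)\}$ of the $\ell_g$ vertices visited by $g$, and $Int(g)$ is the multiset obtained from $Hod(g)$ by removing the first and last entries $h(g)$ and $d(g)$ (one occurrence each). For $A=KQ_n/\langle g_1,\dots,g_k\rangle$, the $Q$-set of $A$ is $\mathscr{X}_A=\mathcal{S}\setminus\bigcup_{i=1}^k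 Int(g_i)$. Given a total ordering $\preceq$ on $\mathcal{S}$, the Weyl module $\Delta(x)$ is the maximal factor module of $P(x)$ all of whose composition factors $y$ satisfy $y\preceq x$. A module is good if it has a finite filtration whose successive quotients are Weyl modules. The ordering $\preceq$ is a quasi-hereditary ordering ($q$-ordering) of $A$ if for every $x\in\mathcal{S}$: (1) $\mathrm{End}_A(\Delta(x))\simeq K$, and (2) $P(x)$ is good. $A$ is quasi-hereditary if it admits at least one $q$-ordering. *)

theory Defs
  imports
    "HOL-Computational_Algebra.Polynomial"
    "HOL-Library.Multiset"
    "Graph_Theory.Arc_Walk"
    "HOL-Algebra.Ideal_Product"
    "HOL-Algebra.QuotRing"
    "HOL-Algebra.Module"
begin

section \<open>Left modules over a not necessarily commutative ring\<close>

text \<open>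
  The records and the predicate \<^const>\<open>submodule\<close> of the library's theory of modules are used;
  none of them requires the ring to be commutative. The fields \<^const>\<open>mult\<close> and \<^const>\<open>one\<close> of a
  record that stands for a module play no role.
\<close>

definition module_hom ::
  "('a, 'r) ring_scheme \<Rightarrow> ('a, 'm) module \<Rightarrow> ('a, 'n) module \<Rightarrow> ('m \<Rightarrow> 'n) set" where
  "module_hom A M N = {f \<in> carrier M \<rightarrow>\<^sub>E carrier N.
     (\<forall>x\<in>carrier M. \<forall>y\<in>carrier M. f (x \<oplus>\<^bsub>M\<^esub> y) = f x \<oplus>\<^bsub>N\<^esub> f y) \<and>
     (\<forall>a\<in>carrier A. \<forall>x\<in>carrier M. f (a \<odot>\<^bsub>M\<^esub> x) = a \<odot>\<^bsub>N\<^esub> f x)}"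

definition module_iso :: "('a, 'r) ring_scheme \<Rightarrow> ('a, 'm) module \<Rightarrow> ('a, 'n) module \<Rightarrow> bool" where
  "module_iso A M N \<longleftrightarrow> (\<exists>f\<in>module_hom A M N. bij_betw f (carrier M) (carrier N))"

definition quot_module :: "('a, 'm) module \<Rightarrow> 'm set \<Rightarrow> ('a, 'm set) module" where
  "quot_module M U = \<lparr>carrier = a_rcosets\<^bsub>M\<^esub> U, mult = undefined, one = undefined,
     zero = U, add = set_add M, smult = (\<lambda>a X. \<Union>m\<in>X. U +>\<^bsub>M\<^esub> (a \<odot>\<^bsub>M\<^esub> m))\<rparr>"

definition subquot :: "('a, 'm) module \<Rightarrow> 'm set \<Rightarrow> 'm set \<Rightarrow> ('a, 'm set) module" where
  "subquot M W V = quot_module (M\<lparr>carrier := W\<rparr>) V"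

definition simple_module :: "('a, 'r) ring_scheme \<Rightarrow> ('a, 'm) module \<Rightarrow> bool" where
  "simple_module A M \<longleftrightarrow> carrier M \<noteq> {\<zero>\<^bsub>M\<^esub>} \<and>
     (\<forall>U. submodule U A M \<longrightarrow> U = {\<zero>\<^bsub>M\<^esub>} \<or> U = carrier M)"

definition maximal_submodule :: "'m set \<Rightarrow> ('a, 'r) ring_scheme \<Rightarrow> ('a, 'm) module \<Rightarrow> bool" where
  "maximal_submodule U A M \<longleftrightarrow> submodule U A M \<and> U \<noteq> carrier M \<and>
     (\<forall>V. submodule V A M \<longrightarrow> U \<subseteq> V \<longrightarrow> V = U \<or> V = carrier M)"

definition module_radical :: "('a, 'r) ring_scheme \<Rightarrow> ('a, 'm) module \<Rightarrow> 'm set" where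
  "module_radical A M = carrier M \<inter> \<Inter>{U. maximal_submodule U A M}"

definition module_top :: "('a, 'r) ring_scheme \<Rightarrow> ('a, 'm) module \<Rightarrow> ('a, 'm set) module" where
  "module_top A M = quot_module M (module_radical A M)"

definition filtration :: "('a, 'r) ring_scheme \<Rightarrow> ('a, 'm) module \<Rightarrow> 'm set list \<Rightarrow> bool" where
  "filtration A M Us \<longleftrightarrow> Us \<noteq> [] \<and> hd Us = {\<zero>\<^bsub>M\<^esub>} \<and> last Us = carrier M \<and>
     (\<forall>U\<in>set Us. submodule U A M) \<and> (\<forall>i. Suc i < length Us \<longrightarrow> Us ! i \<subseteq> Us ! Suc i)"

definition composition_series ::
  "('a, 'r) ring_scheme \<Rightarrow> ('a, 'm) module \<Rightarrow> 'm set list \<Rightarrow> bool" where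
  "composition_series A M Us \<longleftrightarrow> filtration A M Us \<and>
     (\<forall>i. Suc i < length Us \<longrightarrow> simple_module A (subquot M (Us ! Suc i) (Us ! i)))"

definition composition_factor ::
  "('a, 'r) ring_scheme \<Rightarrow> ('a, 'm) module \<Rightarrow> ('a, 'n) module \<Rightarrow> bool" where
  "composition_factor A M L \<longleftrightarrow> (\<exists>Us i. composition_series A M Us \<and> Suc i < length Us \<and>
     module_iso A (subquot M (Us ! Suc i) (Us ! i)) L)"


section \<open>Algebras over a field\<close>

text \<open>
  A \<open>K\<close>-algebra, where the field \<open>K\<close> is a type, is a ring record with the scalar multiplication
  by \<open>K\<close> in its field \<^const>\<open>smult\<close>.
\<close>

definition scalar_algebra :: "('k::field, 'k) module" where
  "scalar_algebra = \<lparr>carrier = UNIV, mult = (*), one = 1, zero = 0, add = (+), smult = (*)\<rparr>"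

definition algebra_iso :: "('k, 'a) module \<Rightarrow> ('k, 'b) module \<Rightarrow> bool" where
  "algebra_iso A B \<longleftrightarrow>
     (\<exists>\<phi>\<in>ring_iso A B. \<forall>c. \<forall>a\<in>carrier A. \<phi> (c \<odot>\<^bsub>A\<^esub> a) = c \<odot>\<^bsub>B\<^esub> \<phi> a)"

definition quot_algebra :: "('k, 'a) module \<Rightarrow> 'a set \<Rightarrow> ('k, 'a set) module" where
  "quot_algebra A I = \<lparr>carrier = carrier (A Quot I), mult = mult (A Quot I),
     one = \<one>\<^bsub>A Quot I\<^esub>, zero = \<zero>\<^bsub>A Quot I\<^esub>, add = add (A Quot I),
     smult = (\<lambda>c X. \<Union>a\<in>X. I +>\<^bsub>A\<^esub> (c \<odot>\<^bsub>A\<^esub> a))\<rparr>"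

definition end_algebra :: "('k, 'a) module \<Rightarrow> ('a, 'm) module \<Rightarrow> ('k, 'm \<Rightarrow> 'm) module" where
  "end_algebra A M = \<lparr>carrier = module_hom A M M,
     mult = compose (carrier M),
     one = (\<lambda>m\<in>carrier M. m),
     zero = (\<lambda>m\<in>carrier M. \<zero>\<^bsub>M\<^esub>),
     add = (\<lambda>f g. \<lambda>m\<in>carrier M. f m \<oplus>\<^bsub>M\<^esub> g m),
     smult = (\<lambda>c f. \<lambda>m\<in>carrier M. (c \<odot>\<^bsub>A\<^esub> \<one>\<^bsub>A\<^esub>) \<odot>\<^bsub>M\<^esub> f m)\<rparr>"


section \<open>Quasi-hereditary orderings\<close>

text \<open>
  Below, \<open>V\<close> is the set of vertices and \<open>e x\<close> the primitive idempotent of \<open>A\<close> at the vertex \<open>x\<close>.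
  A total ordering is a relation \<open>r\<close> on \<open>V\<close>; \<open>(y, x) \<in> r\<close> means that \<open>y\<close> precedes or equals \<open>x\<close>.
\<close>

definition proj_module :: "('k, 'a) module \<Rightarrow> ('v \<Rightarrow> 'a) \<Rightarrow> 'v \<Rightarrow> ('a, 'a) module" where
  "proj_module A e x = \<lparr>carrier = {a \<otimes>\<^bsub>A\<^esub> e x | a. a \<in> carrier A}, mult = undefined, one = undefined,
     zero = \<zero>\<^bsub>A\<^esub>, add = add A, smult = mult A\<rparr>"

definition simple_at :: "('k, 'a) module \<Rightarrow> ('v \<Rightarrow> 'a) \<Rightarrow> 'v \<Rightarrow> ('a, 'a set) module" where
  "simple_at A e x = module_top A (proj_module A e x)"

text \<open>The maximal factor module of \<open>P(x)\<close> with a property is the factor by the least submodule.\<close>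

definition weyl_module ::
  "('k, 'a) module \<Rightarrow> ('v \<Rightarrow> 'a) \<Rightarrow> 'v set \<Rightarrow> ('v \<times> 'v) set \<Rightarrow> 'v \<Rightarrow> ('a, 'a set) module" where
  "weyl_module A e V r x = quot_module (proj_module A e x)
     (LEAST U. submodule U A (proj_module A e x) \<and>
        (\<forall>y\<in>V. composition_factor A (quot_module (proj_module A e x) U) (simple_at A e y)
                 \<longrightarrow> (y, x) \<in> r))"

definition good_module ::
  "('k, 'a) module \<Rightarrow> ('v \<Rightarrow> 'a) \<Rightarrow> 'v set \<Rightarrow> ('v \<times> 'v) set \<Rightarrow> ('a, 'm) module \<Rightarrow> bool" where
  "good_module A e V r M \<longleftrightarrow> (\<exists>Us. filtration A M Us \<and>
     (\<forall>i. Suc i < length Us \<longrightarrow>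
        (\<exists>y\<in>V. module_iso A (subquot M (Us ! Suc i) (Us ! i)) (weyl_module A e V r y))))"

definition q_ordering ::
  "('k::field, 'a) module \<Rightarrow> ('v \<Rightarrow> 'a) \<Rightarrow> 'v set \<Rightarrow> ('v \<times> 'v) set \<Rightarrow> bool" where
  "q_ordering A e V r \<longleftrightarrow> linear_order_on V r \<and>
     (\<forall>x\<in>V. algebra_iso (end_algebra A (weyl_module A e V r x)) scalar_algebra \<and>
            good_module A e V r (proj_module A e x))"

definition quasi_hereditary :: "('k::field, 'a) module \<Rightarrow> ('v \<Rightarrow> 'a) \<Rightarrow> 'v set \<Rightarrow> bool" where
  "quasi_hereditary A e V \<longleftrightarrow> (\<exists>r. q_ordering A e V r)"


section \<open>Path algebras\<close>

text \<open>
  A quiver is a \<open>pre_digraph\<close> record. A path is its source together with the list of its arrows in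
  the order in which they are traversed, so the path written \<open>\<beta>\<alpha>\<close> (first \<open>\<alpha>\<close>, then \<open>\<beta>\<close>)
  has the list \<open>[\<alpha>, \<beta>]\<close>.
\<close>

type_synonym ('v, 'e) qpath = "'v \<times> 'e list"

definition qpaths :: "('v, 'e) pre_digraph \<Rightarrow> ('v, 'e) qpath set" where
  "qpaths Q = {(u, p). \<exists>v. pre_digraph.awalk Q u p v}"

definition path_verts :: "('v, 'e) pre_digraph \<Rightarrow> ('v, 'e) qpath \<Rightarrow> 'v list" where
  "path_verts Q p = pre_digraph.awalk_verts Q (fst p) (snd p)"

definition path_source :: "('v, 'e) pre_digraph \<Rightarrow> ('v, 'e) qpath \<Rightarrow> 'v" where
  "path_source Q p = hd (path_verts Q p)"

definition path_target :: "('v, 'e) pre_digraph \<Rightarrow> ('v, 'e) qpath \<Rightarrow> 'v" where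
  "path_target Q p = last (path_verts Q p)"

text \<open>
  Elements of the path algebra are finitely supported families of coefficients. The product of the
  paths \<open>q\<close> and \<open>p\<close> is \<open>qp\<close>, the path \<open>p\<close> followed by \<open>q\<close>.
\<close>

definition path_algebra ::
  "('v, 'e) pre_digraph \<Rightarrow> ('k::field, ('v, 'e) qpath \<Rightarrow> 'k) module" where
  "path_algebra Q = \<lparr>
     carrier = {f. finite {p. f p \<noteq> 0} \<and> {p. f p \<noteq> 0} \<subseteq> qpaths Q},
     mult = (\<lambda>f g s. \<Sum>(q, p) \<in> {(q, p). q \<in> qpaths Q \<and> p \<in> qpaths Q \<and>
                path_target Q p = path_source Q q \<and> s = (fst p, snd p @ snd q)}. f q * g p),
     one = (\<lambda>p. if p \<in> qpaths Q \<and> snd p = [] then 1 else 0),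
     zero = (\<lambda>p. 0),
     add = (\<lambda>f g p. f p + g p),
     smult = (\<lambda>c f p. c * f p)\<rparr>"

definition path_elem :: "('v, 'e) qpath \<Rightarrow> ('v, 'e) qpath \<Rightarrow> 'k::field" where
  "path_elem p = (\<lambda>q. if q = p then 1 else 0)"

definition arrow_ideal :: "('v, 'e) pre_digraph \<Rightarrow> (('v, 'e) qpath \<Rightarrow> 'k::field) set" where
  "arrow_ideal Q = genideal (path_algebra Q) {path_elem (tail Q a, [a]) | a. a \<in> arcs Q}"

definition arrow_ideal_power ::
  "('v, 'e) pre_digraph \<Rightarrow> nat \<Rightarrow> (('v, 'e) qpath \<Rightarrow> 'k::field) set" where
  "arrow_ideal_power Q m =
     (ideal_prod (path_algebra Q) (arrow_ideal Q) ^^ m) (carrier (path_algebra Q))"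

definition admissible :: "('v, 'e) pre_digraph \<Rightarrow> (('v, 'e) qpath \<Rightarrow> 'k::field) set \<Rightarrow> bool" where
  "admissible Q I \<longleftrightarrow> ideal I (path_algebra Q) \<and>
     (\<exists>m\<ge>2. arrow_ideal_power Q m \<subseteq> I \<and> I \<subseteq> arrow_ideal_power Q 2)"

definition bound_quiver_algebra ::
  "('v, 'e) pre_digraph \<Rightarrow> (('v, 'e) qpath \<Rightarrow> 'k::field) set
     \<Rightarrow> ('k, (('v, 'e) qpath \<Rightarrow> 'k) set) module" where
  "bound_quiver_algebra Q I = quot_algebra (path_algebra Q) I"

definition vertex_idem ::
  "('v, 'e) pre_digraph \<Rightarrow> (('v, 'e) qpath \<Rightarrow> 'k::field) set \<Rightarrow> 'v
     \<Rightarrow> (('v, 'e) qpath \<Rightarrow> 'k) set" where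
  "vertex_idem Q I x = I +>\<^bsub>path_algebra Q\<^esub> path_elem (x, [])"


section \<open>Nakayama algebras and their \<open>Q\<close>-sets\<close>

text \<open>The arrow \<open>j\<close> stands for \<open>\<alpha>\<^sub>j\<close>.\<close>

definition linear_quiver :: "nat \<Rightarrow> (nat, nat) pre_digraph" where
  "linear_quiver n = \<lparr>verts = {1..n}, arcs = {1..n - 1}, tail = (\<lambda>j. j), head = (\<lambda>j. j + 1)\<rparr>"

definition cyclic_quiver :: "nat \<Rightarrow> (nat, nat) pre_digraph" where
  "cyclic_quiver n = \<lparr>verts = {1..n}, arcs = {1..n}, tail = (\<lambda>j. j),
     head = (\<lambda>j. if j = n then 1 else j + 1)\<rparr>"

definition generates :: "('v, 'e) pre_digraph \<Rightarrow> ('v, 'e) qpath set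
    \<Rightarrow> (('v, 'e) qpath \<Rightarrow> 'k::field) set \<Rightarrow> bool" where
  "generates Q G I \<longleftrightarrow> G \<subseteq> qpaths Q \<and> genideal (path_algebra Q) (path_elem ` G) = I"

text \<open>
  Every ideal generated by paths has exactly one minimal generating set of paths, and every
  admissible ideal of the path algebra of a linear or cyclic quiver is generated by paths.
\<close>

definition minimal_relations ::
  "('v, 'e) pre_digraph \<Rightarrow> (('v, 'e) qpath \<Rightarrow> 'k::field) set \<Rightarrow> ('v, 'e) qpath set" where
  "minimal_relations Q I = (THE G. generates Q G I \<and> (\<forall>G'. G' \<subset> G \<longrightarrow> \<not> generates Q G' I))"

definition Hod_verts :: "('v, 'e) pre_digraph \<Rightarrow> ('v, 'e) qpath \<Rightarrow> 'v multiset" where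
  "Hod_verts Q g = mset (path_verts Q g)"

definition Int_verts :: "('v, 'e) pre_digraph \<Rightarrow> ('v, 'e) qpath \<Rightarrow> 'v multiset" where
  "Int_verts Q g = Hod_verts Q g - {#path_source Q g, path_target Q g#}"

definition Q_set :: "('v, 'e) pre_digraph \<Rightarrow> (('v, 'e) qpath \<Rightarrow> 'k::field) set \<Rightarrow> 'v set" where
  "Q_set Q I = verts Q - (\<Union>g\<in>minimal_relations Q I. set_mset (Int_verts Q g))"

end

theory Submission
  imports Defs
begin

text \<open>
  Both quivers are functional: every vertex \<open>x\<close> has at most one outgoing arrow, so the paths from \<open>x\<close>
  are determined by their lengths, an admissible ideal is spanned by paths (a lowest term argument),
  and \<open>P(x)\<close> is uniserial with composition factors \<open>x, s x, s (s x), \<dots>\<close>, in number \<open>L x\<close>. A vertex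
  \<open>x\<close> lies in no \<open>Int(g)\<close> exactly if every occurrence of \<open>x\<close> in a \<open>P(y)\<close> generates a copy of \<open>P(x)\<close>,
  that is, \<open>j + L x \<le> L y\<close> whenever \<open>x\<close> is the factor of \<open>P(y)\<close> at position \<open>j < L y\<close>.

  If \<open>x\<close> is the greatest vertex of a \<open>q\<close>-ordering, then \<open>\<Delta>(x) = P(x)\<close>, and \<open>x\<close> occurs only once in it,
  as \<open>End(\<Delta>(x)) = K\<close>. In a Weyl filtration of \<open>P(y)\<close> an occurrence of \<open>x\<close> belongs to a Weyl factor
  whose index is at least \<open>x\<close>, hence to a copy of \<open>P(x)\<close>, which it generates. Conversely, given such
  an \<open>x\<close>, order the vertices so that \<open>x\<close> is greatest and \<open>y < s y\<close> for all other \<open>y\<close>; then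
  \<open>\<Delta>(x) = P(x)\<close>, the other Weyl modules are simple, and \<open>P(y)\<close> is filtered by the simple factors before
  the first occurrence of \<open>x\<close>, followed by a copy of \<open>P(x)\<close>.
\<close>

section \<open>Left modules and their quotients\<close>

text \<open>Vertices recur along the cyclic quiver, so a submodule of \<open>P(x)\<close> is
  recorded by a position and not by a vertex, and the arguments become inequalities between values
  of \<open>L\<close>. The basic one is \<open>L y \<le> j + L x\<close> if \<open>x\<close> stands
  at position \<open>j\<close> of \<open>P(y)\<close>: a zero path stays zero when it is lengthened.
  The occurrence generates a copy of \<open>P(x)\<close> exactly in the case of equality. If
  equality fails, the path of length \<open>L y\<close> from \<open>y\<close> exists and is zero,
  and a minimal relation in it must end where it ends. The relation cannot start at \<open>x\<close>
  or later, since the remainder from \<open>x\<close> is still nonzero; so it starts earlier and has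
  \<open>x\<close> strictly inside. This is why interiors of relations decide.

  A composition factor is defined by some composition series. The role of uniqueness of the factors
  is taken by idempotents: a factor at \<open>y\<close> prevents \<open>e y\<close> from acting as
  zero, and \<open>e y\<close> detects the positions at which \<open>y\<close> stands. The module
  theory sees the algebra only through the coefficient function \<open>co\<close>; cosets of
  \<open>I\<close> and lists of arrows enter only when \<open>co\<close> is constructed.\<close>

locale left_module = A: ring A + M: abelian_group M
  for A :: "('a, 'r) ring_scheme" and M :: "('a, 'm) module" +
  assumes smult_closed [simp, intro]:
      "\<lbrakk>a \<in> carrier A; x \<in> carrier M\<rbrakk> \<Longrightarrow> a \<odot>\<^bsub>M\<^esub> x \<in> carrier M"
    and smult_l_distr: "\<lbrakk>a \<in> carrier A; b \<in> carrier A; x \<in> carrier M\<rbrakk>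
      \<Longrightarrow> (a \<oplus>\<^bsub>A\<^esub> b) \<odot>\<^bsub>M\<^esub> x = a \<odot>\<^bsub>M\<^esub> x \<oplus>\<^bsub>M\<^esub> b \<odot>\<^bsub>M\<^esub> x"
    and smult_r_distr: "\<lbrakk>a \<in> carrier A; x \<in> carrier M; y \<in> carrier M\<rbrakk>
      \<Longrightarrow> a \<odot>\<^bsub>M\<^esub> (x \<oplus>\<^bsub>M\<^esub> y) = a \<odot>\<^bsub>M\<^esub> x \<oplus>\<^bsub>M\<^esub> a \<odot>\<^bsub>M\<^esub> y"
    and smult_assoc: "\<lbrakk>a \<in> carrier A; b \<in> carrier A; x \<in> carrier M\<rbrakk>
      \<Longrightarrow> (a \<otimes>\<^bsub>A\<^esub> b) \<odot>\<^bsub>M\<^esub> x = a \<odot>\<^bsub>M\<^esub> (b \<odot>\<^bsub>M\<^esub> x)"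
    and smult_one [simp]: "x \<in> carrier M \<Longrightarrow> \<one>\<^bsub>A\<^esub> \<odot>\<^bsub>M\<^esub> x = x"

text \<open>Minus one times \<open>x\<close> serves as the additive inverse of \<open>x\<close>, by
  distributivity and the action of zero.\<close>

lemma left_moduleI:
  assumes "ring A"
    and "\<zero>\<^bsub>M\<^esub> \<in> carrier M"
    and "\<And>x y. \<lbrakk>x \<in> carrier M; y \<in> carrier M\<rbrakk> \<Longrightarrow> x \<oplus>\<^bsub>M\<^esub> y \<in> carrier M"
    and "\<And>x y z. \<lbrakk>x \<in> carrier M; y \<in> carrier M; z \<in> carrier M\<rbrakk>
      \<Longrightarrow> (x \<oplus>\<^bsub>M\<^esub> y) \<oplus>\<^bsub>M\<^esub> z = x \<oplus>\<^bsub>M\<^esub> (y \<oplus>\<^bsub>M\<^esub> z)"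
    and "\<And>x y. \<lbrakk>x \<in> carrier M; y \<in> carrier M\<rbrakk> \<Longrightarrow> x \<oplus>\<^bsub>M\<^esub> y = y \<oplus>\<^bsub>M\<^esub> x"
    and "\<And>x. x \<in> carrier M \<Longrightarrow> \<zero>\<^bsub>M\<^esub> \<oplus>\<^bsub>M\<^esub> x = x"
    and "\<And>a x. \<lbrakk>a \<in> carrier A; x \<in> carrier M\<rbrakk> \<Longrightarrow> a \<odot>\<^bsub>M\<^esub> x \<in> carrier M"
    and l: "\<And>a b x. \<lbrakk>a \<in> carrier A; b \<in> carrier A; x \<in> carrier M\<rbrakk>
      \<Longrightarrow> (a \<oplus>\<^bsub>A\<^esub> b) \<odot>\<^bsub>M\<^esub> x = a \<odot>\<^bsub>M\<^esub> x \<oplus>\<^bsub>M\<^esub> b \<odot>\<^bsub>M\<^esub> x"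
    and "\<And>a x y. \<lbrakk>a \<in> carrier A; x \<in> carrier M; y \<in> carrier M\<rbrakk>
      \<Longrightarrow> a \<odot>\<^bsub>M\<^esub> (x \<oplus>\<^bsub>M\<^esub> y) = a \<odot>\<^bsub>M\<^esub> x \<oplus>\<^bsub>M\<^esub> a \<odot>\<^bsub>M\<^esub> y"
    and "\<And>a b x. \<lbrakk>a \<in> carrier A; b \<in> carrier A; x \<in> carrier M\<rbrakk>
      \<Longrightarrow> (a \<otimes>\<^bsub>A\<^esub> b) \<odot>\<^bsub>M\<^esub> x = a \<odot>\<^bsub>M\<^esub> (b \<odot>\<^bsub>M\<^esub> x)"
    and one: "\<And>x. x \<in> carrier M \<Longrightarrow> \<one>\<^bsub>A\<^esub> \<odot>\<^bsub>M\<^esub> x = x"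
    and zero: "\<And>x. x \<in> carrier M \<Longrightarrow> \<zero>\<^bsub>A\<^esub> \<odot>\<^bsub>M\<^esub> x = \<zero>\<^bsub>M\<^esub>"
  shows "left_module A M"
proof -
  interpret A: ring A by fact
  have "(\<ominus>\<^bsub>A\<^esub> \<one>\<^bsub>A\<^esub>) \<odot>\<^bsub>M\<^esub> x \<oplus>\<^bsub>M\<^esub> x = \<zero>\<^bsub>M\<^esub>" if "x \<in> carrier M" for x
    using l[of "\<ominus>\<^bsub>A\<^esub> \<one>\<^bsub>A\<^esub>" "\<one>\<^bsub>A\<^esub>" x] zero one that by (simp add: A.l_neg)
  moreover have "(\<ominus>\<^bsub>A\<^esub> \<one>\<^bsub>A\<^esub>) \<odot>\<^bsub>M\<^esub> x \<in> carrier M" if "x \<in> carrier M" for x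
    using assms(7) that by simp
  ultimately have inv: "\<exists>y\<in>carrier M. y \<oplus>\<^bsub>M\<^esub> x = \<zero>\<^bsub>M\<^esub>" if "x \<in> carrier M" for x
    using that by blast
  have "abelian_group M"
    by (rule abelian_groupI) (fact assms inv)+
  show ?thesis
    unfolding left_module_def left_module_axioms_def
    by (intro conjI allI impI; fact assms \<open>abelian_group M\<close>)
qed

text \<open>Cosets ignore the carrier, so those formed inside a submodule, as in
  \<open>subquot\<close>, are cosets of the whole module.\<close>

lemma a_r_coset_carrier_update [simp]: "U +>\<^bsub>M\<lparr>carrier := W\<rparr>\<^esub> x = U +>\<^bsub>M\<^esub> x"
  by (simp add: a_r_coset_def')

context left_module
begin

lemma zero_smult [simp]: "x \<in> carrier M \<Longrightarrow> \<zero>\<^bsub>A\<^esub> \<odot>\<^bsub>M\<^esub> x = \<zero>\<^bsub>M\<^esub>"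
  using smult_l_distr[of "\<zero>\<^bsub>A\<^esub>" "\<zero>\<^bsub>A\<^esub>" x] by simp

lemma smult_minus_one: "x \<in> carrier M \<Longrightarrow> (\<ominus>\<^bsub>A\<^esub> \<one>\<^bsub>A\<^esub>) \<odot>\<^bsub>M\<^esub> x = \<ominus>\<^bsub>M\<^esub> x"
  using smult_l_distr[of "\<ominus>\<^bsub>A\<^esub> \<one>\<^bsub>A\<^esub>" "\<one>\<^bsub>A\<^esub>" x]
  by (simp add: A.l_neg) (metis A.a_inv_closed A.one_closed M.minus_equality smult_closed)

lemma smult_minus:
  "\<lbrakk>a \<in> carrier A; x \<in> carrier M; y \<in> carrier M\<rbrakk>
    \<Longrightarrow> a \<odot>\<^bsub>M\<^esub> (x \<ominus>\<^bsub>M\<^esub> y) = a \<odot>\<^bsub>M\<^esub> x \<ominus>\<^bsub>M\<^esub> a \<odot>\<^bsub>M\<^esub> y"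
  using smult_assoc[of a "\<ominus>\<^bsub>A\<^esub> \<one>\<^bsub>A\<^esub>" y] smult_assoc[of "\<ominus>\<^bsub>A\<^esub> \<one>\<^bsub>A\<^esub>" a y]
  by (simp add: a_minus_def smult_r_distr smult_minus_one A.r_minus A.l_minus)

lemma submodule_iff:
  "submodule U A M \<longleftrightarrow> U \<subseteq> carrier M \<and> \<zero>\<^bsub>M\<^esub> \<in> U \<and> (\<forall>x\<in>U. \<forall>y\<in>U. x \<oplus>\<^bsub>M\<^esub> y \<in> U) \<and>
    (\<forall>a\<in>carrier A. \<forall>x\<in>U. a \<odot>\<^bsub>M\<^esub> x \<in> U)" (is "_ = ?R")
proof
  assume "submodule U A M"
  then show ?R
    by (auto simp: submodule_def submodule_axioms_def subgroup_def)
next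
  assume R: ?R
  have "\<ominus>\<^bsub>M\<^esub> x \<in> U" if "x \<in> U" for x
    using R that smult_minus_one[of x] by (metis A.a_inv_closed A.one_closed subsetD)
  then show "submodule U A M"
    using R by (auto simp: submodule_def submodule_axioms_def subgroup_def a_inv_def)
qed

lemma submodule_carrier: "submodule (carrier M) A M"
  by (simp add: submodule_iff)

lemma submodule_left_module:
  assumes "submodule W A M" shows "left_module A (M\<lparr>carrier := W\<rparr>)"
  using assms unfolding submodule_iff
  by (intro left_moduleI)
     (auto simp: A.ring_axioms M.a_ac smult_l_distr smult_r_distr smult_assoc subset_iff)

lemma submodule_submodule_iff:
  assumes "submodule W A M"
  shows "submodule U A (M\<lparr>carrier := W\<rparr>) \<longleftrightarrow> submodule U A M \<and> U \<subseteq> W"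
  using assms left_module.submodule_iff[OF submodule_left_module[OF assms], of U]
  by (auto simp: submodule_iff)

context
  fixes U assumes U: "submodule U A M"
begin

lemma sub_abelian_subgroup: "abelian_subgroup U M"
  using U by (intro abelian_subgroupI3 additive_subgroupI M.abelian_group_axioms)
    (simp add: submodule_def)

lemma mem_coset_iff:
  assumes "m \<in> carrier M" shows "x \<in> U +>\<^bsub>M\<^esub> m \<longleftrightarrow> x \<in> carrier M \<and> x \<ominus>\<^bsub>M\<^esub> m \<in> U"
proof -
  interpret abelian_subgroup U M by (rule sub_abelian_subgroup)
  show ?thesis
    using a_rcos_module[OF assms] a_elemrcos_carrier[OF assms] by (auto simp: a_minus_def)
qed

lemma coset_eq_iff:
  assumes "m \<in> carrier M" "m' \<in> carrier M"
  shows "U +>\<^bsub>M\<^esub> m = U +>\<^bsub>M\<^esub> m' \<longleftrightarrow> m \<ominus>\<^bsub>M\<^esub> m' \<in> U"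
proof -
  interpret abelian_subgroup U M by (rule sub_abelian_subgroup)
  show ?thesis
    using assms mem_coset_iff[OF assms(2), of m] a_rcos_self[OF assms(1)]
      a_repr_independence'[of m m'] by auto
qed

lemma coset_eq_self_iff:
  assumes "m \<in> carrier M" shows "U +>\<^bsub>M\<^esub> m = U \<longleftrightarrow> m \<in> U"
proof -
  have "U +>\<^bsub>M\<^esub> \<zero>\<^bsub>M\<^esub> = U"
    using U by (intro M.a_coset_add_zero) (simp add: submodule_iff)
  moreover have "\<ominus>\<^bsub>M\<^esub> \<zero>\<^bsub>M\<^esub> = \<zero>\<^bsub>M\<^esub>"
    by (rule M.minus_equality) simp_all
  ultimately show ?thesis
    using coset_eq_iff[OF assms M.zero_closed] assms by (metis M.minus_eq M.r_zero)
qed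

lemma coset_add:
  "\<lbrakk>m \<in> carrier M; m' \<in> carrier M\<rbrakk>
    \<Longrightarrow> (U +>\<^bsub>M\<^esub> m) <+>\<^bsub>M\<^esub> (U +>\<^bsub>M\<^esub> m') = U +>\<^bsub>M\<^esub> (m \<oplus>\<^bsub>M\<^esub> m')"
  using abelian_subgroup.a_rcos_sum[OF sub_abelian_subgroup] by blast

text \<open>The union over representatives that defines the scalar action on a quotient collapses,
  because all its members are the same coset.\<close>

lemma coset_smult:
  assumes "a \<in> carrier A" "m \<in> carrier M"
  shows "(\<Union>x\<in>U +>\<^bsub>M\<^esub> m. U +>\<^bsub>M\<^esub> (a \<odot>\<^bsub>M\<^esub> x)) = U +>\<^bsub>M\<^esub> (a \<odot>\<^bsub>M\<^esub> m)"
proof -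
  have "U +>\<^bsub>M\<^esub> (a \<odot>\<^bsub>M\<^esub> x) = U +>\<^bsub>M\<^esub> (a \<odot>\<^bsub>M\<^esub> m)" if "x \<in> U +>\<^bsub>M\<^esub> m" for x
    using that assms U by (simp add: mem_coset_iff coset_eq_iff submodule_iff flip: smult_minus)
  moreover have "m \<in> U +>\<^bsub>M\<^esub> m"
    using assms abelian_subgroup.a_rcos_self[OF sub_abelian_subgroup] by blast
  ultimately show ?thesis by blast
qed

lemma quot_carrier: "carrier (quot_module M U) = (\<lambda>m. U +>\<^bsub>M\<^esub> m) ` carrier M"
  by (auto simp: quot_module_def A_RCOSETS_def')

lemma quot_zero: "\<zero>\<^bsub>quot_module M U\<^esub> = U"
  by (simp add: quot_module_def)

lemma quot_add:
  "\<lbrakk>m \<in> carrier M; m' \<in> carrier M\<rbrakk>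
    \<Longrightarrow> (U +>\<^bsub>M\<^esub> m) \<oplus>\<^bsub>quot_module M U\<^esub> (U +>\<^bsub>M\<^esub> m') = U +>\<^bsub>M\<^esub> (m \<oplus>\<^bsub>M\<^esub> m')"
  by (simp add: quot_module_def coset_add)

lemma quot_smult:
  "\<lbrakk>a \<in> carrier A; m \<in> carrier M\<rbrakk>
    \<Longrightarrow> a \<odot>\<^bsub>quot_module M U\<^esub> (U +>\<^bsub>M\<^esub> m) = U +>\<^bsub>M\<^esub> (a \<odot>\<^bsub>M\<^esub> m)"
  by (simp add: quot_module_def coset_smult)

lemma quot_left_module: "left_module A (quot_module M U)"
proof (rule left_moduleI)
  have z: "U +>\<^bsub>M\<^esub> \<zero>\<^bsub>M\<^esub> = U"
    using U by (simp add: submodule_iff)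
  show "\<zero>\<^bsub>quot_module M U\<^esub> \<in> carrier (quot_module M U)"
    using z M.zero_closed by (auto simp: quot_zero quot_carrier image_iff)
  fix X assume "X \<in> carrier (quot_module M U)"
  then obtain m where m: "m \<in> carrier M" "X = U +>\<^bsub>M\<^esub> m"
    by (auto simp: quot_carrier)
  show "\<zero>\<^bsub>quot_module M U\<^esub> \<oplus>\<^bsub>quot_module M U\<^esub> X = X"
    using quot_add[OF M.zero_closed m(1)] m by (simp add: quot_zero z)
  show "\<zero>\<^bsub>A\<^esub> \<odot>\<^bsub>quot_module M U\<^esub> X = \<zero>\<^bsub>quot_module M U\<^esub>"
    using m by (simp add: quot_zero quot_smult z)
qed (auto simp: A.ring_axioms quot_carrier quot_add quot_smult M.a_ac smult_l_distr
      smult_r_distr smult_assoc)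

end

lemma maximal_submodule_imp_simple:
  assumes "maximal_submodule U A M"
  shows "simple_module A (quot_module M U)"
proof -
  have U: "submodule U A M" "U \<noteq> carrier M"
    and max: "\<And>V. submodule V A M \<Longrightarrow> U \<subseteq> V \<Longrightarrow> V = U \<or> V = carrier M"
    using assms by (auto simp: maximal_submodule_def)
  interpret Q: left_module A "quot_module M U" by (rule quot_left_module[OF U(1)])
  have sub: "U \<subseteq> carrier M" using U(1) by (simp add: submodule_iff)
  obtain m where m: "m \<in> carrier M" "m \<notin> U" using U(2) sub by auto
  have "U +>\<^bsub>M\<^esub> m \<noteq> U" using m coset_eq_self_iff[OF U(1)] by simp
  then have "carrier (quot_module M U) \<noteq> {U}"
    using m(1) by (auto simp: quot_carrier[OF U(1)])
  moreover have "N = {U} \<or> N = carrier (quot_module M U)" if N: "submodule N A (quot_module M U)" for N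
  proof -
    \<comment> \<open>The preimage of \<open>N\<close> in \<open>M\<close>. Maximality of
      \<open>U\<close> leaves two choices for it, and \<open>N\<close> is its image.\<close>
    define V where "V = {m \<in> carrier M. U +>\<^bsub>M\<^esub> m \<in> N}"
    have N': "N \<subseteq> carrier (quot_module M U)" "U \<in> N"
      "\<And>x y. x \<in> N \<Longrightarrow> y \<in> N \<Longrightarrow> x \<oplus>\<^bsub>quot_module M U\<^esub> y \<in> N"
      "\<And>a x. a \<in> carrier A \<Longrightarrow> x \<in> N \<Longrightarrow> a \<odot>\<^bsub>quot_module M U\<^esub> x \<in> N"
      using N unfolding Q.submodule_iff by (auto simp: quot_zero[OF U(1)])
    have "submodule V A M"
      unfolding submodule_iff
    proof (intro conjI ballI)
      show "V \<subseteq> carrier M" by (auto simp: V_def)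
      show "\<zero>\<^bsub>M\<^esub> \<in> V" using N'(2) sub by (simp add: V_def)
    next
      fix x y assume "x \<in> V" "y \<in> V"
      then show "x \<oplus>\<^bsub>M\<^esub> y \<in> V"
        using N'(3)[of "U +>\<^bsub>M\<^esub> x" "U +>\<^bsub>M\<^esub> y"] by (simp add: V_def quot_add[OF U(1)])
    next
      fix a x assume "a \<in> carrier A" "x \<in> V"
      then show "a \<odot>\<^bsub>M\<^esub> x \<in> V"
        using N'(4)[of a "U +>\<^bsub>M\<^esub> x"] by (simp add: V_def quot_smult[OF U(1)])
    qed
    moreover have "U \<subseteq> V"
    proof
      fix m assume "m \<in> U"
      then show "m \<in> V"
        using sub N'(2) coset_eq_self_iff[OF U(1), of m] by (auto simp: V_def)
    qed
    moreover have "N = (\<lambda>m. U +>\<^bsub>M\<^esub> m) ` V"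
    proof
      show "N \<subseteq> (\<lambda>m. U +>\<^bsub>M\<^esub> m) ` V"
      proof
        fix X assume "X \<in> N"
        then show "X \<in> (\<lambda>m. U +>\<^bsub>M\<^esub> m) ` V"
          using N'(1) by (auto simp: V_def quot_carrier[OF U(1)])
      qed
    qed (auto simp: V_def)
    moreover have "(\<lambda>m. U +>\<^bsub>M\<^esub> m) ` U = {U}"
    proof -
      have "U +>\<^bsub>M\<^esub> m = U" if "m \<in> U" for m
        using that sub coset_eq_self_iff[OF U(1)] by blast
      then show ?thesis using U(1) by (auto simp: submodule_iff image_iff)
    qed
    ultimately show ?thesis
      using max[of V] quot_carrier[OF U(1)] by auto
  qed
  ultimately show ?thesis
    by (simp add: simple_module_def quot_zero[OF U(1)])
qed

end

section \<open>Homomorphisms, surjections and subquotients\<close>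

lemma module_homD:
  assumes "g \<in> module_hom A P M"
  shows "\<And>x. x \<in> carrier P \<Longrightarrow> g x \<in> carrier M"
    "\<And>x y. \<lbrakk>x \<in> carrier P; y \<in> carrier P\<rbrakk> \<Longrightarrow> g (x \<oplus>\<^bsub>P\<^esub> y) = g x \<oplus>\<^bsub>M\<^esub> g y"
    "\<And>a x. \<lbrakk>a \<in> carrier A; x \<in> carrier P\<rbrakk> \<Longrightarrow> g (a \<odot>\<^bsub>P\<^esub> x) = a \<odot>\<^bsub>M\<^esub> g x"
  using assms by (auto simp: module_hom_def)

text \<open>The instances below are right multiplications by a path, from a projective onto a
  submodule of another one or onto the image of such a submodule in a quotient.\<close>

locale module_surjection = P: left_module A P + M: left_module A M
  for A :: "('a, 'r) ring_scheme" and P :: "('a, 'p) module" and M :: "('a, 'm) module" +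
  fixes g
  assumes hom: "g \<in> module_hom A P M" and surj: "g ` carrier P = carrier M"
begin

lemmas closed = module_homD(1)[OF hom]
lemmas add = module_homD(2)[OF hom]
lemmas smult = module_homD(3)[OF hom]

lemma zero [simp]: "g \<zero>\<^bsub>P\<^esub> = \<zero>\<^bsub>M\<^esub>"
  using smult[of "\<zero>\<^bsub>A\<^esub>" "\<zero>\<^bsub>P\<^esub>"] closed[of "\<zero>\<^bsub>P\<^esub>"] by simp

lemma minus: "\<lbrakk>p \<in> carrier P; q \<in> carrier P\<rbrakk> \<Longrightarrow> g (p \<ominus>\<^bsub>P\<^esub> q) = g p \<ominus>\<^bsub>M\<^esub> g q"
  using smult[of "\<ominus>\<^bsub>A\<^esub> \<one>\<^bsub>A\<^esub>" q]
  by (simp add: a_minus_def add P.smult_minus_one M.smult_minus_one closed)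

lemma submodule_preimage:
  "submodule V A M \<Longrightarrow> submodule {p \<in> carrier P. g p \<in> V} A P"
  by (auto simp: P.submodule_iff M.submodule_iff add smult)

lemma image_preimage: "V \<subseteq> carrier M \<Longrightarrow> g ` {p \<in> carrier P. g p \<in> V} = V"
  by (auto simp: subset_iff image_iff simp flip: surj)

text \<open>As \<open>g\<close> is onto, a submodule of \<open>M\<close> is the image of its
  preimage, so one strictly between \<open>V\<close> and \<open>M\<close> would pull back to one
  strictly between their preimages.\<close>

lemma maximal_submodule_preimage:
  assumes V: "submodule V A M" and max: "maximal_submodule {p \<in> carrier P. g p \<in> V} A P"
  shows "maximal_submodule V A M"
  unfolding maximal_submodule_def
proof (intro conjI allI impI)
  show "V \<noteq> carrier M"
    using max closed by (auto simp: maximal_submodule_def)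
  fix W assume W: "submodule W A M" "V \<subseteq> W"
  let ?pre = "\<lambda>V. {p \<in> carrier P. g p \<in> V}"
  have "?pre W = ?pre V \<or> ?pre W = carrier P"
    using max submodule_preimage[OF W(1)] W(2) unfolding maximal_submodule_def by blast
  then show "W = V \<or> W = carrier M"
  proof
    assume "?pre W = ?pre V"
    then have "g ` ?pre W = g ` ?pre V" by (rule arg_cong)
    then show ?thesis
      using W(1) V image_preimage[of W] image_preimage[of V] unfolding M.submodule_iff by metis
  next
    assume "?pre W = carrier P"
    then have "g ` ?pre W = g ` carrier P" by (rule arg_cong)
    then show ?thesis
      using W(1) image_preimage[of W] unfolding M.submodule_iff surj by metis
  qed
qed (fact V)

text \<open>A coset is sent to its full preimage, which avoids choosing representatives. The
  quotient of \<open>M\<close> is the source because \<open>composition_factor\<close> and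
  \<open>good_module\<close> ask for maps in this direction.\<close>

lemma quot_iso:
  assumes V: "submodule V A M"
  shows "module_iso A (quot_module M V) (quot_module P {p \<in> carrier P. g p \<in> V})"
proof -
  let ?K = "{p \<in> carrier P. g p \<in> V}"
  note K = submodule_preimage[OF V]
  define f where "f = (\<lambda>X\<in>carrier (quot_module M V). {p \<in> carrier P. g p \<in> X})"
  have carr: "carrier (quot_module M V) = (\<lambda>p. V +>\<^bsub>M\<^esub> g p) ` carrier P"
    unfolding M.quot_carrier[OF V] surj[symmetric] by (auto simp: image_iff)
  have f: "f (V +>\<^bsub>M\<^esub> g p) = ?K +>\<^bsub>P\<^esub> p" if "p \<in> carrier P" for p
    using that
    by (auto simp: f_def carr P.mem_coset_iff[OF K] M.mem_coset_iff[OF V] closed minus)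
  have "f \<in> module_hom A (quot_module M V) (quot_module P ?K)"
    unfolding module_hom_def
  proof (intro CollectI conjI ballI)
    show "f \<in> carrier (quot_module M V) \<rightarrow>\<^sub>E carrier (quot_module P ?K)"
    proof (rule PiE_I)
      show "f X \<in> carrier (quot_module P ?K)" if "X \<in> carrier (quot_module M V)" for X
        using that by (auto simp: carr f P.quot_carrier[OF K])
    qed (simp add: f_def)
  qed (auto simp: carr f M.quot_add[OF V] P.quot_add[OF K] M.quot_smult[OF V] P.quot_smult[OF K]
       closed simp flip: add smult)
  moreover have "bij_betw f (carrier (quot_module M V)) (carrier (quot_module P ?K))"
    unfolding bij_betw_def
  proof
    show "inj_on f (carrier (quot_module M V))"
    proof (rule inj_onI)
      fix X Y assume XY: "X \<in> carrier (quot_module M V)" "Y \<in> carrier (quot_module M V)" "f X = f Y"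
      then obtain p q where pq: "p \<in> carrier P" "X = V +>\<^bsub>M\<^esub> g p" "q \<in> carrier P" "Y = V +>\<^bsub>M\<^esub> g q"
        unfolding carr by blast
      then have "?K +>\<^bsub>P\<^esub> p = ?K +>\<^bsub>P\<^esub> q"
        using XY(3) by (simp add: f)
      then show "X = Y"
        using pq by (simp add: P.coset_eq_iff[OF K] M.coset_eq_iff[OF V] closed minus)
    qed
    show "f ` carrier (quot_module M V) = carrier (quot_module P ?K)"
      by (auto simp: carr f P.quot_carrier[OF K] image_iff)
  qed
  ultimately show ?thesis
    by (auto simp: module_iso_def)
qed

end

lemma module_hom_zero:
  assumes "left_module A M" "left_module A N" "f \<in> module_hom A M N"
  shows "f \<zero>\<^bsub>M\<^esub> = \<zero>\<^bsub>N\<^esub>"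
proof -
  interpret M: left_module A M by fact
  interpret N: left_module A N by fact
  show ?thesis
    using module_homD(3)[OF assms(3), of "\<zero>\<^bsub>A\<^esub>" "\<zero>\<^bsub>M\<^esub>"] module_homD(1)[OF assms(3), of "\<zero>\<^bsub>M\<^esub>"] by simp
qed

lemma subquot_left_module:
  assumes "left_module A M" "submodule W A M" "submodule V A M" "V \<subseteq> W"
  shows "left_module A (subquot M W V)"
proof -
  interpret M: left_module A M by fact
  interpret W: left_module A "M\<lparr>carrier := W\<rparr>" using assms(2) by (rule M.submodule_left_module)
  show ?thesis
    unfolding subquot_def
    by (rule W.quot_left_module) (use assms in \<open>simp add: M.submodule_submodule_iff\<close>)
qed

lemma subquot_simps:
  assumes "left_module A M" "submodule W A M" "submodule V A M" "V \<subseteq> W"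
  shows "carrier (subquot M W V) = (\<lambda>w. V +>\<^bsub>M\<^esub> w) ` W" "\<zero>\<^bsub>subquot M W V\<^esub> = V"
    "\<And>a w. \<lbrakk>a \<in> carrier A; w \<in> W\<rbrakk> \<Longrightarrow> a \<odot>\<^bsub>subquot M W V\<^esub> (V +>\<^bsub>M\<^esub> w) = V +>\<^bsub>M\<^esub> (a \<odot>\<^bsub>M\<^esub> w)"
    "\<And>w. w \<in> W \<Longrightarrow> V +>\<^bsub>M\<^esub> w = V \<longleftrightarrow> w \<in> V"
proof -
  interpret M: left_module A M by fact
  interpret W: left_module A "M\<lparr>carrier := W\<rparr>" using assms(2) by (rule M.submodule_left_module)
  have V: "submodule V A (M\<lparr>carrier := W\<rparr>)"
    using assms by (simp add: M.submodule_submodule_iff)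
  show "carrier (subquot M W V) = (\<lambda>w. V +>\<^bsub>M\<^esub> w) ` W" "\<zero>\<^bsub>subquot M W V\<^esub> = V"
    "\<And>a w. \<lbrakk>a \<in> carrier A; w \<in> W\<rbrakk> \<Longrightarrow> a \<odot>\<^bsub>subquot M W V\<^esub> (V +>\<^bsub>M\<^esub> w) = V +>\<^bsub>M\<^esub> (a \<odot>\<^bsub>M\<^esub> w)"
    "\<And>w. w \<in> W \<Longrightarrow> V +>\<^bsub>M\<^esub> w = V \<longleftrightarrow> w \<in> V"
    unfolding subquot_def
    using W.quot_carrier[OF V] W.quot_zero[OF V] W.quot_smult[OF V] W.coset_eq_self_iff[OF V] by auto
qed

section \<open>Truncated path algebras of functional quivers\<close>

text \<open>
  The lowest term argument behind both the defining ideal and the submodules of \<open>P(x)\<close>: \<open>T\<close> stands for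
  the sequences of coefficients at the paths from a fixed vertex, \<open>\<tau> l\<close> for the end of the path of
  length \<open>l\<close>, and the shift by \<open>d\<close> is left multiplication by the path of length \<open>d\<close> from \<open>\<tau> i\<close>.
\<close>

lemma least_closed_under_shifts:
  fixes T :: "(nat \<Rightarrow> 'k::field) set" and D :: "nat set" and \<tau> :: "nat \<Rightarrow> 'v"
  assumes supp: "\<And>f. f \<in> T \<Longrightarrow> finite {l. f l \<noteq> 0} \<and> {l. f l \<noteq> 0} \<subseteq> D"
    and zero: "(\<lambda>l. 0) \<in> T"
    and add: "\<And>f g. f \<in> T \<Longrightarrow> g \<in> T \<Longrightarrow> (\<lambda>l. f l + g l) \<in> T"
    and scale: "\<And>c f. f \<in> T \<Longrightarrow> (\<lambda>l. c * f l) \<in> T"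
    and shift: "\<And>f i d. \<lbrakk>f \<in> T; i + d \<in> D\<rbrakk>
      \<Longrightarrow> (\<lambda>l. if l \<in> D \<and> d \<le> l \<and> \<tau> (l - d) = \<tau> i then f (l - d) else 0) \<in> T"
    and top: "\<And>l. l \<in> D \<Longrightarrow> m \<le> l \<Longrightarrow> (\<lambda>j. if j = l then 1 else 0) \<in> T"
    and down: "\<And>i j. j \<in> D \<Longrightarrow> i \<le> j \<Longrightarrow> i \<in> D"
  obtains i where "i \<le> m" "\<And>l. l < i \<Longrightarrow> l \<in> D"
    "\<And>f. f \<in> T \<longleftrightarrow> finite {l. f l \<noteq> 0} \<and> {l. f l \<noteq> 0} \<subseteq> D \<and> (\<forall>l<i. f l = 0)"
proof -
  define \<delta> :: "nat \<Rightarrow> nat \<Rightarrow> 'k" where "\<delta> l j = (if j = l then 1 else 0)" for l j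
  have comb: "(\<lambda>j. if j \<in> F then g j else 0) \<in> T" if "finite F" "\<And>l. l \<in> F \<Longrightarrow> \<delta> l \<in> T" for F g
    using that
  proof (induction F)
    case (insert l F)
    have "(\<lambda>j. (if j \<in> F then g j else 0) + g l * \<delta> l j) \<in> T"
      using insert by (intro add scale) auto
    moreover have "(\<lambda>j. (if j \<in> F then g j else 0) + g l * \<delta> l j) = (\<lambda>j. if j \<in> insert l F then g j else 0)"
      using insert by (auto simp: \<delta>_def)
    ultimately show ?case by simp
  qed (simp add: zero)
  \<comment> \<open>Subtracting the terms above the lowest one, which are in \<open>T\<close>
    already, and dividing by the lowest coefficient isolates the lowest term.\<close>
  have step: "\<delta> l \<in> T"
    if g: "g \<in> T" "g l \<noteq> 0" "\<And>j. j < l \<Longrightarrow> g j = 0" and above: "\<And>j. j \<in> D \<Longrightarrow> l < j \<Longrightarrow> \<delta> j \<in> T" for g l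
  proof -
    let ?F = "{j. g j \<noteq> 0} - {l}"
    have "(\<lambda>j. if j \<in> ?F then g j else 0) \<in> T"
    proof (rule comb)
      show "finite ?F" using supp[OF g(1)] by simp
      fix j assume j: "j \<in> ?F"
      then have "l < j" using g(3)[of j] by (cases j l rule: linorder_cases) auto
      moreover have "j \<in> D" using j supp[OF g(1)] by blast
      ultimately show "\<delta> j \<in> T" using above by blast
    qed
    then have "(\<lambda>j. inverse (g l) * (g j + (- 1) * (if j \<in> ?F then g j else 0))) \<in> T"
      by (intro scale add g(1))
    moreover have "(\<lambda>j. inverse (g l) * (g j + (- 1) * (if j \<in> ?F then g j else 0))) = \<delta> l"
      using g(2) by (auto simp: \<delta>_def)
    ultimately show ?thesis by simp
  qed
  have lowest: "\<delta> l \<in> T" if f: "f \<in> T" "f i \<noteq> 0" "\<And>j. j < i \<Longrightarrow> f j = 0" and l: "l \<in> D" "i \<le> l" for f i l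
    using l
  proof (induction "m - l" arbitrary: l rule: less_induct)
    case less
    show ?case
    proof (cases "m \<le> l")
      case True
      then show ?thesis using top[of l] less.prems by (simp add: \<delta>_def[abs_def])
    next
      case False
      \<comment> \<open>Shifting by \<open>l - i\<close> moves the lowest term of \<open>f\<close>
        from \<open>i\<close> to \<open>l\<close>. It passes the test on \<open>\<tau>\<close>,
        since at \<open>l\<close> both sides are \<open>\<tau> i\<close>.\<close>
      let ?g = "\<lambda>j. if j \<in> D \<and> l - i \<le> j \<and> \<tau> (j - (l - i)) = \<tau> i then f (j - (l - i)) else 0"
      have "?g \<in> T"
        using shift[OF f(1), of i "l - i"] less.prems by simp
      moreover have "?g l \<noteq> 0" "\<And>j. j < l \<Longrightarrow> ?g j = 0"
        using less.prems f by auto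
      moreover have "\<delta> j \<in> T" if "j \<in> D" "l < j" for j
        by (rule less.hyps) (use that less.prems False in simp_all)
      ultimately show ?thesis
        by (rule step)
    qed
  qed
  let ?P = "\<lambda>i. \<forall>l\<in>D. i \<le> l \<longrightarrow> \<delta> l \<in> T"
  define i where "i = (LEAST i. ?P i)"
  have m: "?P m" using top by (simp add: \<delta>_def[abs_def])
  have i: "?P i" unfolding i_def using m by (rule LeastI)
  have least: "i \<le> j" if "?P j" for j unfolding i_def using that by (rule Least_le)
  show ?thesis
  proof
    show "i \<le> m" using m by (rule least)
    \<comment> \<open>If \<open>l\<close> were outside \<open>D\<close>, no element of
      \<open>D\<close> would lie above it, so \<open>?P l\<close> would hold vacuously and
      contradict the minimality of \<open>i\<close>.\<close>
    show "l \<in> D" if "l < i" for l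
      using least[of l] that down by (meson linorder_not_less)
    fix f
    have "f l = 0" if "f \<in> T" "l < i" for l
    proof (rule ccontr)
      assume "f l \<noteq> 0"
      define j where "j = (LEAST j. f j \<noteq> 0)"
      have "f j \<noteq> 0" "\<And>k. k < j \<Longrightarrow> f k = 0" "j \<le> l"
        unfolding j_def using \<open>f l \<noteq> 0\<close>
        by (rule LeastI, use not_less_Least[of _ "\<lambda>j. f j \<noteq> 0"] in blast)
           (use \<open>f l \<noteq> 0\<close> in \<open>rule Least_le\<close>)
      then have "i \<le> j"
        using lowest \<open>f \<in> T\<close> by (intro least) blast
      then show False using \<open>j \<le> l\<close> \<open>l < i\<close> by simp
    qed
    moreover have "f \<in> T" if f: "finite {l. f l \<noteq> 0}" "{l. f l \<noteq> 0} \<subseteq> D" "\<forall>l<i. f l = 0"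
    proof -
      have "(\<lambda>j. if j \<in> {l. f l \<noteq> 0} then f j else 0) \<in> T"
      proof (rule comb)
        fix l assume "l \<in> {l. f l \<noteq> 0}"
        then have "l \<in> D" "i \<le> l" using f(2,3) by (auto simp: not_less[symmetric])
        then show "\<delta> l \<in> T" using i by blast
      qed (fact f(1))
      moreover have "(\<lambda>j. if j \<in> {l. f l \<noteq> 0} then f j else 0) = f" by auto
      ultimately show ?thesis by simp
    qed
    ultimately show "f \<in> T \<longleftrightarrow> finite {l. f l \<noteq> 0} \<and> {l. f l \<noteq> 0} \<subseteq> D \<and> (\<forall>l<i. f l = 0)"
      using supp[of f] by blast
  qed
qed

text \<open>
  \<open>co a x l\<close> is the coefficient of \<open>a\<close> at the path of length \<open>l\<close> from \<open>x\<close>, and the paths of length less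
  than \<open>L x\<close> are the nonzero ones. Here and below lengths count arrows, not vertices.
\<close>

locale truncated_path_algebra =
  fixes A :: "('k::field, 'a) module" and e :: "'v \<Rightarrow> 'a" and V :: "'v set"
    and s :: "'v \<Rightarrow> 'v" and L :: "'v \<Rightarrow> nat" and co :: "'a \<Rightarrow> 'v \<Rightarrow> nat \<Rightarrow> 'k"
  assumes ring: "ring A"
    and finite_V: "finite V"
    and L_pos: "x \<in> V \<Longrightarrow> 0 < L x"
    and L_step: "\<lbrakk>x \<in> V; Suc l < L x\<rbrakk> \<Longrightarrow> s x \<in> V \<and> l < L (s x)"
    and co_bij: "bij_betw co (carrier A) {f. \<forall>x l. f x l \<noteq> 0 \<longrightarrow> x \<in> V \<and> l < L x}"
    and co_add: "\<lbrakk>a \<in> carrier A; b \<in> carrier A\<rbrakk> \<Longrightarrow> co (a \<oplus>\<^bsub>A\<^esub> b) x l = co a x l + co b x l"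
    and co_mult: "\<lbrakk>a \<in> carrier A; b \<in> carrier A\<rbrakk> \<Longrightarrow> co (a \<otimes>\<^bsub>A\<^esub> b) x l =
      (if x \<in> V \<and> l < L x then \<Sum>k\<le>l. co a ((s ^^ k) x) (l - k) * co b x k else 0)"
    and co_one: "co \<one>\<^bsub>A\<^esub> x l = (if x \<in> V \<and> l = 0 then 1 else 0)"
    and smult_closed: "a \<in> carrier A \<Longrightarrow> c \<odot>\<^bsub>A\<^esub> a \<in> carrier A"
    and co_smult: "a \<in> carrier A \<Longrightarrow> co (c \<odot>\<^bsub>A\<^esub> a) x l = c * co a x l"
    and e_closed: "x \<in> V \<Longrightarrow> e x \<in> carrier A"
    and co_e: "x \<in> V \<Longrightarrow> co (e x) y l = (if y = x \<and> l = 0 then 1 else 0)"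
begin

sublocale ring A by (rule ring)

abbreviation P :: "'v \<Rightarrow> ('a, 'a) module" where "P \<equiv> proj_module A e"

abbreviation t :: "'v \<Rightarrow> nat \<Rightarrow> 'v" where "t x l \<equiv> (s ^^ l) x"

lemma co_eqI: "\<lbrakk>a \<in> carrier A; b \<in> carrier A; \<And>x l. co a x l = co b x l\<rbrakk> \<Longrightarrow> a = b"
  using co_bij by (auto simp: bij_betw_def inj_on_def fun_eq_iff)

lemma co_supp: "\<lbrakk>a \<in> carrier A; \<not> (x \<in> V \<and> l < L x)\<rbrakk> \<Longrightarrow> co a x l = 0"
  using co_bij by (auto simp: bij_betw_def)

lemma co_zero [simp]: "co \<zero>\<^bsub>A\<^esub> x l = 0"
  by (metis add_cancel_right_right co_add l_zero zero_closed)

lemma co_obtain: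
  assumes "\<And>x l. f x l \<noteq> 0 \<Longrightarrow> x \<in> V \<and> l < L x"
  obtains a where "a \<in> carrier A" "\<And>x l. co a x l = f x l"
proof -
  have "f \<in> co ` carrier A"
    using co_bij assms by (auto simp: bij_betw_def)
  then show ?thesis using that by auto
qed

text \<open>Removing the first \<open>l\<close> arrows from a nonzero path leaves a nonzero path,
  which bounds \<open>L\<close> from below at the vertex reached.\<close>

lemma t_in_V: "\<lbrakk>x \<in> V; l < L x\<rbrakk> \<Longrightarrow> t x l \<in> V \<and> L x \<le> L (t x l) + l"
proof (induction l)
  case (Suc l)
  then have IH: "t x l \<in> V" "L x \<le> L (t x l) + l" by auto
  then have "Suc (L x - Suc (Suc l)) < L (t x l)"
    using Suc.prems by simp
  from L_step[OF IH(1) this] show ?case using Suc.prems by auto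
qed simp

text \<open>The path of length \<open>l\<close> from \<open>x\<close> as an element of the algebra,
  zero if the path is too long. It exists because \<open>co\<close> is a bijection.\<close>

definition pth :: "'v \<Rightarrow> nat \<Rightarrow> 'a" where
  "pth x l = (SOME a. a \<in> carrier A \<and> co a = (\<lambda>y m. if y = x \<and> m = l \<and> x \<in> V \<and> l < L x then 1 else 0))"

lemma pth: "pth x l \<in> carrier A \<and> co (pth x l) = (\<lambda>y m. if y = x \<and> m = l \<and> x \<in> V \<and> l < L x then 1 else 0)"
  unfolding pth_def
proof (rule someI_ex)
  obtain a where "a \<in> carrier A" "\<And>y m. co a y m = (if y = x \<and> m = l \<and> x \<in> V \<and> l < L x then 1 else 0)"
    by (rule co_obtain[of "\<lambda>y m. if y = x \<and> m = l \<and> x \<in> V \<and> l < L x then 1 else 0"]) (auto split: if_splits)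
  then show "\<exists>a. a \<in> carrier A \<and> co a = (\<lambda>y m. if y = x \<and> m = l \<and> x \<in> V \<and> l < L x then 1 else 0)"
    by (intro exI[of _ a]) auto
qed

lemma pth_closed [simp]: "pth x l \<in> carrier A" and
  co_pth: "co (pth x l) y m = (if y = x \<and> m = l \<and> x \<in> V \<and> l < L x then 1 else 0)"
  using pth by auto

lemma pth_0: "x \<in> V \<Longrightarrow> pth x 0 = e x"
  by (rule co_eqI) (auto simp: e_closed co_pth co_e L_pos)

lemma co_pth_mult:
  assumes "a \<in> carrier A" "x \<in> V" "l < L x"
  shows "co (pth y m \<otimes>\<^bsub>A\<^esub> a) x l = (if m \<le> l \<and> t x (l - m) = y then co a x (l - m) else 0)"
proof -
  \<comment> \<open>Only the cut after \<open>l - m\<close> arrows contributes. For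
    \<open>m > l\<close> truncated subtraction makes this \<open>0\<close>, which the condition
    \<open>m \<le> l\<close> has to exclude.\<close>
  have eq: "co (pth y m) (t x k) (l - k) * co a x k =
      (if k = l - m then if m \<le> l \<and> t x (l - m) = y then co a x (l - m) else 0 else 0)" if "k \<le> l" for k
  proof -
    have V: "t x k \<in> V" "l - k < L (t x k)"
      using that t_in_V[OF assms(2), of k] assms(3) by auto
    show ?thesis
    proof (cases "m \<le> l \<and> k = l - m")
      case True
      then have "l - k = m" by simp
      then show ?thesis using True V by (auto simp: co_pth)
    next
      case False
      then have "l - k \<noteq> m" using that by auto
      then show ?thesis using False by (auto simp: co_pth)
    qed
  qed
  have "co (pth y m \<otimes>\<^bsub>A\<^esub> a) x l = (\<Sum>k\<le>l. co (pth y m) (t x k) (l - k) * co a x k)"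
    using assms by (simp add: co_mult)
  also have "\<dots> = (\<Sum>k\<le>l. if k = l - m then if m \<le> l \<and> t x (l - m) = y then co a x (l - m) else 0 else 0)"
    by (rule sum.cong[OF refl]) (rule eq, simp)
  finally show ?thesis by (simp add: sum.delta)
qed

lemma co_mult_pth:
  assumes "a \<in> carrier A" "y \<in> V"
  shows "co (a \<otimes>\<^bsub>A\<^esub> pth y m) x l = (if x = y \<and> m \<le> l \<and> l < L y then co a (t y m) (l - m) else 0)"
proof (cases "x \<in> V \<and> l < L x")
  case True
  have "co (a \<otimes>\<^bsub>A\<^esub> pth y m) x l = (\<Sum>k\<le>l. co a (t x k) (l - k) * co (pth y m) x k)"
    using assms True by (simp add: co_mult)
  also have "\<dots> = (\<Sum>k\<le>l. if k = m then if x = y \<and> m \<le> l \<and> l < L y then co a (t y m) (l - m) else 0 else 0)"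
    using True by (intro sum.cong) (auto simp: co_pth)
  finally show ?thesis by (simp add: sum.delta)
qed (use assms in \<open>auto simp: co_supp\<close>)

text \<open>Scalars act through central elements of the algebra. So submodules are subspaces over
  \<open>K\<close>, and multiplication by a scalar is a module endomorphism.\<close>

lemma smult_one_mult: "a \<in> carrier A \<Longrightarrow> (c \<odot>\<^bsub>A\<^esub> \<one>\<^bsub>A\<^esub>) \<otimes>\<^bsub>A\<^esub> a = c \<odot>\<^bsub>A\<^esub> a"
  and mult_smult_one: "a \<in> carrier A \<Longrightarrow> a \<otimes>\<^bsub>A\<^esub> (c \<odot>\<^bsub>A\<^esub> \<one>\<^bsub>A\<^esub>) = c \<odot>\<^bsub>A\<^esub> a"
proof -
  assume a: "a \<in> carrier A"
  show "(c \<odot>\<^bsub>A\<^esub> \<one>\<^bsub>A\<^esub>) \<otimes>\<^bsub>A\<^esub> a = c \<odot>\<^bsub>A\<^esub> a"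
  proof (rule co_eqI)
    fix x l
    show "co ((c \<odot>\<^bsub>A\<^esub> \<one>\<^bsub>A\<^esub>) \<otimes>\<^bsub>A\<^esub> a) x l = co (c \<odot>\<^bsub>A\<^esub> a) x l"
    proof (cases "x \<in> V \<and> l < L x")
      case True
      have "(\<Sum>k\<le>l. co (c \<odot>\<^bsub>A\<^esub> \<one>\<^bsub>A\<^esub>) (t x k) (l - k) * co a x k) = (\<Sum>k\<le>l. if k = l then c * co a x k else 0)"
        using t_in_V[of x] True by (intro sum.cong) (auto simp: co_smult co_one)
      then show ?thesis
        using True a by (simp add: co_mult co_smult smult_closed)
    qed (use a in \<open>simp add: co_mult co_smult smult_closed co_supp\<close>)
  qed (use a in \<open>simp_all add: smult_closed\<close>)
  show "a \<otimes>\<^bsub>A\<^esub> (c \<odot>\<^bsub>A\<^esub> \<one>\<^bsub>A\<^esub>) = c \<odot>\<^bsub>A\<^esub> a"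
  proof (rule co_eqI)
    fix x l
    show "co (a \<otimes>\<^bsub>A\<^esub> (c \<odot>\<^bsub>A\<^esub> \<one>\<^bsub>A\<^esub>)) x l = co (c \<odot>\<^bsub>A\<^esub> a) x l"
    proof (cases "x \<in> V \<and> l < L x")
      case True
      have "(\<Sum>k\<le>l. co a (t x k) (l - k) * co (c \<odot>\<^bsub>A\<^esub> \<one>\<^bsub>A\<^esub>) x k) = (\<Sum>k\<le>l. if k = 0 then c * co a x l else 0)"
        using True by (intro sum.cong) (auto simp: co_smult co_one)
      then show ?thesis
        using True a by (simp add: co_mult co_smult smult_closed)
    qed (use a in \<open>simp add: co_mult co_smult smult_closed co_supp\<close>)
  qed (use a in \<open>simp_all add: smult_closed\<close>)
qed

section \<open>The projectives and their submodules\<close>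

lemma carrier_P: "x \<in> V \<Longrightarrow> carrier (P x) = {a \<in> carrier A. \<forall>y l. y \<noteq> x \<longrightarrow> co a y l = 0}"
proof -
  assume x: "x \<in> V"
  have "a = a \<otimes>\<^bsub>A\<^esub> pth x 0" if "a \<in> carrier A" "\<forall>y l. y \<noteq> x \<longrightarrow> co a y l = 0" for a
  proof (rule co_eqI)
    fix y l show "co a y l = co (a \<otimes>\<^bsub>A\<^esub> pth x 0) y l"
      using that x by (cases "y = x"; cases "l < L x") (auto simp: co_mult_pth co_supp)
  qed (use that in auto)
  then show ?thesis
    using x by (auto simp: proj_module_def pth_0[symmetric] co_mult_pth)
qed

lemma P_simps [simp]: "\<zero>\<^bsub>P x\<^esub> = \<zero>\<^bsub>A\<^esub>" "add (P x) = add A" "smult (P x) = mult A"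
  by (simp_all add: proj_module_def)

lemma P_left_module: assumes "x \<in> V" shows "left_module A (P x)"
  by (rule left_moduleI)
     (use assms in \<open>auto simp: carrier_P ring_axioms co_add a_ac l_distr r_distr m_assoc
       co_mult intro!: sum.neutral\<close>)

text \<open>This is the \<open>i\<close>-th power of the radical applied to \<open>P x\<close>;
  \<open>submodule_imp_U\<close> shows that there are no other submodules.\<close>

definition U :: "'v \<Rightarrow> nat \<Rightarrow> 'a set" where
  "U x i = {a \<in> carrier (P x). \<forall>l<i. co a x l = 0}"

lemma pth_in_P: "x \<in> V \<Longrightarrow> pth x l \<in> carrier (P x)"
  by (auto simp: carrier_P co_pth)

lemma e_in_P: "x \<in> V \<Longrightarrow> e x \<in> carrier (P x)"
  using pth_in_P[of x 0] by (simp add: pth_0)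

lemma P_closed: "x \<in> V \<Longrightarrow> a \<in> carrier (P x) \<Longrightarrow> a \<in> carrier A"
  by (simp add: carrier_P)

lemma pth_in_U_iff: "x \<in> V \<Longrightarrow> pth x l \<in> U x i \<longleftrightarrow> i \<le> l \<or> L x \<le> l"
  by (auto simp: U_def pth_in_P co_pth)

lemma submodule_U: assumes "x \<in> V" shows "submodule (U x i) A (P x)"
proof -
  interpret P: left_module A "P x" using assms by (rule P_left_module)
  have "co (a \<otimes>\<^bsub>A\<^esub> b) x l = 0"
    if "a \<in> carrier A" "b \<in> carrier (P x)" "\<forall>l<i. co b x l = 0" "l < i" for a b l
    using that P_closed[OF assms] by (auto simp: co_mult intro!: sum.neutral)
  moreover have "a \<otimes>\<^bsub>A\<^esub> b \<in> carrier (P x)" if "a \<in> carrier A" "b \<in> carrier (P x)" for a b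
    using P.smult_closed[OF that] by simp
  moreover have "a \<oplus>\<^bsub>A\<^esub> b \<in> U x i" if "a \<in> U x i" "b \<in> U x i" for a b
    using that by (simp add: U_def carrier_P[OF assms] co_add)
  ultimately show ?thesis
    unfolding P.submodule_iff by (simp add: U_def) (simp add: carrier_P[OF assms])
qed

lemma U_0: "U x 0 = carrier (P x)"
  by (simp add: U_def)

lemma U_L: assumes "x \<in> V" "L x \<le> i" shows "U x i = {\<zero>\<^bsub>A\<^esub>}"
proof -
  have "a = \<zero>\<^bsub>A\<^esub>" if "a \<in> U x i" for a
    using that assms
    by (intro co_eqI) (auto simp: U_def carrier_P, metis co_supp less_le_trans)
  then show ?thesis using assms by (auto simp: U_def carrier_P)
qed

lemma U_antimono: "i \<le> j \<Longrightarrow> U x j \<subseteq> U x i"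
  by (auto simp: U_def)

lemma U_neq: "\<lbrakk>x \<in> V; i < j; i < L x\<rbrakk> \<Longrightarrow> U x i \<noteq> U x j"
  using pth_in_U_iff[of x i i] pth_in_U_iff[of x i j] by auto

text \<open>The lowest term argument for the coefficients of \<open>N\<close> at paths from
  \<open>x\<close>. Lengths stay below \<open>L x\<close>, so with \<open>m = L x\<close> its
  hypothesis on long paths is vacuous.\<close>

lemma submodule_imp_U:
  assumes x: "x \<in> V" and N: "submodule N A (P x)"
  obtains i where "i \<le> L x" "N = U x i"
proof -
  interpret P: left_module A "P x" using x by (rule P_left_module)
  have N': "N \<subseteq> carrier (P x)" "\<zero>\<^bsub>A\<^esub> \<in> N"
    "\<And>a b. a \<in> N \<Longrightarrow> b \<in> N \<Longrightarrow> a \<oplus>\<^bsub>A\<^esub> b \<in> N"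
    "\<And>a b. a \<in> carrier A \<Longrightarrow> b \<in> N \<Longrightarrow> a \<otimes>\<^bsub>A\<^esub> b \<in> N"
    using N unfolding P.submodule_iff by auto
  have NA: "a \<in> carrier A" if "a \<in> N" for a
    using that N'(1) P_closed[OF x] by blast
  let ?T = "(\<lambda>a. co a x) ` N"
  have "finite {l. f l \<noteq> 0} \<and> {l. f l \<noteq> 0} \<subseteq> {..<L x}" if "f \<in> ?T" for f
  proof -
    have "{l. f l \<noteq> 0} \<subseteq> {..<L x}"
      using that NA co_supp by (auto simp: subset_iff)
    then show ?thesis by (auto intro: finite_subset)
  qed
  moreover have "(\<lambda>l. 0) \<in> ?T"
    using N'(2) by (intro image_eqI[of _ _ "\<zero>\<^bsub>A\<^esub>"]) auto
  moreover have "(\<lambda>l. f l + g l) \<in> ?T" if "f \<in> ?T" "g \<in> ?T" for f g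
  proof -
    from that obtain a b where "a \<in> N" "f = co a x" "b \<in> N" "g = co b x" by auto
    then show ?thesis
      using N'(3) NA by (intro image_eqI[of _ _ "a \<oplus>\<^bsub>A\<^esub> b"]) (auto simp: co_add)
  qed
  moreover have "(\<lambda>l. c * f l) \<in> ?T" if "f \<in> ?T" for c f
  proof -
    from that obtain a where a: "a \<in> N" "f = co a x" by auto
    have "c \<odot>\<^bsub>A\<^esub> a \<in> N"
      using N'(4)[OF _ a(1), of "c \<odot>\<^bsub>A\<^esub> \<one>\<^bsub>A\<^esub>"] NA[OF a(1)] by (simp add: smult_one_mult smult_closed)
    then show ?thesis
      using a NA by (intro image_eqI[of _ _ "c \<odot>\<^bsub>A\<^esub> a"]) (auto simp: co_smult)
  qed
  moreover have "(\<lambda>l. if l \<in> {..<L x} \<and> d \<le> l \<and> t x (l - d) = t x i then f (l - d) else 0) \<in> ?T"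
    if f: "f \<in> ?T" and "i + d \<in> {..<L x}" for f i d
  proof -
    from f obtain a where a: "a \<in> N" "f = co a x" by auto
    have "co (pth (t x i) d \<otimes>\<^bsub>A\<^esub> a) x l = (if l \<in> {..<L x} \<and> d \<le> l \<and> t x (l - d) = t x i then f (l - d) else 0)" for l
      using NA[OF a(1)] x a(2) by (cases "l < L x") (auto simp: co_pth_mult co_supp)
    then show ?thesis
      using N'(4)[OF _ a(1)] by (intro image_eqI[of _ _ "pth (t x i) d \<otimes>\<^bsub>A\<^esub> a"]) auto
  qed
  ultimately obtain i where i: "i \<le> L x"
    "\<And>f. f \<in> ?T \<longleftrightarrow> finite {l. f l \<noteq> 0} \<and> {l. f l \<noteq> 0} \<subseteq> {..<L x} \<and> (\<forall>l<i. f l = 0)"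
    by (rule least_closed_under_shifts[of ?T "{..<L x}" "\<lambda>l. t x l" "L x"]) auto
  have "N = U x i"
  proof (intro equalityI subsetI)
    fix a assume "a \<in> N"
    then show "a \<in> U x i" using i(2)[of "co a x"] N'(1) by (auto simp: U_def)
  next
    fix a assume a: "a \<in> U x i"
    then have aA: "a \<in> carrier A" using P_closed[OF x] by (auto simp: U_def)
    have "{l. co a x l \<noteq> 0} \<subseteq> {..<L x}"
      using co_supp[OF aA] by (auto simp: subset_iff)
    then have "co a x \<in> ?T"
      using i(2)[of "co a x"] a by (auto simp: U_def intro: finite_subset)
    then obtain b where b: "b \<in> N" "co b x = co a x" by auto
    have "b = a"
    proof (rule co_eqI)
      fix y l show "co b y l = co a y l"
        using b a N'(1) by (cases "y = x") (auto simp: U_def carrier_P[OF x])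
    qed (use b NA aA in auto)
    then show "a \<in> N" using b by simp
  qed
  then show ?thesis using that i(1) by blast
qed

section \<open>Right multiplication by a path\<close>

lemma mult_pth_in_P: "\<lbrakk>a \<in> carrier A; y \<in> V\<rbrakk> \<Longrightarrow> a \<otimes>\<^bsub>A\<^esub> pth y k \<in> carrier (P y)"
  by (simp add: carrier_P co_mult_pth)

text \<open>Right multiplication by the path of length \<open>k\<close> raises all lengths by
  \<open>k\<close>. Coefficients pushed to \<open>L y\<close> or beyond are lost, which is why
  \<open>m\<close> is bounded by \<open>L y\<close>.\<close>

lemma mult_pth_in_U_iff:
  assumes "y \<in> V" "k < L y" "a \<in> carrier (P (t y k))" "m \<le> L y"
  shows "a \<otimes>\<^bsub>A\<^esub> pth y k \<in> U y m \<longleftrightarrow> a \<in> U (t y k) (m - k)"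
proof -
  have a: "a \<in> carrier A" using assms t_in_V[of y k] P_closed by blast
  show ?thesis
  proof
    assume "a \<otimes>\<^bsub>A\<^esub> pth y k \<in> U y m"
    then have *: "co (a \<otimes>\<^bsub>A\<^esub> pth y k) y (l + k) = 0" if "l < m - k" for l
      using that by (auto simp: U_def)
    have "co a (t y k) l = 0" if "l < m - k" for l
    proof -
      have "l + k < L y" using that assms by linarith
      then show ?thesis using *[OF that] assms a by (simp add: co_mult_pth)
    qed
    then show "a \<in> U (t y k) (m - k)" using assms by (simp add: U_def)
  next
    assume *: "a \<in> U (t y k) (m - k)"
    have "co (a \<otimes>\<^bsub>A\<^esub> pth y k) y l = 0" if "l < m" for l
      using * assms a that by (simp add: co_mult_pth U_def)
    then show "a \<otimes>\<^bsub>A\<^esub> pth y k \<in> U y m"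
      using assms a by (simp add: U_def mult_pth_in_P)
  qed
qed

lemma mult_pth_image:
  assumes "y \<in> V" "k < L y"
  shows "(\<lambda>a. a \<otimes>\<^bsub>A\<^esub> pth y k) ` carrier (P (t y k)) = U y k"
proof (intro equalityI subsetI)
  fix b assume "b \<in> (\<lambda>a. a \<otimes>\<^bsub>A\<^esub> pth y k) ` carrier (P (t y k))"
  then obtain a where a: "a \<in> carrier (P (t y k))" "b = a \<otimes>\<^bsub>A\<^esub> pth y k" by auto
  have "a \<in> U (t y k) (k - k)" using a by (simp add: U_0)
  then show "b \<in> U y k"
    using mult_pth_in_U_iff[OF assms a(1), of k] assms a by simp
next
  have z: "t y k \<in> V" "L y \<le> L (t y k) + k" using assms t_in_V by auto
  fix b assume b: "b \<in> U y k"
  then have bP: "b \<in> carrier (P y)" by (simp add: U_def)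
  then have bA: "b \<in> carrier A" using P_closed assms by blast
  \<comment> \<open>The preimage of \<open>b\<close>: its coefficients moved down by
    \<open>k\<close>, which fit below \<open>L (t y k)\<close> by \<open>t_in_V\<close>.\<close>
  obtain a where a: "a \<in> carrier A"
    "\<And>x l. co a x l = (if x = t y k \<and> l + k < L y then co b y (l + k) else 0)"
    by (rule co_obtain[of "\<lambda>x l. if x = t y k \<and> l + k < L y then co b y (l + k) else 0"])
       (use z in \<open>auto split: if_splits\<close>)
  have "b = a \<otimes>\<^bsub>A\<^esub> pth y k"
  proof (rule co_eqI)
    fix x l
    show "co b x l = co (a \<otimes>\<^bsub>A\<^esub> pth y k) x l"
      using b bP assms a co_supp[OF bA, of y l]
      by (cases "x = y") (auto simp: co_mult_pth U_def carrier_P)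
  qed (use a bA in auto)
  moreover have "a \<in> carrier (P (t y k))"
    using a z by (simp add: carrier_P)
  ultimately show "b \<in> (\<lambda>a. a \<otimes>\<^bsub>A\<^esub> pth y k) ` carrier (P (t y k))" by blast
qed

lemma mult_pth_hom:
  assumes "y \<in> V" "k < L y"
  shows "(\<lambda>a\<in>carrier (P (t y k)). a \<otimes>\<^bsub>A\<^esub> pth y k) \<in> module_hom A (P (t y k)) (P y)"
proof -
  have z: "t y k \<in> V" using assms t_in_V by auto
  interpret Z: left_module A "P (t y k)" using z by (rule P_left_module)
  note cl = P_closed[OF z]
  have "a \<oplus>\<^bsub>A\<^esub> b \<in> carrier (P (t y k))" if "a \<in> carrier (P (t y k))" "b \<in> carrier (P (t y k))" for a b
    using Z.M.add.m_closed[OF that] by simp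
  moreover have "a \<otimes>\<^bsub>A\<^esub> b \<in> carrier (P (t y k))" if "a \<in> carrier A" "b \<in> carrier (P (t y k))" for a b
    using Z.smult_closed[OF that] by simp
  ultimately show ?thesis
    using assms by (auto simp: module_hom_def cl mult_pth_in_P l_distr m_assoc)
qed

lemma mult_pth_surjection:
  assumes "y \<in> V" "k < L y"
  shows "module_surjection A (P (t y k)) (P y\<lparr>carrier := U y k\<rparr>)
    (\<lambda>a\<in>carrier (P (t y k)). a \<otimes>\<^bsub>A\<^esub> pth y k)"
proof -
  have z: "t y k \<in> V" using assms t_in_V by auto
  interpret Y: left_module A "P y" using assms(1) by (rule P_left_module)
  have "(\<lambda>a\<in>carrier (P (t y k)). a \<otimes>\<^bsub>A\<^esub> pth y k) ` carrier (P (t y k)) = U y k"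
    using mult_pth_image[OF assms] by simp
  then show ?thesis
    using mult_pth_hom[OF assms] mult_pth_image[OF assms]
    by (intro module_surjection.intro module_surjection_axioms.intro P_left_module z
        Y.submodule_left_module submodule_U assms) (auto simp: module_hom_def)
qed

text \<open>Serves with \<open>m = Suc k\<close> for a simple factor of \<open>P y\<close> and with
  \<open>m = L y\<close> for the tail that starts at position \<open>k\<close>.\<close>

lemma subquot_iso:
  assumes "y \<in> V" "k < L y" "k \<le> m" "m \<le> L y"
  shows "module_iso A (subquot (P y) (U y k) (U y m)) (quot_module (P (t y k)) (U (t y k) (m - k)))"
proof -
  interpret Y: left_module A "P y" using assms(1) by (rule P_left_module)
  interpret S: module_surjection A "P (t y k)" "P y\<lparr>carrier := U y k\<rparr>"
    "\<lambda>a\<in>carrier (P (t y k)). a \<otimes>\<^bsub>A\<^esub> pth y k"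
    using assms by (intro mult_pth_surjection)
  have "submodule (U y m) A (P y\<lparr>carrier := U y k\<rparr>)"
    using assms by (simp add: Y.submodule_submodule_iff submodule_U U_antimono)
  moreover have "{a \<in> carrier (P (t y k)). (\<lambda>a\<in>carrier (P (t y k)). a \<otimes>\<^bsub>A\<^esub> pth y k) a \<in> U y m}
      = U (t y k) (m - k)"
    using mult_pth_in_U_iff[OF assms(1,2) _ assms(4)] by (auto simp: U_def)
  ultimately show ?thesis
    using S.quot_iso[of "U y m"] by (simp add: subquot_def)
qed

section \<open>Simple modules and composition factors\<close>

lemma maximal_submodule_iff:
  assumes x: "x \<in> V" shows "maximal_submodule N A (P x) \<longleftrightarrow> N = U x (Suc 0)"
proof -
  have 1: "U x (Suc 0) \<noteq> carrier (P x)" using U_neq[OF x, of 0 "Suc 0"] L_pos[OF x] by (simp add: U_0)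
  have cases: "N = carrier (P x) \<or> N \<subseteq> U x (Suc 0)" if N: "submodule N A (P x)" for N
  proof -
    obtain i where "N = U x i" using submodule_imp_U[OF x N] by blast
    then show ?thesis
      using U_antimono[of "Suc 0" i x] by (cases "i = 0") (auto simp: U_0)
  qed
  show ?thesis
  proof
    assume N: "maximal_submodule N A (P x)"
    then have "N \<subseteq> U x (Suc 0)" using cases[of N] by (auto simp: maximal_submodule_def)
    then show "N = U x (Suc 0)"
      using N submodule_U[OF x, of "Suc 0"] 1 unfolding maximal_submodule_def by blast
  next
    assume N: "N = U x (Suc 0)"
    show "maximal_submodule N A (P x)"
      unfolding N maximal_submodule_def using submodule_U[OF x, of "Suc 0"] 1 cases by blast
  qed
qed

lemma simple_at_eq:
  assumes "x \<in> V" shows "simple_at A e x = quot_module (P x) (U x (Suc 0))"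
proof -
  have "module_radical A (P x) = U x (Suc 0)"
    using assms by (auto simp: module_radical_def maximal_submodule_iff U_def)
  then show ?thesis by (simp add: simple_at_def module_top_def)
qed

lemma e_mult_e: "x \<in> V \<Longrightarrow> e x \<otimes>\<^bsub>A\<^esub> e x = e x"
  by (rule co_eqI) (auto simp: co_mult_pth co_pth L_pos simp flip: pth_0)

text \<open>The idempotent \<open>e y\<close> fixes the generator of the simple module at
  \<open>y\<close>, so it cannot annihilate a module with such a factor, whichever series exhibits
  it.\<close>

lemma composition_factor_imp_nonzero:
  assumes M: "left_module A M" and y: "y \<in> V" and cf: "composition_factor A M (simple_at A e y)"
  shows "\<exists>m\<in>carrier M. e y \<odot>\<^bsub>M\<^esub> m \<noteq> \<zero>\<^bsub>M\<^esub>"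
proof -
  obtain Us i where Us: "composition_series A M Us" "Suc i < length Us"
    "module_iso A (subquot M (Us ! Suc i) (Us ! i)) (simple_at A e y)"
    using cf by (auto simp: composition_factor_def)
  interpret M: left_module A M by (rule M)
  interpret Y: left_module A "P y" using y by (rule P_left_module)
  let ?W = "Us ! Suc i" and ?V = "Us ! i"
  have WV: "submodule ?W A M" "submodule ?V A M" "?V \<subseteq> ?W"
    using Us(1,2) by (auto simp: composition_series_def filtration_def)
  note S = subquot_simps[OF M WV]
  note U = submodule_U[OF y, of "Suc 0"]
  obtain f where f: "f \<in> module_hom A (subquot M ?W ?V) (simple_at A e y)"
    "bij_betw f (carrier (subquot M ?W ?V)) (carrier (simple_at A e y))"
    using Us(3) by (auto simp: module_iso_def)
  have "f \<zero>\<^bsub>subquot M ?W ?V\<^esub> = \<zero>\<^bsub>simple_at A e y\<^esub>"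
    by (rule module_hom_zero[OF subquot_left_module[OF M WV] _ f(1)])
       (simp add: simple_at_eq y Y.quot_left_module[OF U])
  then have f0: "f ?V = U y (Suc 0)" by (simp add: S simple_at_eq y Y.quot_zero[OF U])
  let ?E = "U y (Suc 0) +>\<^bsub>P y\<^esub> e y"
  have "?E \<in> carrier (simple_at A e y)"
    using y e_in_P by (simp add: simple_at_eq Y.quot_carrier[OF U])
  then have "?E \<in> f ` (\<lambda>w. ?V +>\<^bsub>M\<^esub> w) ` ?W"
    using bij_betw_imp_surj_on[OF f(2)] by (simp add: S(1))
  then obtain w where w: "w \<in> ?W" "f (?V +>\<^bsub>M\<^esub> w) = ?E"
    by (auto simp del: image_image)
  \<comment> \<open>\<open>w\<close> lifts the class of \<open>e y\<close>, and by idempotency its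
    product with \<open>e y\<close> is another lift. As the class is nonzero, that lift lies outside
    the lower term of the series.\<close>
  have "f (?V +>\<^bsub>M\<^esub> (e y \<odot>\<^bsub>M\<^esub> w)) = ?E"
  proof -
    have "?V +>\<^bsub>M\<^esub> w \<in> carrier (subquot M ?W ?V)" using w S(1) by blast
    from module_homD(3)[OF f(1) e_closed[OF y] this] show ?thesis
      using w(2) Y.quot_smult[OF U e_closed[OF y] e_in_P[OF y]]
      unfolding S(3)[OF e_closed[OF y] w(1)] by (simp add: simple_at_eq y e_mult_e)
  qed
  moreover have "?E \<noteq> U y (Suc 0)"
    using Y.coset_eq_self_iff[OF U e_in_P[OF y]] pth_in_U_iff[of y 0 "Suc 0"] y L_pos[OF y] by (simp add: pth_0)
  ultimately have "?V +>\<^bsub>M\<^esub> (e y \<odot>\<^bsub>M\<^esub> w) \<noteq> ?V" using f0 by auto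
  then have "e y \<odot>\<^bsub>M\<^esub> w \<notin> ?V"
    using S(4)[of "e y \<odot>\<^bsub>M\<^esub> w"] w WV(1) e_closed[OF y] by (simp add: M.submodule_iff)
  moreover have wM: "w \<in> carrier M" "e y \<odot>\<^bsub>M\<^esub> w \<in> ?W"
    using w WV(1) e_closed[OF y] by (auto simp: M.submodule_iff)
  moreover have "\<zero>\<^bsub>M\<^esub> \<in> ?V" using WV(2) by (simp add: M.submodule_iff)
  ultimately show ?thesis by metis
qed

text \<open>Left multiplication by \<open>e y\<close> keeps only the paths that end at
  \<open>y\<close>, and what survives modulo \<open>U x i\<close> involves a length less than
  \<open>i\<close>.\<close>

lemma quot_nonzero_imp_occurs:
  assumes x: "x \<in> V" and y: "y \<in> V" and X: "X \<in> carrier (quot_module (P x) (U x i))"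
    and nz: "e y \<odot>\<^bsub>quot_module (P x) (U x i)\<^esub> X \<noteq> U x i"
  shows "\<exists>j<i. t x j = y"
proof -
  interpret X: left_module A "P x" using x by (rule P_left_module)
  note U = submodule_U[OF x, of i]
  obtain a where a: "a \<in> carrier (P x)" "X = U x i +>\<^bsub>P x\<^esub> a"
    using X by (auto simp: X.quot_carrier[OF U])
  have aA: "a \<in> carrier A" using a P_closed x by blast
  have ea: "e y \<otimes>\<^bsub>A\<^esub> a \<in> carrier (P x)" using X.smult_closed[OF e_closed[OF y] a(1)] by simp
  have "e y \<otimes>\<^bsub>A\<^esub> a \<notin> U x i"
    using nz X.quot_smult[OF U e_closed[OF y] a(1)] X.coset_eq_self_iff[OF U ea] a(2) by simp
  then obtain l where l: "l < i" "co (e y \<otimes>\<^bsub>A\<^esub> a) x l \<noteq> 0"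
    using ea by (auto simp: U_def)
  then have "l < L x" using co_supp[of "e y \<otimes>\<^bsub>A\<^esub> a" x l] aA e_closed[OF y] by auto
  then have "t x l = y"
    using l(2) co_pth_mult[OF aA x, of l y 0] y by (auto simp: pth_0 split: if_splits)
  then show ?thesis using l(1) by blast
qed

lemma occurs_imp_composition_factor:
  assumes x: "x \<in> V" and i: "i \<le> L x" and j: "j < i"
  shows "composition_factor A (quot_module (P x) (U x i)) (simple_at A e (t x j))"
proof -
  interpret X: left_module A "P x" using x by (rule P_left_module)
  note Ui = submodule_U[OF x, of i]
  let ?Q = "quot_module (P x) (U x i)"
  interpret Q: left_module A ?Q by (rule X.quot_left_module[OF Ui])
  \<comment> \<open>The images of the radical powers in the quotient; they will form the composition
    series.\<close>
  define W where "W m = (\<lambda>a. U x i +>\<^bsub>P x\<^esub> a) ` U x m" for m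
  have UP: "U x m \<subseteq> carrier (P x)" for m by (auto simp: U_def)
  have Ucl: "a \<oplus>\<^bsub>A\<^esub> b \<in> U x m" if "a \<in> U x m" "b \<in> U x m" for a b m
    using submodule_U[OF x, of m] that by (simp add: X.submodule_iff)
  have Usm: "a \<otimes>\<^bsub>A\<^esub> b \<in> U x m" if "a \<in> carrier A" "b \<in> U x m" for a b m
    using submodule_U[OF x, of m] that by (simp add: X.submodule_iff)
  have Uz: "\<zero>\<^bsub>A\<^esub> \<in> U x m" for m
    using submodule_U[OF x, of m] by (simp add: X.submodule_iff)
  have W_mono: "W m \<subseteq> W k" if "k \<le> m" for k m
    unfolding W_def using U_antimono[OF that] by (rule image_mono)
  have W_sub: "submodule (W m) A ?Q" for m
    unfolding Q.submodule_iff
  proof (intro conjI ballI)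
    show "W m \<subseteq> carrier ?Q" unfolding W_def X.quot_carrier[OF Ui] using UP by (rule image_mono)
    have "U x i +>\<^bsub>P x\<^esub> \<zero>\<^bsub>A\<^esub> = U x i"
      using X.coset_eq_self_iff[OF Ui, of "\<zero>\<^bsub>A\<^esub>"] Uz UP by blast
    then show "\<zero>\<^bsub>?Q\<^esub> \<in> W m" unfolding X.quot_zero[OF Ui] W_def using Uz by (metis imageI)
  next
    fix X Y assume "X \<in> W m" "Y \<in> W m"
    then obtain a b where ab: "a \<in> U x m" "X = U x i +>\<^bsub>P x\<^esub> a" "b \<in> U x m" "Y = U x i +>\<^bsub>P x\<^esub> b"
      unfolding W_def by blast
    then show "X \<oplus>\<^bsub>?Q\<^esub> Y \<in> W m"
      using X.quot_add[OF Ui subsetD[OF UP] subsetD[OF UP], of a m b m] Ucl[of a m b]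
      by (simp add: W_def)
  next
    fix c X assume c: "c \<in> carrier A" and "X \<in> W m"
    then obtain a where ab: "a \<in> U x m" "X = U x i +>\<^bsub>P x\<^esub> a"
      unfolding W_def by blast
    then show "c \<odot>\<^bsub>?Q\<^esub> X \<in> W m"
      using X.quot_smult[OF Ui c subsetD[OF UP], of a m] Usm[OF c, of a m]
      by (simp add: W_def)
  qed
  \<comment> \<open>For \<open>m \<le> i\<close> the submodule \<open>U x m\<close> contains
    \<open>U x i\<close>, so membership does not depend on the representative.\<close>
  have mem_W: "U x i +>\<^bsub>P x\<^esub> a \<in> W m \<longleftrightarrow> a \<in> U x m" if a: "a \<in> carrier (P x)" and "m \<le> i" for a m
  proof
    assume "U x i +>\<^bsub>P x\<^esub> a \<in> W m"
    then obtain b where b: "b \<in> U x m" "U x i +>\<^bsub>P x\<^esub> a = U x i +>\<^bsub>P x\<^esub> b"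
      unfolding W_def by blast
    then have bP: "b \<in> carrier (P x)" using UP by blast
    then have "a \<ominus>\<^bsub>P x\<^esub> b \<in> U x m"
      using b X.coset_eq_iff[OF Ui a] U_antimono[OF \<open>m \<le> i\<close>] by blast
    then have "(a \<ominus>\<^bsub>P x\<^esub> b) \<oplus>\<^bsub>P x\<^esub> b \<in> U x m" using b Ucl by simp
    moreover have "(a \<ominus>\<^bsub>P x\<^esub> b) \<oplus>\<^bsub>P x\<^esub> b = a"
      using a bP by (simp only: X.M.minus_eq X.M.a_assoc X.M.l_neg X.M.r_zero X.M.a_inv_closed)
    ultimately show "a \<in> U x m" by simp
  qed (auto simp: W_def)
  have factor: "simple_module A (subquot ?Q (W k) (W (Suc k)))"
      "module_iso A (subquot ?Q (W k) (W (Suc k))) (simple_at A e (t x k))" if k: "k < i" for k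
  proof -
    have kL: "k < L x" using k i by simp
    have z: "t x k \<in> V" using t_in_V[OF x kL] by simp
    let ?z = "t x k"
    interpret Z: left_module A "P ?z" using z by (rule P_left_module)
    let ?h = "\<lambda>a\<in>carrier (P ?z). a \<otimes>\<^bsub>A\<^esub> pth x k"
    \<comment> \<open>Right multiplication by the path to position \<open>k\<close>, followed by the
      quotient map; it takes \<open>P ?z\<close> onto \<open>W k\<close>.\<close>
    let ?g = "\<lambda>a\<in>carrier (P ?z). U x i +>\<^bsub>P x\<^esub> (a \<otimes>\<^bsub>A\<^esub> pth x k)"
    note h = module_homD[OF mult_pth_hom[OF x kL]]
    have img: "?g ` carrier (P ?z) = W k"
      unfolding W_def mult_pth_image[OF x kL, symmetric] by (simp add: image_image)
    have "?g \<in> module_hom A (P ?z) (?Q\<lparr>carrier := W k\<rparr>)"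
      unfolding module_hom_def
    proof (intro CollectI conjI ballI)
      show "?g \<in> carrier (P ?z) \<rightarrow>\<^sub>E carrier (?Q\<lparr>carrier := W k\<rparr>)"
        using img by auto
    next
      fix a b assume ab: "a \<in> carrier (P ?z)" "b \<in> carrier (P ?z)"
      have "a \<oplus>\<^bsub>P ?z\<^esub> b \<in> carrier (P ?z)" using ab by (rule Z.M.add.m_closed)
      then show "?g (a \<oplus>\<^bsub>P ?z\<^esub> b) = ?g a \<oplus>\<^bsub>?Q\<lparr>carrier := W k\<rparr>\<^esub> ?g b"
        using ab h(1)[of a] h(1)[of b] h(2)[of a b] X.quot_add[OF Ui, of "?h a" "?h b"] by simp
    next
      fix c a assume ca: "c \<in> carrier A" "a \<in> carrier (P ?z)"
      have "c \<odot>\<^bsub>P ?z\<^esub> a \<in> carrier (P ?z)" using ca by (rule Z.smult_closed)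
      then show "?g (c \<odot>\<^bsub>P ?z\<^esub> a) = c \<odot>\<^bsub>?Q\<lparr>carrier := W k\<rparr>\<^esub> ?g a"
        using ca h(1)[of a] h(3)[of c a] X.quot_smult[OF Ui, of c "?h a"] by simp
    qed
    then interpret S: module_surjection A "P ?z" "?Q\<lparr>carrier := W k\<rparr>" ?g
      using img by (intro module_surjection.intro module_surjection_axioms.intro P_left_module z
          Q.submodule_left_module W_sub) simp_all
    have sub: "submodule (W (Suc k)) A (?Q\<lparr>carrier := W k\<rparr>)"
      using W_sub W_mono by (simp add: Q.submodule_submodule_iff)
    have "{a \<in> carrier (P ?z). ?g a \<in> W (Suc k)} = {a \<in> carrier (P ?z). a \<otimes>\<^bsub>A\<^esub> pth x k \<in> U x (Suc k)}"
      using mem_W[OF _ Suc_leI[OF k]] h(1) by auto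
    also have "\<dots> = U ?z (Suc 0)"
      using mult_pth_in_U_iff[OF x kL _ Suc_leI[OF kL]] by (auto simp: U_def)
    finally have pre: "{a \<in> carrier (P ?z). ?g a \<in> W (Suc k)} = U ?z (Suc 0)" .
    have "maximal_submodule (W (Suc k)) A (?Q\<lparr>carrier := W k\<rparr>)"
      by (rule S.maximal_submodule_preimage[OF sub], unfold pre) (simp only: maximal_submodule_iff[OF z])
    then show "simple_module A (subquot ?Q (W k) (W (Suc k)))"
      unfolding subquot_def by (rule S.M.maximal_submodule_imp_simple)
    show "module_iso A (subquot ?Q (W k) (W (Suc k))) (simple_at A e ?z)"
      using S.quot_iso[OF sub] unfolding pre subquot_def simple_at_eq[OF z] .
  qed
  \<comment> \<open>Listed from the bottom: \<open>W i\<close> is zero and \<open>W 0\<close> is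
    everything, so step number \<open>m\<close> has the factor at position
    \<open>i - Suc m\<close>.\<close>
  let ?Us = "map (\<lambda>m. W (i - m)) [0..<Suc i]"
  have "U x i +>\<^bsub>P x\<^esub> a = U x i" if "a \<in> U x i" for a
    using that X.coset_eq_self_iff[OF Ui, of a] UP by blast
  then have W_i: "W i = {U x i}" using Uz[of i] by (auto simp: W_def)
  have "composition_series A ?Q ?Us"
    unfolding composition_series_def filtration_def
  proof (intro conjI allI impI ballI)
    show "hd ?Us = {\<zero>\<^bsub>?Q\<^esub>}"
      by (simp add: hd_map X.quot_zero[OF Ui] W_i upt_rec del: upt_Suc)
    show "last ?Us = carrier ?Q"
      by (simp add: W_def U_0 X.quot_carrier[OF Ui])
    show "submodule N A ?Q" if "N \<in> set ?Us" for N using that W_sub by auto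
  next
    fix m assume m: "Suc m < length ?Us"
    then have "i - m = Suc (i - Suc m)" by simp
    with m have nth: "?Us ! Suc m = W (i - Suc m)" "?Us ! m = W (Suc (i - Suc m))" "i - Suc m < i"
      by (simp_all del: upt_Suc add: nth_append)
    show "?Us ! m \<subseteq> ?Us ! Suc m" unfolding nth by (rule W_mono) simp
    show "simple_module A (subquot ?Q (?Us ! Suc m) (?Us ! m))"
      unfolding nth by (rule factor(1)) (rule nth(3))
  qed simp
  moreover have "Suc (i - Suc j) < length ?Us" using j by simp
  moreover have "?Us ! Suc (i - Suc j) = W j"
    using j by (simp del: upt_Suc)
  moreover have "?Us ! (i - Suc j) = W (Suc j)"
  proof -
    have "i - Suc j < Suc i" "i - (i - Suc j) = Suc j" using j by auto
    then show ?thesis by (simp del: upt_Suc)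
  qed
  ultimately show ?thesis
    using factor(2)[OF j] unfolding composition_factor_def
    by (intro exI[of _ ?Us] exI[of _ "i - Suc j"]) (simp del: upt_Suc)
qed

section \<open>Weyl modules and quasi-hereditary orderings\<close>

text \<open>The submodules of \<open>P x\<close> form a chain, and for \<open>m > i\<close> the
  quotient by \<open>U x m\<close> has the factor \<open>t x i\<close>. So the first vertex that is
  not below \<open>x\<close> alone decides where to cut.\<close>

lemma weyl_eq:
  assumes x: "x \<in> V" and i: "i \<le> L x" and below: "\<And>j. j < i \<Longrightarrow> (t x j, x) \<in> r"
    and stop: "i < L x \<Longrightarrow> (t x i, x) \<notin> r"
  shows "weyl_module A e V r x = quot_module (P x) (U x i)"
proof -
  interpret X: left_module A "P x" using x by (rule P_left_module)
  let ?ok = "\<lambda>N. submodule N A (P x) \<and>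
    (\<forall>y\<in>V. composition_factor A (quot_module (P x) N) (simple_at A e y) \<longrightarrow> (y, x) \<in> r)"
  have "(LEAST N. ?ok N) = U x i"
  proof (rule Least_equality)
    note U = submodule_U[OF x, of i]
    have "(y, x) \<in> r"
      if y: "y \<in> V" and cf: "composition_factor A (quot_module (P x) (U x i)) (simple_at A e y)" for y
    proof -
      obtain X where "X \<in> carrier (quot_module (P x) (U x i))" "e y \<odot>\<^bsub>quot_module (P x) (U x i)\<^esub> X \<noteq> U x i"
        using composition_factor_imp_nonzero[OF X.quot_left_module[OF U] y cf]
        unfolding X.quot_zero[OF U] by blast
      from quot_nonzero_imp_occurs[OF x y this] show ?thesis using below by blast
    qed
    then show "?ok (U x i)" using U by blast
  next
    fix N assume N: "?ok N"
    then obtain m where m: "m \<le> L x" "N = U x m"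
      using submodule_imp_U[OF x] by blast
    have "m \<le> i"
    proof (rule ccontr)
      assume "\<not> m \<le> i"
      then have "i < m" "i < L x" using m by auto
      then have "(t x i, x) \<in> r"
        using N occurs_imp_composition_factor[OF x m(1), of i] t_in_V[OF x, of i] m(2) by blast
      then show False using stop \<open>i < L x\<close> by blast
    qed
    then show "U x i \<subseteq> N" using m(2) U_antimono by blast
  qed
  then show ?thesis by (simp add: weyl_module_def)
qed

lemma weyl_obtain:
  assumes "x \<in> V"
  obtains i where "i \<le> L x" "\<And>j. j < i \<Longrightarrow> (t x j, x) \<in> r" "i < L x \<Longrightarrow> (t x i, x) \<notin> r"
    "weyl_module A e V r x = quot_module (P x) (U x i)"
proof -
  \<comment> \<open>The alternative \<open>L x\<close> makes the minimum exist when all factors lie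
    below \<open>x\<close>.\<close>
  define i where "i = (LEAST i. i = L x \<or> (t x i, x) \<notin> r)"
  have 1: "i = L x \<or> (t x i, x) \<notin> r"
    unfolding i_def by (rule LeastI[of _ "L x"]) simp
  have 2: "i \<le> L x"
    unfolding i_def by (rule Least_le) simp
  have 3: "(t x j, x) \<in> r" if "j < i" for j
    using not_less_Least[of j "\<lambda>i. i = L x \<or> (t x i, x) \<notin> r"] that unfolding i_def by blast
  show ?thesis
    by (rule that[OF 2 3 _ weyl_eq[OF assms 2 3]]) (use 1 in auto)
qed

section \<open>Endomorphism algebras of Weyl modules\<close>

lemma mult_e:
  assumes x: "x \<in> V" and a: "a \<in> carrier (P x)" shows "a \<otimes>\<^bsub>A\<^esub> e x = a"
proof (rule co_eqI)
  have aA: "a \<in> carrier A" using a P_closed x by blast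
  then show "a \<otimes>\<^bsub>A\<^esub> e x \<in> carrier A" using x by (simp add: e_closed)
  show "a \<in> carrier A" by (rule aA)
  fix y l show "co (a \<otimes>\<^bsub>A\<^esub> e x) y l = co a y l"
    unfolding pth_0[OF x, symmetric] co_mult_pth[OF aA x]
    using a x co_supp[OF aA, of y l] by (cases "y = x") (auto simp: carrier_P)
qed

text \<open>An endomorphism is determined by the image of the class of \<open>e x\<close>. That
  image is fixed by \<open>e x\<close>, so it involves only paths from \<open>x\<close> back to
  \<open>x\<close>, and the trivial path is the only one of length less than
  \<open>i\<close>.\<close>

lemma end_algebra_iso_scalars:
  assumes x: "x \<in> V" and i: "0 < i" and once: "\<And>j. \<lbrakk>0 < j; j < i\<rbrakk> \<Longrightarrow> t x j \<noteq> x"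
  shows "algebra_iso (end_algebra A (quot_module (P x) (U x i))) scalar_algebra"
proof -
  interpret X: left_module A "P x" using x by (rule P_left_module)
  note U = submodule_U[OF x, of i]
  let ?Q = "quot_module (P x) (U x i)"
  interpret Q: left_module A ?Q by (rule X.quot_left_module[OF U])
  let ?c = "\<lambda>c. c \<odot>\<^bsub>A\<^esub> \<one>\<^bsub>A\<^esub>"
  have c: "?c c \<in> carrier A" for c by (simp add: smult_closed)
  have c_add: "?c (c + d) = ?c c \<oplus>\<^bsub>A\<^esub> ?c d" for c d
    by (rule co_eqI) (auto simp: c co_add co_smult algebra_simps)
  have c_mult: "?c (c * d) = ?c c \<otimes>\<^bsub>A\<^esub> ?c d" for c d
    by (rule co_eqI) (auto simp: c smult_one_mult smult_closed co_smult)
  have c_one: "?c 1 = \<one>\<^bsub>A\<^esub>"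
    by (rule co_eqI) (auto simp: c co_smult)
  have c_comm: "?c c \<otimes>\<^bsub>A\<^esub> a = a \<otimes>\<^bsub>A\<^esub> ?c c" if "a \<in> carrier A" for a c
    using that by (simp add: smult_one_mult mult_smult_one)
  define \<psi> where "\<psi> c = (\<lambda>X\<in>carrier ?Q. ?c c \<odot>\<^bsub>?Q\<^esub> X)" for c
  have hom: "\<psi> c \<in> module_hom A ?Q ?Q" for c
    unfolding module_hom_def \<psi>_def
    using c[of c] by (auto simp: Q.smult_r_distr c_comm simp flip: Q.smult_assoc)
  let ?E = "U x i +>\<^bsub>P x\<^esub> e x"
  note eP = e_in_P[OF x]
  have E: "?E \<in> carrier ?Q" by (simp add: X.quot_carrier[OF U] eP)
  have \<psi>_E: "\<psi> c ?E = U x i +>\<^bsub>P x\<^esub> (c \<odot>\<^bsub>A\<^esub> e x)" for c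
    using E X.quot_smult[OF U c eP] by (simp add: \<psi>_def smult_one_mult e_closed x)
  have ceP: "c \<odot>\<^bsub>A\<^esub> e x \<in> carrier (P x)" for c
    using x by (simp add: carrier_P smult_closed e_closed co_smult co_e)
  have co_minus: "co (a \<ominus>\<^bsub>P x\<^esub> b) y l = co a y l - co b y l" if "a \<in> carrier (P x)" "b \<in> carrier (P x)" for a b y l
  proof -
    have ab: "a \<in> carrier A" "b \<in> carrier A" "a \<ominus>\<^bsub>P x\<^esub> b \<in> carrier A"
      using that P_closed[OF x] X.M.minus_closed by blast+
    have "(a \<ominus>\<^bsub>P x\<^esub> b) \<oplus>\<^bsub>P x\<^esub> b = a"
      using that by (simp only: X.M.minus_eq X.M.a_assoc X.M.l_neg X.M.r_zero X.M.a_inv_closed)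
    then show ?thesis using co_add[OF ab(3,2), of y l] by simp
  qed
  have inj: "inj \<psi>"
  proof (rule injI)
    fix c d assume "\<psi> c = \<psi> d"
    then have "U x i +>\<^bsub>P x\<^esub> (c \<odot>\<^bsub>A\<^esub> e x) = U x i +>\<^bsub>P x\<^esub> (d \<odot>\<^bsub>A\<^esub> e x)"
      using \<psi>_E by metis
    then have "(c \<odot>\<^bsub>A\<^esub> e x) \<ominus>\<^bsub>P x\<^esub> (d \<odot>\<^bsub>A\<^esub> e x) \<in> U x i"
      using X.coset_eq_iff[OF U ceP ceP] by blast
    \<comment> \<open>The coefficients at the trivial path are compared, whose length
      \<open>0\<close> is below \<open>i\<close>.\<close>
    then show "c = d"
      using i x by (auto simp: U_def co_minus ceP co_smult e_closed co_e)
  qed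
  have surj: "F \<in> range \<psi>" if F: "F \<in> module_hom A ?Q ?Q" for F
  proof -
    note F' = module_homD[OF F]
    obtain a where a: "a \<in> carrier (P x)" "F ?E = U x i +>\<^bsub>P x\<^esub> a"
      using F'(1)[OF E] by (auto simp: X.quot_carrier[OF U])
    have aA: "a \<in> carrier A" using a P_closed[OF x] by blast
    have "F ?E = F (e x \<odot>\<^bsub>?Q\<^esub> ?E)"
      using X.quot_smult[OF U e_closed[OF x] eP] x by (simp add: e_mult_e)
    also have "\<dots> = U x i +>\<^bsub>P x\<^esub> (e x \<otimes>\<^bsub>A\<^esub> a)"
      using F'(3)[OF e_closed[OF x] E] X.quot_smult[OF U e_closed[OF x] a(1)] a(2) by simp
    also have "\<dots> = U x i +>\<^bsub>P x\<^esub> (co a x 0 \<odot>\<^bsub>A\<^esub> e x)"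
    proof -
      have ea: "e x \<otimes>\<^bsub>A\<^esub> a \<in> carrier (P x)" using X.smult_closed[OF e_closed[OF x] a(1)] by simp
      have "co (e x \<otimes>\<^bsub>A\<^esub> a) x l = co (co a x 0 \<odot>\<^bsub>A\<^esub> e x) x l" if "l < i" for l
      proof (cases "l < L x")
        case True
        then show ?thesis
          using co_pth_mult[OF aA x, of l x 0] once[of l] that x
          by (auto simp: pth_0 co_smult e_closed co_e)
      next
        case False
        then show ?thesis using aA x by (simp add: co_supp e_closed smult_closed)
      qed
      then have "(e x \<otimes>\<^bsub>A\<^esub> a) \<ominus>\<^bsub>P x\<^esub> (co a x 0 \<odot>\<^bsub>A\<^esub> e x) \<in> U x i"
        unfolding U_def using X.M.minus_closed[OF ea ceP] by (simp add: co_minus ea ceP)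
      then show ?thesis
        using X.coset_eq_iff[OF U ea ceP] by blast
    qed
    finally have FE: "F ?E = \<psi> (co a x 0) ?E" by (simp add: \<psi>_E)
    have "F X = \<psi> (co a x 0) X" for X
    proof (cases "X \<in> carrier ?Q")
      case True
      then obtain p where p: "p \<in> carrier (P x)" "X = U x i +>\<^bsub>P x\<^esub> p"
        by (auto simp: X.quot_carrier[OF U])
      have pA: "p \<in> carrier A" using p P_closed[OF x] by blast
      have "p \<otimes>\<^bsub>A\<^esub> e x = p" using p(1) x by (simp add: mult_e)
      then have X: "X = p \<odot>\<^bsub>?Q\<^esub> ?E"
        using X.quot_smult[OF U pA eP] p(2) by simp
      show ?thesis
        unfolding X using F'(3)[OF pA E] module_homD(3)[OF hom pA E] FE by simp
    next
      case False
      then show ?thesis using F by (auto simp: module_hom_def \<psi>_def)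
    qed
    then show ?thesis by blast
  qed
  have range: "range \<psi> = module_hom A ?Q ?Q"
    using hom surj by blast
  define \<phi> where "\<phi> = inv_into UNIV \<psi>"
  have \<phi>: "\<phi> (\<psi> c) = c" for c
    using inj by (simp add: \<phi>_def)
  have sc: "carrier (end_algebra A ?Q) = range \<psi>" "mult (end_algebra A ?Q) = compose (carrier ?Q)"
    "\<one>\<^bsub>end_algebra A ?Q\<^esub> = \<psi> 1"
    "\<And>f g. f \<oplus>\<^bsub>end_algebra A ?Q\<^esub> g = (\<lambda>m\<in>carrier ?Q. f m \<oplus>\<^bsub>?Q\<^esub> g m)"
    "\<And>c f. c \<odot>\<^bsub>end_algebra A ?Q\<^esub> f = (\<lambda>m\<in>carrier ?Q. ?c c \<odot>\<^bsub>?Q\<^esub> f m)"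
    using range by (auto simp: end_algebra_def \<psi>_def c_one intro!: restrict_ext)
  have \<psi>_mult: "compose (carrier ?Q) (\<psi> c) (\<psi> d) = \<psi> (c * d)" for c d
    by (auto simp: \<psi>_def compose_def c c_mult Q.smult_assoc fun_eq_iff)
  have \<psi>_add: "(\<lambda>m\<in>carrier ?Q. \<psi> c m \<oplus>\<^bsub>?Q\<^esub> \<psi> d m) = \<psi> (c + d)" for c d
    by (auto simp: \<psi>_def c c_add Q.smult_l_distr fun_eq_iff)
  have \<psi>_smult: "(\<lambda>m\<in>carrier ?Q. ?c c \<odot>\<^bsub>?Q\<^esub> \<psi> d m) = \<psi> (c * d)" for c d
    by (auto simp: \<psi>_def c c_mult Q.smult_assoc fun_eq_iff)
  have "\<phi> \<in> ring_iso (end_algebra A ?Q) scalar_algebra"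
    unfolding ring_iso_def ring_hom_def
  proof (intro CollectI conjI ballI)
    show "bij_betw \<phi> (carrier (end_algebra A ?Q)) (carrier scalar_algebra)"
      by (auto simp: bij_betw_def inj_on_def sc \<phi> scalar_algebra_def image_image)
  qed (auto simp: sc \<phi> scalar_algebra_def \<psi>_mult \<psi>_add)
  then show ?thesis
    unfolding algebra_iso_def
    by (intro bexI[of _ \<phi>]) (auto simp: sc \<psi>_smult \<phi> scalar_algebra_def)
qed

section \<open>Quasi-heredity in terms of the lengths \<open>L\<close>\<close>

theorem quasi_hereditaryI:
  fixes \<rho> :: "'v \<Rightarrow> nat"
  assumes x: "x \<in> V" and her: "\<And>y j. \<lbrakk>y \<in> V; j < L y; t y j = x\<rbrakk> \<Longrightarrow> j + L x \<le> L y"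
    and inj: "inj_on \<rho> V" and top: "\<And>y. y \<in> V \<Longrightarrow> \<rho> y \<le> \<rho> x"
    and up: "\<And>y. \<lbrakk>y \<in> V; y \<noteq> x; 1 < L y\<rbrakk> \<Longrightarrow> \<rho> y < \<rho> (s y)"
  shows "quasi_hereditary A e V"
proof -
  define r where "r = {(y, z). y \<in> V \<and> z \<in> V \<and> \<rho> y \<le> \<rho> z}"
  have lin: "linear_order_on V r"
    using inj unfolding linear_order_on_def partial_order_on_def preorder_on_def
    by (auto simp: r_def refl_on_def trans_def antisym_def total_on_def inj_on_def)
  have weyl_x: "weyl_module A e V r x = quot_module (P x) (U x (L x))"
    using x top t_in_V[OF x] by (intro weyl_eq) (auto simp: r_def)
  have weyl_y: "weyl_module A e V r y = quot_module (P y) (U y (Suc 0))" if y: "y \<in> V" "y \<noteq> x" for y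
    using y up[OF y] L_pos[OF y(1)] by (intro weyl_eq) (auto simp: r_def)
  have "algebra_iso (end_algebra A (weyl_module A e V r y)) scalar_algebra" if y: "y \<in> V" for y
  proof (cases "y = x")
    case True
    \<comment> \<open>A return to \<open>x\<close> would make \<open>P x\<close> contain a proper
      copy of itself: \<open>her\<close> would give \<open>j + L x \<le> L x\<close>.\<close>
    have "t x j \<noteq> x" if "0 < j" "j < L x" for j
      using her[OF x, of j] that by auto
    then show ?thesis
      using end_algebra_iso_scalars[OF x L_pos[OF x]] True by (simp add: weyl_x)
  next
    case False
    then show ?thesis
      using end_algebra_iso_scalars[OF y, of "Suc 0"] by (simp add: weyl_y y)
  qed
  moreover have "good_module A e V r (P y)" if y: "y \<in> V" for y
  proof -
    \<comment> \<open>The position of the first \<open>x\<close> in \<open>P y\<close>. If there is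
      none, \<open>J\<close> is the last position, where the tail is simple and thus the Weyl module
      at its vertex.\<close>
    define J where "J = (LEAST k. t y k = x \<or> k = L y - 1)"
    have J: "t y J = x \<or> J = L y - 1"
      unfolding J_def by (rule LeastI[of _ "L y - 1"]) simp
    have "J \<le> L y - 1" unfolding J_def by (rule Least_le) simp
    then have JL: "J < L y" using L_pos[OF y] by simp
    have before: "t y k \<noteq> x" if "k < J" for k
      using not_less_Least[of k "\<lambda>k. t y k = x \<or> k = L y - 1"] that unfolding J_def by blast
    have first: "module_iso A (subquot (P y) (U y J) (U y (L y))) (weyl_module A e V r (t y J))"
    proof (cases "t y J = x")
      case True
      \<comment> \<open>Both sides are zero, since \<open>her\<close> gives
        \<open>L x \<le> L y - J\<close>.\<close>
      have "U x (L y - J) = U x (L x)"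
        using her[OF y JL True] x by (simp add: U_L)
      then show ?thesis
        using subquot_iso[OF y JL, of "L y"] JL True by (simp add: weyl_x)
    next
      case False
      then have "L y - J = Suc 0" using J JL by auto
      then show ?thesis
        using subquot_iso[OF y JL, of "L y"] JL False weyl_y t_in_V[OF y JL] by simp
    qed
    have rest: "module_iso A (subquot (P y) (U y k) (U y (Suc k))) (weyl_module A e V r (t y k))" if "k < J" for k
      using subquot_iso[OF y, of k "Suc k"] that JL weyl_y before t_in_V[OF y, of k] by simp
    \<comment> \<open>The lowest step goes from zero straight to \<open>U y J\<close>; after that
      each step adds one simple factor.\<close>
    let ?Us = "{\<zero>\<^bsub>A\<^esub>} # map (\<lambda>m. U y (J - m)) [0..<Suc J]"
    have nth: "?Us ! Suc m = U y (J - m)" if "m \<le> J" for m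
      using that by (simp del: upt_Suc add: less_Suc_eq_le)
    have zero: "U y (L y) = {\<zero>\<^bsub>A\<^esub>}" using y by (simp add: U_L)
    have step: "?Us ! m \<subseteq> ?Us ! Suc m \<and>
        (\<exists>z\<in>V. module_iso A (subquot (P y) (?Us ! Suc m) (?Us ! m)) (weyl_module A e V r z))"
      if m: "Suc m < length ?Us" for m
    proof (cases m)
      case 0
      then have "?Us ! Suc m = U y J" "?Us ! m = U y (L y)" using nth[of 0] zero by simp_all
      then show ?thesis using first U_antimono[of J "L y" y] JL t_in_V[OF y JL] by auto
    next
      case (Suc l)
      then have "l < J" using m by simp
      then have "?Us ! Suc m = U y (J - Suc l)" "?Us ! m = U y (Suc (J - Suc l))" "J - Suc l < J"
        using nth[of "Suc l"] nth[of l] Suc by (simp_all add: Suc_diff_Suc del: upt_Suc)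
      then show ?thesis
        using rest[of "J - Suc l"] U_antimono[of "J - Suc l" "Suc (J - Suc l)" y]
          t_in_V[OF y, of "J - Suc l"] JL by auto
    qed
    have "filtration A (P y) ?Us"
      unfolding filtration_def
    proof (intro conjI allI impI ballI)
      show "submodule N A (P y)" if "N \<in> set ?Us" for N
        using that submodule_U[OF y] zero by (auto simp del: upt_Suc) (metis submodule_U y)
    qed (use step in \<open>auto simp: U_0\<close>)
    then show ?thesis
      unfolding good_module_def using step by blast
  qed
  ultimately show ?thesis
    using lin unfolding quasi_hereditary_def q_ordering_def by blast
qed

text \<open>Right multiplication by the longest path from \<open>x\<close> back to \<open>x\<close> would have square zero.\<close>

lemma no_return_if_end_algebra_iso_scalars:
  assumes x: "x \<in> V"
    and iso: "algebra_iso (end_algebra A (quot_module (P x) (U x (L x)))) scalar_algebra"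
    and j: "0 < j" "j < L x"
  shows "t x j \<noteq> x"
proof
  assume ret: "t x j = x"
  interpret X: left_module A "P x" using x by (rule P_left_module)
  note U = submodule_U[OF x, of "L x"]
  let ?Q = "quot_module (P x) (U x (L x))"
  let ?Ret = "{j. j < L x \<and> t x j = x}"
  define m where "m = Max ?Ret"
  have Ret: "finite ?Ret" "j \<in> ?Ret" using j ret by auto
  have "m \<in> ?Ret" "j \<le> m"
    unfolding m_def using Max_in[OF Ret(1)] Max_ge[OF Ret] Ret(2) by blast+
  then have m: "0 < m" "m < L x" "t x m = x" using j by auto
  have max: "k \<le> m" if "k < L x" "t x k = x" for k
    using that unfolding m_def by (intro Max_ge) auto
  define b where "b = pth x m"
  have bP: "b \<in> carrier (P x)" "b \<in> carrier A" unfolding b_def using x by (auto intro: pth_in_P)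
  have bb: "b \<otimes>\<^bsub>A\<^esub> b = \<zero>\<^bsub>A\<^esub>"
  proof (rule co_eqI)
    fix y l
    \<comment> \<open>Going around twice would be a longer return to \<open>x\<close>, against the
      choice of \<open>m\<close>.\<close>
    have "\<not> m + m < L x"
      using max[of "m + m"] m by (auto simp: funpow_add)
    then show "co (b \<otimes>\<^bsub>A\<^esub> b) y l = co \<zero>\<^bsub>A\<^esub> y l"
      using x m unfolding b_def by (auto simp: co_mult_pth co_pth)
  qed (use bP in auto)
  have b0: "b \<noteq> \<zero>\<^bsub>A\<^esub>"
    using co_pth[of x m x m] m x by (auto simp: b_def)
  \<comment> \<open>As the submodule is zero, the elements of the quotient are singletons, and the
    quotient is a copy of \<open>P x\<close>.\<close>
  have zU: "U x (L x) = {\<zero>\<^bsub>A\<^esub>}" using x by (simp add: U_L)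
  have coset: "U x (L x) +>\<^bsub>P x\<^esub> a = {a}" if "a \<in> carrier (P x)" for a
    using P_closed[OF x that] by (simp add: zU a_r_coset_def')
  have Qc: "carrier ?Q = (\<lambda>a. {a}) ` carrier (P x)"
    unfolding X.quot_carrier[OF U] by (rule image_cong) (simp_all add: coset)
  have Padd: "a \<oplus>\<^bsub>A\<^esub> c \<in> carrier (P x)" if "a \<in> carrier (P x)" "c \<in> carrier (P x)" for a c
    using X.M.add.m_closed[OF that] by simp
  have Pmult: "a \<otimes>\<^bsub>A\<^esub> c \<in> carrier (P x)" if "a \<in> carrier A" "c \<in> carrier (P x)" for a c
    using X.smult_closed[OF that] by simp
  have Qadd: "{a} \<oplus>\<^bsub>?Q\<^esub> {c} = {a \<oplus>\<^bsub>A\<^esub> c}" if "a \<in> carrier (P x)" "c \<in> carrier (P x)" for a c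
    using X.quot_add[OF U that] that by (simp add: coset Padd)
  have Qsmult: "a \<odot>\<^bsub>?Q\<^esub> {c} = {a \<otimes>\<^bsub>A\<^esub> c}" if "a \<in> carrier A" "c \<in> carrier (P x)" for a c
    using X.quot_smult[OF U that] that by (simp add: coset Pmult)
  define F where "F = (\<lambda>X\<in>carrier ?Q. {the_elem X \<otimes>\<^bsub>A\<^esub> b})"
  define Z where "Z = (\<lambda>X\<in>carrier ?Q. \<zero>\<^bsub>?Q\<^esub>)"
  have F: "F {a} = {a \<otimes>\<^bsub>A\<^esub> b}" if "a \<in> carrier (P x)" for a
    using that by (simp add: F_def Qc)
  have zP: "\<zero>\<^bsub>A\<^esub> \<in> carrier (P x)" using X.M.zero_closed by simp
  have Q0: "\<zero>\<^bsub>?Q\<^esub> = {\<zero>\<^bsub>A\<^esub>}" unfolding X.quot_zero[OF U] by (rule zU)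
  have cl: "a \<in> carrier A" if "a \<in> carrier (P x)" for a using that P_closed[OF x] by blast
  have F_hom: "F \<in> carrier (end_algebra A ?Q)"
    unfolding end_algebra_def module_hom_def using bP
    by (auto simp: Qc Qadd Qsmult F Padd Pmult cl l_distr m_assoc)
       (auto simp: F_def Qc)
  have Z_hom: "Z \<in> carrier (end_algebra A ?Q)"
    unfolding end_algebra_def module_hom_def
    by (auto simp: Qc Qadd Qsmult Z_def Q0 zP Padd Pmult)
  have FF: "F \<otimes>\<^bsub>end_algebra A ?Q\<^esub> F = Z"
    using bP by (auto simp: end_algebra_def compose_def Z_def F Qc Q0 Pmult cl m_assoc bb intro!: restrict_ext)
  have ZZ: "Z \<oplus>\<^bsub>end_algebra A ?Q\<^esub> Z = Z"
    by (auto simp: end_algebra_def Z_def Q0 Qadd zP intro!: restrict_ext)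
  obtain \<phi> where \<phi>: "\<phi> \<in> ring_iso (end_algebra A ?Q) (scalar_algebra :: ('k, 'k) module)"
    using iso unfolding algebra_iso_def by blast
  have add: "\<phi> (f \<oplus>\<^bsub>end_algebra A ?Q\<^esub> g) = \<phi> f + \<phi> g" and mult: "\<phi> (f \<otimes>\<^bsub>end_algebra A ?Q\<^esub> g) = \<phi> f * \<phi> g"
    if "f \<in> carrier (end_algebra A ?Q)" "g \<in> carrier (end_algebra A ?Q)" for f g
    using \<phi> that by (auto simp: ring_iso_def ring_hom_def scalar_algebra_def)
  \<comment> \<open>Cancellation in \<open>K\<close>, applied to the image of \<open>ZZ\<close>. The
    image of \<open>F\<close> then has square zero in a field, so injectivity identifies
    \<open>F\<close> with \<open>Z\<close>.\<close>
  have "\<phi> Z = 0" using add[OF Z_hom Z_hom] ZZ by (metis add_cancel_right_right)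
  moreover have "\<phi> F = 0" using mult[OF F_hom F_hom] FF \<open>\<phi> Z = 0\<close> by simp
  ultimately have "F = Z"
    using \<phi> F_hom Z_hom unfolding ring_iso_def bij_betw_def inj_on_def by auto
  then have "F {e x} = Z {e x}" by simp
  then have "e x \<otimes>\<^bsub>A\<^esub> b = \<zero>\<^bsub>A\<^esub>"
    using F[OF e_in_P[OF x]] e_in_P[OF x] by (simp add: Z_def Qc Q0)
  moreover have "e x \<otimes>\<^bsub>A\<^esub> b = b"
    using m x by (intro co_eqI) (auto simp: b_def co_mult_pth co_pth L_pos bP e_closed simp flip: pth_0)
  ultimately show False using b0 by simp
qed

theorem quasi_hereditaryD:
  assumes qh: "quasi_hereditary A e V" and ne: "V \<noteq> {}"
  obtains x where "x \<in> V" "\<And>y j. \<lbrakk>y \<in> V; j < L y; t y j = x\<rbrakk> \<Longrightarrow> j + L x \<le> L y"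
proof -
  obtain r where r: "q_ordering A e V r" using qh by (auto simp: quasi_hereditary_def)
  then have lin: "linear_order_on V r" by (simp add: q_ordering_def)
  then have trans: "trans r" and anti: "antisym r" and refl: "\<And>y. y \<in> V \<Longrightarrow> (y, y) \<in> r"
    and tot: "\<And>y z. \<lbrakk>y \<in> V; z \<in> V; y \<noteq> z\<rbrakk> \<Longrightarrow> (y, z) \<in> r \<or> (z, y) \<in> r"
    by (auto simp: linear_order_on_def partial_order_on_def preorder_on_def refl_on_def total_on_def)
  have "\<exists>x\<in>V. \<forall>y\<in>V. (y, x) \<in> r"
    using finite_V ne refl tot
  proof (induction rule: finite_ne_induct)
    case (insert z W)
    then obtain x where x: "x \<in> W" "\<forall>y\<in>W. (y, x) \<in> r" by auto
    show ?case
    proof (cases "(z, x) \<in> r")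
      case False
      then have "(x, z) \<in> r" using insert x(1) by blast
      then show ?thesis using x(2) insert.prems(1) trans by (auto dest: transD)
    qed (use x in auto)
  qed auto
  then obtain x where x: "x \<in> V" "\<And>y. y \<in> V \<Longrightarrow> (y, x) \<in> r" by blast
  interpret X: left_module A "P x" using x(1) by (rule P_left_module)
  have weyl_x: "weyl_module A e V r x = quot_module (P x) (U x (L x))"
    using x t_in_V[OF x(1)] by (intro weyl_eq) auto
  have once: "t x j \<noteq> x" if "0 < j" "j < L x" for j
    using no_return_if_end_algebra_iso_scalars[OF x(1) _ that] r x(1) weyl_x
    unfolding q_ordering_def by metis
  have "j + L x \<le> L y" if y: "y \<in> V" and j: "j < L y" and yj: "t y j = x" for y j
  proof (rule ccontr)
    assume "\<not> j + L x \<le> L y"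
    \<comment> \<open>The length of what remains of \<open>P y\<close> from position
      \<open>j\<close>. As \<open>l < L x\<close>, the path of length \<open>l\<close> from
      \<open>x\<close> is nonzero, yet it annihilates \<open>pth y j\<close>; inside a copy of
      \<open>P x\<close> this will turn out to be impossible.\<close>
    define l where "l = L y - j"
    have l: "0 < l" "l < L x" "j + l = L y" using j \<open>\<not> j + L x \<le> L y\<close> by (auto simp: l_def)
    interpret Y: left_module A "P y" using y by (rule P_left_module)
    have "good_module A e V r (P y)" using r y by (simp add: q_ordering_def)
    then obtain Us where Us: "filtration A (P y) Us"
      "\<And>i. Suc i < length Us \<Longrightarrow> \<exists>z\<in>V. module_iso A (subquot (P y) (Us ! Suc i) (Us ! i)) (weyl_module A e V r z)"
      by (auto simp: good_module_def)
    let ?m = "pth y j"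
    have mP: "?m \<in> carrier (P y)" using y by (rule pth_in_P)
    have m0: "?m \<noteq> \<zero>\<^bsub>A\<^esub>" using co_pth[of y j y j] y j by auto
    have em: "e x \<otimes>\<^bsub>A\<^esub> ?m = ?m" and lm: "pth x l \<otimes>\<^bsub>A\<^esub> ?m = \<zero>\<^bsub>A\<^esub>"
      using yj y j l x(1) by (auto intro!: co_eqI simp: co_mult_pth co_pth L_pos simp flip: pth_0)
    have "?m \<in> last Us" "?m \<notin> hd Us" "Us \<noteq> []"
      using Us(1) mP m0 by (auto simp: filtration_def)
    then have last: "?m \<in> Us ! (length Us - 1)" "?m \<notin> Us ! 0" by (auto simp: last_conv_nth hd_conv_nth)
    \<comment> \<open>The filtration step at which \<open>?m\<close> enters; there its class in the
      Weyl factor is nonzero.\<close>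
    define i where "i = (LEAST i. ?m \<in> Us ! i)"
    have "?m \<in> Us ! i" unfolding i_def using last(1) by (rule LeastI)
    moreover have "i \<le> length Us - 1" unfolding i_def using last(1) by (rule Least_le)
    moreover have "i \<noteq> 0" using \<open>?m \<in> Us ! i\<close> last(2) by metis
    moreover have "?m \<notin> Us ! (i - 1)"
      using not_less_Least[of "i - 1" "\<lambda>i. ?m \<in> Us ! i"] \<open>i \<noteq> 0\<close> unfolding i_def[symmetric] by auto
    moreover have "length Us \<noteq> 0" using \<open>Us \<noteq> []\<close> by simp
    ultimately obtain k where k: "Suc k < length Us" "?m \<in> Us ! Suc k" "?m \<notin> Us ! k"
      by (cases i; cases "length Us") (auto simp: Suc_le_eq)
    let ?W = "Us ! Suc k" and ?N = "Us ! k"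
    have WN: "submodule ?W A (P y)" "submodule ?N A (P y)" "?N \<subseteq> ?W"
      using Us(1) k(1) by (auto simp: filtration_def)
    note S = subquot_simps[OF Y.left_module_axioms WN]
    obtain z f where z: "z \<in> V" and f: "f \<in> module_hom A (subquot (P y) ?W ?N) (weyl_module A e V r z)"
      "bij_betw f (carrier (subquot (P y) ?W ?N)) (carrier (weyl_module A e V r z))"
      using Us(2)[OF k(1)] by (auto simp: module_iso_def)
    obtain n where n: "\<And>j. j < n \<Longrightarrow> (t z j, z) \<in> r"
      "weyl_module A e V r z = quot_module (P z) (U z n)"
      using weyl_obtain[OF z, of r] by metis
    interpret Z: left_module A "P z" using z by (rule P_left_module)
    note Un = submodule_U[OF z, of n]
    let ?c = "?N +>\<^bsub>P y\<^esub> ?m"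
    have c: "?c \<in> carrier (subquot (P y) ?W ?N)" using S(1) k(2) by blast
    have NQ: "?N \<in> carrier (subquot (P y) ?W ?N)"
      using left_module.submodule_carrier[OF subquot_left_module[OF Y.left_module_axioms WN]]
        left_module.submodule_iff[OF subquot_left_module[OF Y.left_module_axioms WN]] S(2) by auto
    have "f \<zero>\<^bsub>subquot (P y) ?W ?N\<^esub> = \<zero>\<^bsub>weyl_module A e V r z\<^esub>"
      by (rule module_hom_zero[OF subquot_left_module[OF Y.left_module_axioms WN] _ f(1)])
         (simp add: n(2) Z.quot_left_module[OF Un])
    then have fN: "f ?N = U z n" by (simp add: S n(2) Z.quot_zero[OF Un])
    have "?c \<noteq> ?N" using S(4)[OF k(2)] k(3) by blast
    then have fc: "f ?c \<noteq> U z n"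
      using f(2) c NQ fN unfolding bij_betw_def inj_on_def by metis
    have efc: "e x \<odot>\<^bsub>quot_module (P z) (U z n)\<^esub> f ?c = f ?c"
      using module_homD(3)[OF f(1) e_closed[OF x(1)] c] S(3)[OF e_closed[OF x(1)] k(2)] em n(2) by simp
    have lfc: "pth x l \<odot>\<^bsub>quot_module (P z) (U z n)\<^esub> f ?c = U z n"
    proof -
      have "pth x l \<odot>\<^bsub>subquot (P y) ?W ?N\<^esub> ?c = ?N"
        using S(3)[OF pth_closed k(2), of x l] lm Y.coset_eq_self_iff[OF WN(2), of "\<zero>\<^bsub>A\<^esub>"] WN(2)
        by (simp add: Y.submodule_iff) (metis P_simps(1) Y.M.zero_closed)
      then show ?thesis
        using module_homD(3)[OF f(1) pth_closed c, of x l] fN n(2) by simp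
    qed
    have fcQ: "f ?c \<in> carrier (quot_module (P z) (U z n))"
      using module_homD(1)[OF f(1) c] n(2) by simp
    obtain i where "i < n" "t z i = x"
      using quot_nonzero_imp_occurs[OF z x(1) fcQ] efc fc by auto
    then have "(x, z) \<in> r" using n(1) by blast
    \<comment> \<open>\<open>x\<close> occurs in the Weyl module at \<open>z\<close>, so it precedes
      \<open>z\<close>; being the greatest vertex, it equals \<open>z\<close>.\<close>
    then have zx: "z = x" using x(2)[OF z] anti by (auto dest: antisymD)
    have Uz: "U z n = {\<zero>\<^bsub>A\<^esub>}"
    proof -
      \<comment> \<open>\<open>n\<close> has not been tied to \<open>L x\<close>. Comparing the
        zeros of the two descriptions of the Weyl module shows that nothing is factored out.\<close>
      have QX: "quot_module (P x) (U x n) = quot_module (P x) (U x (L x))"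
        using n(2) weyl_x zx by simp
      then have "\<zero>\<^bsub>quot_module (P x) (U x n)\<^esub> = \<zero>\<^bsub>quot_module (P x) (U x (L x))\<^esub>" by simp
      then show ?thesis
        unfolding X.quot_zero[OF submodule_U[OF x(1)]] zx using U_L[OF x(1)] by simp
    qed
    obtain a where a: "a \<in> carrier (P z)" "f ?c = U z n +>\<^bsub>P z\<^esub> a"
      using fcQ unfolding Z.quot_carrier[OF Un] by blast
    have aA: "a \<in> carrier A" using a P_closed[OF z] by blast
    have coset: "U z n +>\<^bsub>P z\<^esub> b = {b}" if "b \<in> carrier A" for b
      using that by (simp add: Uz a_r_coset_def')
    have fca: "f ?c = {a}" using a(2) coset[OF aA] by simp
    have smult: "b \<odot>\<^bsub>quot_module (P z) (U z n)\<^esub> f ?c = {b \<otimes>\<^bsub>A\<^esub> a}" if "b \<in> carrier A" for b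
      using Z.quot_smult[OF Un that a(1)] coset[OF m_closed[OF that aA]] unfolding a(2) by simp
    have "a \<noteq> \<zero>\<^bsub>A\<^esub>" using fc unfolding fca Uz by simp
    have "e x \<otimes>\<^bsub>A\<^esub> a = a"
      using efc unfolding smult[OF e_closed[OF x(1)]] unfolding fca by simp
    \<comment> \<open>Fixed by \<open>e x\<close>, and without returns to \<open>x\<close>, the
      element \<open>a\<close> is a multiple of \<open>e x\<close>.\<close>
    then have co_a: "co a x i = 0" if "0 < i" for i
      using co_pth_mult[OF aA x(1), of i x 0] once[of i] that x(1) co_supp[OF aA, of x i]
      by (cases "i < L x") (auto simp: pth_0)
    have "pth x l \<otimes>\<^bsub>A\<^esub> a = \<zero>\<^bsub>A\<^esub>"
      using HOL.trans[OF smult[OF pth_closed, symmetric] lfc] unfolding Uz by simp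
    \<comment> \<open>The coefficient of the product at length \<open>l\<close> is that of
      \<open>a\<close> at the trivial path, because \<open>l < L x\<close>.\<close>
    then have co_0: "co a x 0 = 0"
      using co_pth_mult[OF aA x(1) l(2), of x l] by simp
    have "a = \<zero>\<^bsub>A\<^esub>"
    proof (rule co_eqI[OF aA zero_closed])
      fix w i show "co a w i = co \<zero>\<^bsub>A\<^esub> w i"
        using co_a[of i] co_0 a(1) carrier_P[OF z] unfolding zx by (cases "w = x"; cases "i = 0") auto
    qed
    then show False using \<open>a \<noteq> \<zero>\<^bsub>A\<^esub>\<close> by simp
  qed
  then show ?thesis using that x(1) by blast
qed

end

section \<open>Path algebras of functional quivers\<close>

text \<open>Carries the ring axioms from the factor ring over to \<open>quot_algebra\<close>, which
  adds a scalar multiplication.\<close>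

lemma ring_cong:
  assumes "ring R" "carrier S = carrier R" "mult S = mult R" "\<one>\<^bsub>S\<^esub> = \<one>\<^bsub>R\<^esub>"
    "\<zero>\<^bsub>S\<^esub> = \<zero>\<^bsub>R\<^esub>" "add S = add R"
  shows "ring S"
proof -
  interpret R: ring R by fact
  have inv: "\<exists>y\<in>carrier R. y \<oplus>\<^bsub>R\<^esub> x = \<zero>\<^bsub>R\<^esub>" if "x \<in> carrier R" for x
    using that R.l_neg by blast
  show ?thesis
    by (intro ringI abelian_groupI monoidI)
       (simp_all add: assms(2-) R.a_ac R.m_assoc R.l_distr R.r_distr inv)
qed

lemma (in ring) ideal_if_closed:
  assumes "S \<subseteq> carrier R" "\<zero> \<in> S" "\<And>a b. \<lbrakk>a \<in> S; b \<in> S\<rbrakk> \<Longrightarrow> a \<oplus> b \<in> S"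
    "\<And>a x. \<lbrakk>a \<in> S; x \<in> carrier R\<rbrakk> \<Longrightarrow> x \<otimes> a \<in> S" "\<And>a x. \<lbrakk>a \<in> S; x \<in> carrier R\<rbrakk> \<Longrightarrow> a \<otimes> x \<in> S"
  shows "ideal S R"
proof (rule idealI)
  have "\<ominus> a \<in> S" if "a \<in> S" for a
    using assms(4)[OF that, of "\<ominus> \<one>"] that assms(1) by (auto simp: l_minus)
  then show "subgroup S (add_monoid R)"
    using assms(1-3) by (auto simp: subgroup_def a_inv_def)
qed (use assms ring_axioms in auto)

text \<open>Every arrow is named by its tail.\<close>

locale functional_quiver =
  fixes Q :: "('v, 'v) pre_digraph" and V E :: "'v set" and s :: "'v \<Rightarrow> 'v"
  assumes Q: "Q = \<lparr>verts = V, arcs = E, tail = (\<lambda>a. a), head = s\<rparr>"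
    and finite_V: "finite V" and E_subset: "E \<subseteq> V" and s_in_V: "a \<in> E \<Longrightarrow> s a \<in> V"
begin

abbreviation t :: "'v \<Rightarrow> nat \<Rightarrow> 'v" where "t x l \<equiv> (s ^^ l) x"

text \<open>As arrows are named by their tails, the arrow list of a path is the list of the vertices
  that it leaves. It is formed for all \<open>x\<close> and \<open>l\<close>; \<open>valid\<close>
  says that it is a path.\<close>

definition arr :: "'v \<Rightarrow> nat \<Rightarrow> 'v list" where "arr x l = map (t x) [0..<l]"

definition valid :: "'v \<Rightarrow> nat \<Rightarrow> bool" where "valid x l \<longleftrightarrow> x \<in> V \<and> (\<forall>i<l. t x i \<in> E)"

lemma t_t [simp]: "t (t x k) i = t x (k + i)"
  by (simp add: funpow_add add.commute[of k])

lemma t_s: "t (s x) i = t x (Suc i)"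
  by (simp add: funpow_swap1)

lemma length_arr [simp]: "length (arr x l) = l"
  by (simp add: arr_def)

lemma arr_eq_iff [simp]: "arr x l = arr x m \<longleftrightarrow> l = m"
  by (metis length_arr)

lemma arr_0 [simp]: "arr x 0 = []"
  by (simp add: arr_def)

lemma arr_eq_Nil_iff [simp]: "arr x l = [] \<longleftrightarrow> l = 0"
  by (simp add: arr_def)

lemma arr_append: "arr x k @ arr (t x k) m = arr x (k + m)"
  by (rule nth_equalityI) (auto simp: arr_def nth_append)

lemma arr_Suc: "arr x (Suc l) = x # arr (s x) l"
  using arr_append[of x 1 l] by (simp add: arr_def)

lemma valid_0 [simp]: "valid x 0 \<longleftrightarrow> x \<in> V"
  by (simp add: valid_def)

lemma valid_mono: "\<lbrakk>valid x l; k \<le> l\<rbrakk> \<Longrightarrow> valid x k"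
  by (auto simp: valid_def)

lemma t_in_V: assumes "valid x l" shows "t x l \<in> V"
proof (cases l)
  case (Suc k)
  then show ?thesis using assms s_in_V by (auto simp: valid_def)
qed (use assms in \<open>simp add: valid_def\<close>)

lemma valid_add: "valid x (k + m) \<longleftrightarrow> valid x k \<and> valid (t x k) m"
proof
  assume "valid x (k + m)"
  then show "valid x k \<and> valid (t x k) m"
    using t_in_V[of x k] valid_mono[of x "k + m" k] by (auto simp: valid_def)
next
  assume *: "valid x k \<and> valid (t x k) m"
  have "t x i \<in> E" if "i < k + m" for i
  proof (cases "i < k")
    case False
    then have "t (t x k) (i - k) \<in> E" using * that unfolding valid_def by (metis add.commute less_diff_conv2 not_less)
    then show ?thesis using False by simp
  qed (use * in \<open>simp add: valid_def\<close>)
  then show "valid x (k + m)" using * by (simp add: valid_def)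
qed

text \<open>Here it enters that the quiver is functional: start and length determine the
  path.\<close>

lemma cas_iff: "pre_digraph.cas Q u p v \<longleftrightarrow> p = arr u (length p) \<and> v = t u (length p)"
proof (induction p arbitrary: u)
  case (Cons a p)
  then show ?case
    by (auto simp: pre_digraph.cas.simps Q arr_Suc t_s)
qed (auto simp: pre_digraph.cas.simps)

lemma qpaths_iff: "(u, p) \<in> qpaths Q \<longleftrightarrow> p = arr u (length p) \<and> valid u (length p)"
proof -
  have set_arr: "set (arr u l) \<subseteq> E \<longleftrightarrow> (\<forall>i<l. t u i \<in> E)" for l by (auto simp: arr_def)
  have "(u, p) \<in> qpaths Q \<longleftrightarrow> u \<in> V \<and> set p \<subseteq> E \<and> p = arr u (length p)"
    unfolding qpaths_def pre_digraph.awalk_def cas_iff by (simp add: Q)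
  also have "\<dots> \<longleftrightarrow> p = arr u (length p) \<and> valid u (length p)"
    unfolding valid_def set_arr[symmetric] by (rule iffI; elim conjE; intro conjI; (assumption | metis))
  finally show ?thesis .
qed

lemma arr_in_qpaths_iff [simp]: "(u, arr u l) \<in> qpaths Q \<longleftrightarrow> valid u l"
  by (simp add: qpaths_iff)

lemma qpathsE:
  assumes "p \<in> qpaths Q" obtains x l where "p = (x, arr x l)" "valid x l"
  using assms qpaths_iff[of "fst p" "snd p"] by (metis prod.collapse)

lemma path_verts_arr: "path_verts Q (u, arr u l) = map (t u) [0..<Suc l]"
proof -
  have "pre_digraph.awalk_verts Q u (arr u l) = map (t u) [0..<Suc l]"
  proof (induction l arbitrary: u)
    case (Suc l)
    have "map (t u) [0..<Suc (Suc l)] = u # map (t (s u)) [0..<Suc l]"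
      by (rule nth_equalityI) (auto simp: nth_Cons t_s simp del: upt_Suc funpow.simps split: nat.splits)
    then show ?case
      using Suc[of "s u"] by (simp add: arr_Suc pre_digraph.awalk_verts.simps Q)
  qed (simp add: pre_digraph.awalk_verts.simps)
  then show ?thesis by (simp add: path_verts_def)
qed

lemma path_source_arr: "path_source Q (u, arr u l) = u"
  by (simp add: path_source_def path_verts_arr upt_rec del: upt_Suc)

lemma path_target_arr: "path_target Q (u, arr u l) = t u l"
  by (simp add: path_target_def path_verts_arr)

abbreviation KQ :: "('k::field, ('v, 'v) qpath \<Rightarrow> 'k) module" where "KQ \<equiv> path_algebra Q"

lemma KQ_simps:
  "carrier KQ = {f. finite {p. f p \<noteq> 0} \<and> {p. f p \<noteq> 0} \<subseteq> qpaths Q}"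
  "\<zero>\<^bsub>KQ\<^esub> = (\<lambda>p. 0)" "f \<oplus>\<^bsub>KQ\<^esub> g = (\<lambda>p. f p + g p)" "c \<odot>\<^bsub>KQ\<^esub> f = (\<lambda>p. c * f p)"
  "\<one>\<^bsub>KQ\<^esub> = (\<lambda>p. if p \<in> qpaths Q \<and> snd p = [] then 1 else 0)"
  by (simp_all add: path_algebra_def)

text \<open>A path of length \<open>l\<close> factors in exactly one way for each cut point
  \<open>k\<close>, because both pieces are determined by their starts and lengths.\<close>

lemma KQ_mult:
  assumes "valid x l"
  shows "(f \<otimes>\<^bsub>KQ\<^esub> g) (x, arr x l) = (\<Sum>k\<le>l. f (t x k, arr (t x k) (l - k)) * g (x, arr x k))"
proof -
  let ?S = "{(q, p). q \<in> qpaths Q \<and> p \<in> qpaths Q \<and> path_target Q p = path_source Q q \<and>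
    (x, arr x l) = (fst p, snd p @ snd q)}"
  let ?i = "\<lambda>k. ((t x k, arr (t x k) (l - k)), (x, arr x k))"
  have "?S = ?i ` {..l}"
  proof (intro equalityI subsetI)
    fix z assume "z \<in> ?S"
    then obtain q p where z: "z = (q, p)" "q \<in> qpaths Q" "p \<in> qpaths Q"
      "path_target Q p = path_source Q q" "x = fst p" "arr x l = snd p @ snd q" by auto
    obtain w m where q: "q = (w, arr w m)" using z(2) by (rule qpathsE)
    obtain u k where p: "p = (u, arr u k)" using z(3) by (rule qpathsE)
    have "w = t x k" "u = x" using z(4,5) by (auto simp: p q path_target_arr path_source_arr)
    moreover have "arr x l = arr x (k + m)" using z(6) calculation by (simp add: p q arr_append)
    ultimately show "z \<in> ?i ` {..l}" by (auto simp: z(1) p q image_iff intro!: bexI[of _ k])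
  next
    fix z assume "z \<in> ?i ` {..l}"
    then obtain k where k: "k \<le> l" "z = ?i k" by auto
    then show "z \<in> ?S"
      using assms valid_add[of x k "l - k"] by (simp add: path_target_arr path_source_arr arr_append)
  qed
  then have "(f \<otimes>\<^bsub>KQ\<^esub> g) (x, arr x l) = (\<Sum>(q, p)\<in>?i ` {..l}. f q * g p)"
    by (simp add: path_algebra_def)
  also have "\<dots> = (\<Sum>k\<le>l. f (t x k, arr (t x k) (l - k)) * g (x, arr x k))"
    by (subst sum.reindex) (auto simp: inj_on_def)
  finally show ?thesis .
qed

definition pe :: "'v \<Rightarrow> nat \<Rightarrow> ('v, 'v) qpath \<Rightarrow> 'k::field" where
  "pe x l = path_elem (x, arr x l)"

lemma pe_apply: "pe x l (y, arr y m) = (if y = x \<and> m = l then 1 else 0)"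
  by (auto simp: pe_def path_elem_def)

lemma pe_closed: "valid x l \<Longrightarrow> pe x l \<in> carrier KQ"
  by (auto simp: KQ_simps pe_def path_elem_def)

lemma KQ_eqI:
  assumes "f \<in> carrier KQ" "g \<in> carrier KQ" "\<And>x l. valid x l \<Longrightarrow> f (x, arr x l) = g (x, arr x l)"
  shows "f = g"
proof
  fix p show "f p = g p"
  proof (cases "p \<in> qpaths Q")
    case True
    then show ?thesis using assms(3) by (auto elim: qpathsE)
  next
    case False
    then have "f p = 0" "g p = 0" using assms(1,2) by (auto simp: KQ_simps)
    then show ?thesis by simp
  qed
qed

lemma pe_mult:
  assumes "valid x l"
  shows "(pe y m \<otimes>\<^bsub>KQ\<^esub> f) (x, arr x l) = (if m \<le> l \<and> t x (l - m) = y then f (x, arr x (l - m)) else 0)"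
proof -
  have "(pe y m \<otimes>\<^bsub>KQ\<^esub> f) (x, arr x l) = (\<Sum>k\<le>l. pe y m (t x k, arr (t x k) (l - k)) * f (x, arr x k))"
    using assms by (rule KQ_mult)
  also have "\<dots> = (\<Sum>k\<le>l. if k = l - m then if m \<le> l \<and> t x (l - m) = y then f (x, arr x (l - m)) else 0 else 0)"
  proof (rule sum.cong[OF refl])
    fix k assume "k \<in> {..l}"
    then have "l - k = m \<longleftrightarrow> m \<le> l \<and> k = l - m" by auto
    then show "pe y m (t x k, arr (t x k) (l - k)) * f (x, arr x k) =
        (if k = l - m then if m \<le> l \<and> t x (l - m) = y then f (x, arr x (l - m)) else 0 else 0)"
      unfolding pe_apply by auto
  qed
  finally show ?thesis by (simp add: sum.delta)
qed

lemma mult_pe: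
  assumes "valid x l"
  shows "(f \<otimes>\<^bsub>KQ\<^esub> pe y m) (x, arr x l) = (if x = y \<and> m \<le> l then f (t y m, arr (t y m) (l - m)) else 0)"
proof -
  have "(f \<otimes>\<^bsub>KQ\<^esub> pe y m) (x, arr x l) = (\<Sum>k\<le>l. f (t x k, arr (t x k) (l - k)) * pe y m (x, arr x k))"
    using assms by (rule KQ_mult)
  also have "\<dots> = (\<Sum>k\<le>l. if k = m then if x = y \<and> m \<le> l then f (t y m, arr (t y m) (l - m)) else 0 else 0)"
    by (rule sum.cong) (auto simp: pe_apply)
  finally show ?thesis by (simp add: sum.delta)
qed

end

section \<open>Admissible ideals are spanned by paths\<close>

locale bound_functional_quiver = functional_quiver Q V E s
  for Q :: "('v, 'v) pre_digraph" and V E :: "'v set" and s :: "'v \<Rightarrow> 'v" +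
  fixes I :: "(('v, 'v) qpath \<Rightarrow> 'k::field) set"
  assumes adm: "admissible Q I"
begin

abbreviation K :: "('k, ('v, 'v) qpath \<Rightarrow> 'k) module" where "K \<equiv> path_algebra Q"

lemma ideal_I: "ideal I K"
  using adm by (simp add: admissible_def)

text \<open>The locale \<open>ideal\<close> includes the ring axioms, so those of the path algebra
  arrive together with the admissible ideal.\<close>

sublocale I: ideal I K by (rule ideal_I)

text \<open>An ideal of the ring is a subspace over \<open>K\<close>, since the scalar multiples of
  the identity belong to the path algebra.\<close>

lemma scalar_closed:
  assumes "ideal S K" "f \<in> S" shows "(\<lambda>p. c * f p) \<in> S"
proof -
  interpret S: ideal S K by fact
  have f: "f \<in> carrier K" using assms S.Icarr by blast
  have c: "c \<odot>\<^bsub>K\<^esub> \<one>\<^bsub>K\<^esub> \<in> carrier K"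
    using I.one_closed by (auto simp: KQ_simps intro: finite_subset[rotated])
  have "(c \<odot>\<^bsub>K\<^esub> \<one>\<^bsub>K\<^esub>) \<otimes>\<^bsub>K\<^esub> f = (\<lambda>p. c * f p)"
  proof (rule KQ_eqI)
    show "(c \<odot>\<^bsub>K\<^esub> \<one>\<^bsub>K\<^esub>) \<otimes>\<^bsub>K\<^esub> f \<in> carrier K" using c f by simp
    show "(\<lambda>p. c * f p) \<in> carrier K"
      using f by (auto simp: KQ_simps intro: finite_subset[rotated])
    fix x l assume l: "valid x l"
    have "((c \<odot>\<^bsub>K\<^esub> \<one>\<^bsub>K\<^esub>) \<otimes>\<^bsub>K\<^esub> f) (x, arr x l) = (\<Sum>k\<le>l. if k = l then c * f (x, arr x l) else 0)"
      unfolding KQ_mult[OF l] using l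
      by (intro sum.cong) (auto simp: KQ_simps t_in_V valid_mono)
    then show "((c \<odot>\<^bsub>K\<^esub> \<one>\<^bsub>K\<^esub>) \<otimes>\<^bsub>K\<^esub> f) (x, arr x l) = c * f (x, arr x l)" by simp
  qed
  then show ?thesis using S.I_l_closed[OF assms(2) c] by simp
qed

lemma mem_ideal_if_support:
  assumes S: "ideal S K" and f: "f \<in> carrier K"
    and sup: "\<And>x l. \<lbrakk>valid x l; f (x, arr x l) \<noteq> 0\<rbrakk> \<Longrightarrow> pe x l \<in> S"
  shows "f \<in> S"
proof -
  interpret S: ideal S K by fact
  have "(\<lambda>p. if p \<in> F then f p else 0) \<in> S" if "finite F" "F \<subseteq> {p. f p \<noteq> 0}" for F
    using that
  proof (induction F)
    case empty
    then show ?case using S.zero_closed by (simp add: KQ_simps)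
  next
    case (insert p F)
    then have "p \<in> qpaths Q" using f by (auto simp: KQ_simps)
    then obtain x l where p: "p = (x, arr x l)" "valid x l" by (rule qpathsE)
    have "pe x l \<in> S" using sup p insert.prems by auto
    then have "(\<lambda>q. f p * pe x l q) \<in> S" by (rule scalar_closed[OF S])
    moreover have "(\<lambda>p. if p \<in> F then f p else 0) \<in> S" using insert by auto
    ultimately have "(\<lambda>p. if p \<in> F then f p else 0) \<oplus>\<^bsub>K\<^esub> (\<lambda>q. f p * pe x l q) \<in> S"
      by (intro S.a_closed)
    moreover have "(\<lambda>p. if p \<in> F then f p else 0) \<oplus>\<^bsub>K\<^esub> (\<lambda>q. f p * pe x l q)
        = (\<lambda>q. if q \<in> insert p F then f q else 0)"
      using insert.hyps by (auto simp: KQ_simps p pe_def path_elem_def)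
    ultimately show ?case by simp
  qed
  from this[of "{p. f p \<noteq> 0}"] have "(\<lambda>p. if p \<in> {p. f p \<noteq> 0} then f p else 0) \<in> S"
    using f by (simp add: KQ_simps)
  moreover have "(\<lambda>p. if p \<in> {p. f p \<noteq> 0} then f p else 0) = f" by auto
  ultimately show ?thesis by simp
qed

lemma mult_zero_outside: "f \<in> carrier K \<Longrightarrow> g \<in> carrier K \<Longrightarrow> p \<notin> qpaths Q \<Longrightarrow> (f \<otimes>\<^bsub>K\<^esub> g) p = 0"
  using I.m_closed[of f g] by (auto simp: KQ_simps)

text \<open>The induction splits off the last arrow, because \<open>arrow_ideal_power\<close> adds
  its new factor on the left and products run from right to left.\<close>

lemma pe_in_arrow_ideal_power: "\<lbrakk>valid x l; m \<le> l\<rbrakk> \<Longrightarrow> (pe x l :: _ \<Rightarrow> 'k) \<in> arrow_ideal_power Q m"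
proof (induction m arbitrary: l)
  case 0
  then show ?case by (simp add: arrow_ideal_power_def pe_closed)
next
  case (Suc m)
  then obtain k where k: "l = Suc k" "m \<le> k" by (cases l) auto
  then have v: "valid x k" "valid (t x k) 1" using Suc.prems valid_add[of x k 1] by auto
  then have "t x k \<in> E" by (auto simp: valid_def)
  then have "(pe (t x k) 1 :: _ \<Rightarrow> 'k) \<in> arrow_ideal Q"
    unfolding arrow_ideal_def genideal_def pe_def by (auto simp: arr_Suc Q)
  moreover have "(pe x k :: _ \<Rightarrow> 'k) \<in> arrow_ideal_power Q m" using Suc.IH v(1) k(2) by simp
  ultimately have "pe (t x k) 1 \<otimes>\<^bsub>K\<^esub> pe x k \<in> arrow_ideal_power Q (Suc m)"
    by (simp add: arrow_ideal_power_def ideal_prod.prod)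
  moreover have "pe (t x k) 1 \<otimes>\<^bsub>K\<^esub> pe x k = (pe x l :: _ \<Rightarrow> 'k)"
    by (rule KQ_eqI) (use v Suc.prems k in \<open>auto simp: pe_mult pe_closed pe_apply\<close>)
  ultimately show ?case by simp
qed

text \<open>Taking the coefficient at a trivial path is multiplicative, so its vanishing at all
  vertices defines an ideal. This contains the arrows, hence \<open>I\<close>. The result keeps the
  vertex idempotents nonzero in the quotient.\<close>

lemma trivial_coeff_zero: assumes f: "f \<in> I" shows "f (x, []) = 0"
proof -
  let ?S = "{f \<in> carrier K. \<forall>x. f (x, []) = 0}"
  have prod0: "(f \<otimes>\<^bsub>K\<^esub> g) (x, []) = f (x, []) * g (x, [])" if "f \<in> carrier K" "g \<in> carrier K" for f g x
  proof (cases "x \<in> V")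
    case True
    then show ?thesis using KQ_mult[of x 0 f g] by simp
  next
    case False
    then have "(x, []) \<notin> qpaths Q" using arr_in_qpaths_iff[of x 0] by simp
    then show ?thesis using mult_zero_outside[OF that] that by (auto simp: KQ_simps)
  qed
  have S: "ideal ?S K"
  proof (rule I.ideal_if_closed)
    show "f \<oplus>\<^bsub>K\<^esub> g \<in> ?S" if "f \<in> ?S" "g \<in> ?S" for f g
      using that I.a_closed[of f g] by (auto simp: KQ_simps(3))
  qed (auto simp: prod0, auto simp: KQ_simps)
  have "arrow_ideal Q \<subseteq> ?S"
    unfolding arrow_ideal_def genideal_def
  proof (rule Inter_lower, rule CollectI, rule conjI[OF S], rule subsetI)
    fix f :: "_ \<Rightarrow> 'k" assume "f \<in> {path_elem (tail Q a, [a]) |a. a \<in> arcs Q}"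
    then obtain a where "a \<in> E" "f = pe a 1" by (auto simp: Q pe_def arr_Suc)
    moreover have "valid a 1" using \<open>a \<in> E\<close> E_subset by (auto simp: valid_def)
    moreover have "pe a 1 (x, []) = (0 :: 'k)" for x
      using pe_apply[of a 1 x 0] by simp
    ultimately show "f \<in> ?S" by (simp add: pe_closed)
  qed
  moreover have "arrow_ideal_power Q (Suc 0) \<subseteq> carrier K"
  proof
    fix f :: "_ \<Rightarrow> 'k" assume "f \<in> arrow_ideal_power Q (Suc 0)"
    then have "f \<in> ideal_prod K (arrow_ideal Q) (carrier K)" by (simp add: arrow_ideal_power_def)
    then show "f \<in> carrier K"
      by (induction rule: ideal_prod.induct) (use \<open>arrow_ideal Q \<subseteq> ?S\<close> in auto)
  qed
  moreover have "I \<subseteq> ideal_prod K (arrow_ideal Q) (arrow_ideal_power Q (Suc 0))"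
    using adm unfolding admissible_def arrow_ideal_power_def numeral_2_eq_2 by auto
  ultimately have "f \<in> ideal_prod K (arrow_ideal Q) (arrow_ideal_power Q (Suc 0))"
    "arrow_ideal Q \<subseteq> ?S" "arrow_ideal_power Q (Suc 0) \<subseteq> carrier K" using f by blast+
  then have "f \<in> ?S"
  proof (induction rule: ideal_prod.induct)
    case (prod i j)
    then have "i \<in> ?S" "j \<in> carrier K" by blast+
    then show ?case by (rule ideal.I_r_closed[OF S])
  next
    case (sum f g)
    then show ?case using additive_subgroup.a_closed[OF ideal.axioms(1)[OF S]] by blast
  qed
  then show ?thesis by simp
qed

text \<open>The lowest term argument again. A power of the arrow ideal inside \<open>I\<close>
  supplies the long paths; on a cycle, where paths have all lengths, this is what starts the
  downward induction.\<close>

lemma ex_L: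
  "\<exists>i. \<forall>x\<in>V. (\<forall>l<i x. valid x l) \<and> (\<forall>f\<in>I. \<forall>l<i x. f (x, arr x l) = 0) \<and> (\<forall>l\<ge>i x. valid x l \<longrightarrow> pe x l \<in> I)"
proof -
  obtain m where m: "arrow_ideal_power Q m \<subseteq> I" using adm by (auto simp: admissible_def)
  have "\<exists>i. (\<forall>l<i. valid x l) \<and> (\<forall>f\<in>I. \<forall>l<i. f (x, arr x l) = 0) \<and> (\<forall>l\<ge>i. valid x l \<longrightarrow> pe x l \<in> I)"
    if x: "x \<in> V" for x
  proof -
    let ?T = "(\<lambda>f l. f (x, arr x l)) ` I" and ?D = "{l. valid x l}"
    have "finite {l. f l \<noteq> 0} \<and> {l. f l \<noteq> 0} \<subseteq> ?D" if "f \<in> ?T" for f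
    proof -
      from that obtain h where h: "h \<in> I" "f = (\<lambda>l. h (x, arr x l))" by auto
      then have h': "finite {p. h p \<noteq> 0}" "{p. h p \<noteq> 0} \<subseteq> qpaths Q"
        using I.Icarr by (auto simp: KQ_simps)
      have "(\<lambda>l. (x, arr x l)) ` {l. f l \<noteq> 0} \<subseteq> {p. h p \<noteq> 0}" using h by auto
      then have "finite {l. f l \<noteq> 0}"
        using h'(1) by (intro finite_imageD[of "\<lambda>l. (x, arr x l)"]) (auto simp: inj_on_def intro: finite_subset)
      moreover have "{l. f l \<noteq> 0} \<subseteq> ?D"
      proof
        fix l assume "l \<in> {l. f l \<noteq> 0}"
        then have "(x, arr x l) \<in> qpaths Q" using h(2) h'(2) by auto
        then show "l \<in> ?D" by simp
      qed
      ultimately show ?thesis by blast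
    qed
    moreover have "(\<lambda>l. 0) \<in> ?T"
      using additive_subgroup.zero_closed[OF ideal.axioms(1)[OF ideal_I]]
      by (intro image_eqI[of _ _ "\<lambda>p. 0"]) (simp_all add: KQ_simps(2))
    moreover have "(\<lambda>l. f l + g l) \<in> ?T" if "f \<in> ?T" "g \<in> ?T" for f g
    proof -
      from that obtain h k where hk: "h \<in> I" "f = (\<lambda>l. h (x, arr x l))" "k \<in> I" "g = (\<lambda>l. k (x, arr x l))" by auto
      then show ?thesis
        using additive_subgroup.a_closed[OF ideal.axioms(1)[OF ideal_I], of h k]
        by (intro image_eqI[of _ _ "\<lambda>p. h p + k p"]) (simp_all add: KQ_simps(3))
    qed
    moreover have "(\<lambda>l. c * f l) \<in> ?T" if "f \<in> ?T" for c f
    proof -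
      from that obtain h where h: "h \<in> I" "f = (\<lambda>l. h (x, arr x l))" by auto
      then show ?thesis
        using scalar_closed[OF ideal_I, of h c] by (intro image_eqI[of _ _ "\<lambda>p. c * h p"]) auto
    qed
    moreover have "(\<lambda>l. if l \<in> ?D \<and> d \<le> l \<and> t x (l - d) = t x i then f (l - d) else 0) \<in> ?T"
      if "f \<in> ?T" and D: "i + d \<in> ?D" for f i d
    proof -
      from that obtain h where h: "h \<in> I" "f = (\<lambda>l. h (x, arr x l))" by auto
      have p: "pe (t x i) d \<in> carrier K" using D valid_add[of x i d] by (simp add: pe_closed)
      have "(pe (t x i) d \<otimes>\<^bsub>K\<^esub> h) (x, arr x l) =
          (if l \<in> ?D \<and> d \<le> l \<and> t x (l - d) = t x i then f (l - d) else 0)" for l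
      proof (cases "valid x l")
        case False
        then show ?thesis using mult_zero_outside[OF p I.Icarr[OF h(1)]] by simp
      qed (simp add: pe_mult h(2))
      then show ?thesis
        using I.I_l_closed[OF h(1) p] by (intro image_eqI[of _ _ "pe (t x i) d \<otimes>\<^bsub>K\<^esub> h"]) auto
    qed
    moreover have "(\<lambda>j. if j = l then 1 else 0) \<in> ?T" if "l \<in> ?D" "m \<le> l" for l
      using that m pe_in_arrow_ideal_power[of x l m]
      by (intro image_eqI[of _ _ "pe x l"]) (auto simp: pe_apply)
    ultimately obtain i where i: "\<And>l. l < i \<Longrightarrow> l \<in> ?D"
      "\<And>f. f \<in> ?T \<longleftrightarrow> finite {l. f l \<noteq> 0} \<and> {l. f l \<noteq> 0} \<subseteq> ?D \<and> (\<forall>l<i. f l = 0)"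
      by (rule least_closed_under_shifts[of ?T ?D "\<lambda>l. t x l" m]) (auto intro: valid_mono)
    have "pe x l \<in> I" if l: "i \<le> l" "valid x l" for l
    proof -
      have "(\<lambda>j. if j = l then 1 else 0) \<in> ?T" unfolding i(2) using l by auto
      then obtain h where h: "h \<in> I" "\<And>j. h (x, arr x j) = (if j = l then 1 else 0)"
        by (auto simp: fun_eq_iff)
      \<comment> \<open>\<open>h\<close> is known only at paths from \<open>x\<close>; multiplying
        by the trivial path at \<open>x\<close> removes the others.\<close>
      have "h \<otimes>\<^bsub>K\<^esub> pe x 0 = pe x l"
        by (rule KQ_eqI) (use x l(2) h in \<open>auto simp: mult_pe pe_closed pe_apply I.Icarr\<close>)
      then show ?thesis
        using I.I_r_closed[OF h(1) pe_closed, of x 0] x by simp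
    qed
    moreover have "f (x, arr x l) = 0" if "f \<in> I" "l < i" for f l
    proof -
      have "(\<lambda>l. f (x, arr x l)) \<in> ?T" using that by blast
      then show ?thesis unfolding i(2) using that by blast
    qed
    ultimately show ?thesis using i(1) by blast
  qed
  then show ?thesis by metis
qed

definition L :: "'v \<Rightarrow> nat" where
  "L = (SOME i. \<forall>x\<in>V. (\<forall>l<i x. valid x l) \<and> (\<forall>f\<in>I. \<forall>l<i x. f (x, arr x l) = 0) \<and>
    (\<forall>l\<ge>i x. valid x l \<longrightarrow> pe x l \<in> I))"

lemma
  assumes x: "x \<in> V"
  shows valid_if_less_L: "\<And>l. l < L x \<Longrightarrow> valid x l"
    and coeff_zero: "\<And>f l. \<lbrakk>f \<in> I; l < L x\<rbrakk> \<Longrightarrow> f (x, arr x l) = 0"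
    and pe_in_I: "\<And>l. \<lbrakk>valid x l; L x \<le> l\<rbrakk> \<Longrightarrow> pe x l \<in> I"
proof -
  have "\<forall>x\<in>V. (\<forall>l<L x. valid x l) \<and> (\<forall>f\<in>I. \<forall>l<L x. f (x, arr x l) = 0) \<and>
    (\<forall>l\<ge>L x. valid x l \<longrightarrow> pe x l \<in> I)"
    using someI_ex[OF ex_L] unfolding L_def .
  then show "\<And>l. l < L x \<Longrightarrow> valid x l" "\<And>f l. \<lbrakk>f \<in> I; l < L x\<rbrakk> \<Longrightarrow> f (x, arr x l) = 0"
    "\<And>l. \<lbrakk>valid x l; L x \<le> l\<rbrakk> \<Longrightarrow> pe x l \<in> I"
    using x by blast+
qed

lemma valid_V: "valid x l \<Longrightarrow> x \<in> V"
  by (simp add: valid_def)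

lemma pe_in_I_iff:
  assumes "valid x l" shows "pe x l \<in> I \<longleftrightarrow> L x \<le> l"
proof
  assume "pe x l \<in> I"
  then show "L x \<le> l"
    using coeff_zero[OF valid_V[OF assms], of "pe x l" l] by (force simp: pe_apply)
qed (use pe_in_I valid_V assms in blast)

lemma mem_I_iff:
  assumes "f \<in> carrier K" shows "f \<in> I \<longleftrightarrow> (\<forall>x\<in>V. \<forall>l<L x. f (x, arr x l) = 0)"
proof
  assume R: "\<forall>x\<in>V. \<forall>l<L x. f (x, arr x l) = 0"
  show "f \<in> I"
  proof (rule mem_ideal_if_support[OF ideal_I assms])
    fix x l assume "valid x l" "f (x, arr x l) \<noteq> 0"
    then show "pe x l \<in> I" using R valid_V[of x l] by (intro pe_in_I) (auto simp: not_less[symmetric])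
  qed
qed (use coeff_zero in blast)

lemma L_pos: assumes "x \<in> V" shows "0 < L x"
proof (rule ccontr)
  assume "\<not> 0 < L x"
  then have "pe x 0 \<in> I" using assms by (intro pe_in_I) auto
  then have "pe x 0 (x, arr x 0) = (0 :: 'k)" using trivial_coeff_zero by simp
  then show False unfolding pe_apply by simp
qed

text \<open>If the path of length \<open>l\<close> from \<open>s x\<close> were in \<open>I\<close>,
  so would be its product with the arrow at \<open>x\<close>, which is too short to be zero.\<close>

lemma L_step: assumes x: "x \<in> V" and l: "Suc l < L x" shows "s x \<in> V \<and> l < L (s x)"
proof -
  have v: "valid x (Suc l)" using valid_if_less_L[OF x l] .
  then have v': "valid x 1" "valid (s x) l" using valid_add[of x 1 l] by auto
  have "s x \<in> V" using v'(2) by (rule valid_V)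
  moreover have "l < L (s x)"
  proof (rule ccontr)
    assume "\<not> l < L (s x)"
    then have "pe (s x) l \<in> I" using v'(2) \<open>s x \<in> V\<close> by (intro pe_in_I) auto
    then have "pe (s x) l \<otimes>\<^bsub>K\<^esub> pe x 1 \<in> I" using pe_closed[OF v'(1)] by (rule I.I_r_closed)
    then have "(pe (s x) l \<otimes>\<^bsub>K\<^esub> pe x 1) (x, arr x (Suc l)) = 0" using coeff_zero[OF x _ l] by blast
    then show False using v by (simp add: mult_pe pe_apply)
  qed
  ultimately show ?thesis by blast
qed

text \<open>For \<open>j \<ge> L x\<close> the claim is trivial, so it also covers the case that
  \<open>t x j\<close> is outside \<open>V\<close>, where \<open>L\<close> is arbitrary.\<close>

lemma L_le_shift: "x \<in> V \<Longrightarrow> L x \<le> L (t x j) + j"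
proof (induction j)
  case (Suc j)
  show ?case
  proof (cases "Suc j < L x")
    case True
    then have v: "valid x j" by (intro valid_if_less_L[OF Suc.prems]) simp
    have "Suc (L x - Suc (Suc j)) < L (t x j)" using Suc True by simp
    from L_step[OF t_in_V[OF v] this] have "L x - Suc (Suc j) < L (t x (Suc j))" by simp
    then show ?thesis using True by linarith
  qed simp
qed simp

section \<open>The quotient as a truncated path algebra\<close>

abbreviation B :: "('k, (('v, 'v) qpath \<Rightarrow> 'k) set) module" where
  "B \<equiv> bound_quiver_algebra Q I"

text \<open>The choice of a representative is harmless, because elements of \<open>I\<close> vanish
  at the paths from \<open>x\<close> that are shorter than \<open>L x\<close>.\<close>

definition co :: "(('v, 'v) qpath \<Rightarrow> 'k) set \<Rightarrow> 'v \<Rightarrow> nat \<Rightarrow> 'k" where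
  "co X x l = (if x \<in> V \<and> l < L x then (SOME f. f \<in> X) (x, arr x l) else 0)"

lemma mem_cosetE:
  assumes "g \<in> I +>\<^bsub>K\<^esub> f" obtains h where "h \<in> I" "g = (\<lambda>p. h p + f p)"
  using assms by (auto simp: a_r_coset_def' KQ_simps(3))

lemma co_coset:
  assumes "f \<in> carrier K"
  shows "co (I +>\<^bsub>K\<^esub> f) x l = (if x \<in> V \<and> l < L x then f (x, arr x l) else 0)"
proof -
  have "(SOME g. g \<in> I +>\<^bsub>K\<^esub> f) \<in> I +>\<^bsub>K\<^esub> f"
    using I.a_rcos_self[OF assms] by (rule someI[of "\<lambda>g. g \<in> I +>\<^bsub>K\<^esub> f"])
  then obtain h where "h \<in> I" "(SOME g. g \<in> I +>\<^bsub>K\<^esub> f) = (\<lambda>p. h p + f p)" by (rule mem_cosetE)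
  then show ?thesis using coeff_zero by (auto simp: co_def)
qed

lemma coset_eqI:
  assumes f: "f \<in> carrier K" and g: "g \<in> carrier K"
    and eq: "\<And>x l. \<lbrakk>x \<in> V; l < L x\<rbrakk> \<Longrightarrow> f (x, arr x l) = g (x, arr x l)"
  shows "I +>\<^bsub>K\<^esub> f = I +>\<^bsub>K\<^esub> g"
proof -
  have "f \<ominus>\<^bsub>K\<^esub> g \<in> carrier K" using f g by simp
  moreover have fg: "f = (f \<ominus>\<^bsub>K\<^esub> g) \<oplus>\<^bsub>K\<^esub> g"
    using f g by (simp add: I.minus_eq I.a_assoc I.l_neg)
  then have "(f \<ominus>\<^bsub>K\<^esub> g) p = f p - g p" for p
    unfolding KQ_simps(3) by (metis add_diff_cancel_right')
  ultimately have "f \<ominus>\<^bsub>K\<^esub> g \<in> I" using eq by (simp add: mem_I_iff)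
  then have "f \<in> I +>\<^bsub>K\<^esub> g" using fg unfolding a_r_coset_def' by blast
  then show ?thesis using I.a_repr_independence'[OF _ g] by blast
qed

lemma B_simps:
  "carrier B = (\<lambda>f. I +>\<^bsub>K\<^esub> f) ` carrier K"
  "\<lbrakk>f \<in> carrier K; g \<in> carrier K\<rbrakk> \<Longrightarrow> (I +>\<^bsub>K\<^esub> f) \<oplus>\<^bsub>B\<^esub> (I +>\<^bsub>K\<^esub> g) = I +>\<^bsub>K\<^esub> (f \<oplus>\<^bsub>K\<^esub> g)"
  "\<lbrakk>f \<in> carrier K; g \<in> carrier K\<rbrakk> \<Longrightarrow> (I +>\<^bsub>K\<^esub> f) \<otimes>\<^bsub>B\<^esub> (I +>\<^bsub>K\<^esub> g) = I +>\<^bsub>K\<^esub> (f \<otimes>\<^bsub>K\<^esub> g)"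
  "\<one>\<^bsub>B\<^esub> = I +>\<^bsub>K\<^esub> \<one>\<^bsub>K\<^esub>"
  by (auto simp: bound_quiver_algebra_def quot_algebra_def FactRing_def A_RCOSETS_def'
      I.a_rcos_sum I.rcoset_mult_add)

lemma smult_in_K: "f \<in> carrier K \<Longrightarrow> c \<odot>\<^bsub>K\<^esub> f \<in> carrier K"
  by (auto simp: KQ_simps intro: finite_subset[rotated])

lemma B_smult:
  assumes f: "f \<in> carrier K"
  shows "c \<odot>\<^bsub>B\<^esub> (I +>\<^bsub>K\<^esub> f) = I +>\<^bsub>K\<^esub> (c \<odot>\<^bsub>K\<^esub> f)"
proof -
  have "I +>\<^bsub>K\<^esub> (c \<odot>\<^bsub>K\<^esub> g) = I +>\<^bsub>K\<^esub> (c \<odot>\<^bsub>K\<^esub> f)" if g: "g \<in> I +>\<^bsub>K\<^esub> f" for g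
  proof -
    obtain h where "h \<in> I" "g = (\<lambda>p. h p + f p)" using g by (rule mem_cosetE)
    moreover have "g \<in> carrier K" using g f I.a_elemrcos_carrier by blast
    ultimately show ?thesis
      using f by (intro coset_eqI smult_in_K) (auto simp: KQ_simps(4) coeff_zero)
  qed
  moreover have "f \<in> I +>\<^bsub>K\<^esub> f" using f by (rule I.a_rcos_self)
  moreover have "c \<odot>\<^bsub>B\<^esub> (I +>\<^bsub>K\<^esub> f) = (\<Union>g\<in>I +>\<^bsub>K\<^esub> f. I +>\<^bsub>K\<^esub> (c \<odot>\<^bsub>K\<^esub> g))"
    by (simp add: bound_quiver_algebra_def quot_algebra_def)
  ultimately show ?thesis by blast
qed

lemma ring_B: "ring B"
  by (rule ring_cong[OF I.quotient_is_ring])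
     (simp_all add: bound_quiver_algebra_def quot_algebra_def)

lemma vertex_idem_eq: "vertex_idem Q I x = I +>\<^bsub>K\<^esub> pe x 0"
  by (simp add: vertex_idem_def pe_def)

lemma truncated_path_algebra_B: "truncated_path_algebra B (vertex_idem Q I) V s L co"
proof (rule truncated_path_algebra.intro)
  show "ring B" by (rule ring_B)
  show "finite V" by (rule finite_V)
  show "0 < L x" if "x \<in> V" for x using that by (rule L_pos)
  show "s x \<in> V \<and> l < L (s x)" if "x \<in> V" "Suc l < L x" for x l using that by (rule L_step)
  show "bij_betw co (carrier B) {f. \<forall>x l. f x l \<noteq> 0 \<longrightarrow> x \<in> V \<and> l < L x}"
    unfolding bij_betw_def
  proof
    show "inj_on co (carrier B)"
    proof (rule inj_onI)
      fix X Y assume "X \<in> carrier B" "Y \<in> carrier B" and eq: "co X = co Y"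
      then obtain f g where f: "f \<in> carrier K" "X = I +>\<^bsub>K\<^esub> f" and g: "g \<in> carrier K" "Y = I +>\<^bsub>K\<^esub> g"
        unfolding B_simps by blast
      have "f (x, arr x l) = g (x, arr x l)" if "x \<in> V" "l < L x" for x l
      proof -
        have "co X x l = co Y x l" using eq by simp
        then show ?thesis using that by (simp add: f g co_coset)
      qed
      then show "X = Y" unfolding f g by (intro coset_eqI f g)
    qed
    show "co ` carrier B = {f. \<forall>x l. f x l \<noteq> 0 \<longrightarrow> x \<in> V \<and> l < L x}"
    proof (intro equalityI subsetI)
      fix F assume "F \<in> co ` carrier B"
      then show "F \<in> {f. \<forall>x l. f x l \<noteq> 0 \<longrightarrow> x \<in> V \<and> l < L x}"
        by (auto simp: co_def split: if_splits)
    next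
      fix F :: "'v \<Rightarrow> nat \<Rightarrow> 'k" assume F: "F \<in> {f. \<forall>x l. f x l \<noteq> 0 \<longrightarrow> x \<in> V \<and> l < L x}"
      \<comment> \<open>Lists that are not of the form \<open>arr x l\<close> get the coefficient
        zero, so \<open>f\<close> is supported on nonzero paths.\<close>
      define f where "f p = (if snd p = arr (fst p) (length (snd p)) then F (fst p) (length (snd p)) else 0)" for p
      have f_arr: "f (x, arr x l) = F x l" for x l by (simp add: f_def)
      have sub: "{p. f p \<noteq> 0} \<subseteq> (\<Union>x\<in>V. (\<lambda>l. (x, arr x l)) ` {..<L x})"
      proof
        fix p assume "p \<in> {p. f p \<noteq> 0}"
        then have p: "snd p = arr (fst p) (length (snd p))" "F (fst p) (length (snd p)) \<noteq> 0"
          by (auto simp: f_def split: if_splits)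
        then have "p = (fst p, arr (fst p) (length (snd p)))" by (metis prod.collapse)
        then show "p \<in> (\<Union>x\<in>V. (\<lambda>l. (x, arr x l)) ` {..<L x})" using F p(2) by blast
      qed
      then have "finite {p. f p \<noteq> 0}"
        using finite_V by (auto intro: finite_subset)
      moreover have "{p. f p \<noteq> 0} \<subseteq> qpaths Q"
        using sub valid_if_less_L by fastforce
      ultimately have fK: "f \<in> carrier K" by (simp add: KQ_simps)
      then have "co (I +>\<^bsub>K\<^esub> f) = F"
        using F by (auto simp: fun_eq_iff co_coset f_arr)
      then show "F \<in> co ` carrier B" unfolding B_simps using fK by blast
    qed
  qed
  show "co (X \<oplus>\<^bsub>B\<^esub> Y) x l = co X x l + co Y x l" if "X \<in> carrier B" "Y \<in> carrier B" for X Y x l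
  proof -
    from that obtain f g where f: "f \<in> carrier K" "X = I +>\<^bsub>K\<^esub> f" and g: "g \<in> carrier K" "Y = I +>\<^bsub>K\<^esub> g"
      unfolding B_simps(1) by blast
    then show ?thesis
      using co_coset[OF I.a_closed[OF f(1) g(1)]] by (simp add: B_simps(2) co_coset) (simp add: KQ_simps(3))
  qed
  show "co (X \<otimes>\<^bsub>B\<^esub> Y) x l =
      (if x \<in> V \<and> l < L x then \<Sum>k\<le>l. co X (t x k) (l - k) * co Y x k else 0)"
    if XY: "X \<in> carrier B" "Y \<in> carrier B" for X Y x l
  proof (cases "x \<in> V \<and> l < L x")
    case True
    from XY obtain f g where f: "f \<in> carrier K" "X = I +>\<^bsub>K\<^esub> f" and g: "g \<in> carrier K" "Y = I +>\<^bsub>K\<^esub> g"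
      unfolding B_simps by blast
    have "co X (t x k) (l - k) * co Y x k = f (t x k, arr (t x k) (l - k)) * g (x, arr x k)" if "k \<le> l" for k
    proof -
      have "valid x k" using True that by (intro valid_if_less_L) auto
      \<comment> \<open>With this, \<open>co\<close> returns the actual coefficient at both pieces,
        so that truncation loses no product.\<close>
      moreover have "l - k < L (t x k)" using L_le_shift[of x k] True that by linarith
      ultimately show ?thesis using True that t_in_V by (simp add: f g co_coset)
    qed
    then have sum: "(\<Sum>k\<le>l. co X (t x k) (l - k) * co Y x k)
        = (\<Sum>k\<le>l. f (t x k, arr (t x k) (l - k)) * g (x, arr x k))"
      by (intro sum.cong) auto
    have "valid x l" using True valid_if_less_L by blast
    then have "co (X \<otimes>\<^bsub>B\<^esub> Y) x l = (\<Sum>k\<le>l. f (t x k, arr (t x k) (l - k)) * g (x, arr x k))"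
      using True by (simp add: f g B_simps(3) co_coset KQ_mult)
    then show ?thesis using True by (simp add: sum)
  next
    case False
    then show ?thesis by (auto simp: co_def)
  qed
  show "co \<one>\<^bsub>B\<^esub> x l = (if x \<in> V \<and> l = 0 then 1 else 0)" for x l
    unfolding B_simps(4) co_coset[OF I.one_closed]
    using L_pos valid_if_less_L arr_in_qpaths_iff[of x 0] by (auto simp: KQ_simps(5))
  show "c \<odot>\<^bsub>B\<^esub> X \<in> carrier B" if "X \<in> carrier B" for c X
    using that unfolding B_simps(1) by (auto simp: B_smult smult_in_K)
  show "co (c \<odot>\<^bsub>B\<^esub> X) x l = c * co X x l" if "X \<in> carrier B" for c X x l
  proof -
    from that obtain f where "f \<in> carrier K" "X = I +>\<^bsub>K\<^esub> f" unfolding B_simps(1) by blast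
    then show ?thesis
      by (simp add: B_smult co_coset smult_in_K) (simp add: KQ_simps(4))
  qed
  show "vertex_idem Q I x \<in> carrier B" if "x \<in> V" for x
    unfolding B_simps(1) vertex_idem_eq by (rule imageI, rule pe_closed) (use that in simp)
  show "co (vertex_idem Q I x) y l = (if y = x \<and> l = 0 then 1 else 0)" if "x \<in> V" for x y l
  proof -
    have "pe x 0 (x, arr x 0) = (1 :: 'k)" unfolding pe_apply by simp
    then show ?thesis
      using that L_pos by (auto simp: vertex_idem_eq co_coset pe_closed pe_apply)
  qed
qed

text \<open>The shortest zero path from \<open>x\<close> is minimal if it stays nonzero without its first arrow.\<close>

definition rels :: "('v, 'v) qpath set" where
  "rels = {(x, arr x (L x)) | x. valid x (L x) \<and> L x \<le> L (s x)}"

section \<open>Subpaths and the minimal relations\<close>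

definition covers :: "('v, 'v) qpath set \<Rightarrow> 'v \<Rightarrow> nat \<Rightarrow> bool" where
  "covers G x l \<longleftrightarrow> (\<exists>i k. i + k \<le> l \<and> (t x i, arr (t x i) k) \<in> G)"

lemma covers_rels: "\<lbrakk>valid x l; L x \<le> l\<rbrakk> \<Longrightarrow> covers rels x l"
proof (induction l arbitrary: x)
  case 0
  then show ?case using L_pos[of x] by auto
next
  case (Suc l)
  show ?case
  proof (cases "L x \<le> L (s x)")
    case True
    then have "(t x 0, arr (t x 0) (L x)) \<in> rels"
      using valid_mono[OF Suc.prems] by (auto simp: rels_def)
    then show ?thesis unfolding covers_def using Suc.prems by (intro exI[of _ 0] exI[of _ "L x"]) auto
  next
    case False
    have "valid (s x) l" using Suc.prems(1) valid_add[of x 1 l] by simp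
    moreover have "L (s x) \<le> l" using False Suc.prems(2) by simp
    ultimately obtain i k where "i + k \<le> l" "(t (s x) i, arr (t (s x) i) k) \<in> rels"
      using Suc.IH unfolding covers_def by blast
    then show ?thesis
      unfolding covers_def t_s by (intro exI[of _ "Suc i"] exI[of _ k]) auto
  qed
qed

text \<open>A subpath in \<open>G\<close> persists when the path is extended at either end. In
  \<open>covers_if_generates\<close> this ideal shows that every zero path contains a
  generator.\<close>

lemma ideal_of_covered_paths:
  "ideal {f \<in> carrier K. \<forall>x l. f (x, arr x l) \<noteq> 0 \<longrightarrow> covers G x l} K" (is "ideal ?S K")
proof (rule I.ideal_if_closed)
  have zero: "f (x, arr x l) = 0" if "f \<in> carrier K" "\<not> valid x l" for f :: "_ \<Rightarrow> 'k" and x l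
    using that arr_in_qpaths_iff[of x l] by (auto simp: KQ_simps simp del: arr_in_qpaths_iff)
  show "f \<oplus>\<^bsub>K\<^esub> g \<in> ?S" if "f \<in> ?S" "g \<in> ?S" for f g
    using that I.a_closed[of f g] by (auto simp: KQ_simps(3)) (metis add_0)
  show "g \<otimes>\<^bsub>K\<^esub> f \<in> ?S" if f: "f \<in> ?S" and g: "g \<in> carrier K" for f g
  proof -
    have "covers G x l" if nz: "(g \<otimes>\<^bsub>K\<^esub> f) (x, arr x l) \<noteq> 0" for x l
    proof -
      have v: "valid x l" using nz zero[of "g \<otimes>\<^bsub>K\<^esub> f"] f g by blast
      obtain k where "k \<le> l" "f (x, arr x k) \<noteq> 0"
        using nz unfolding KQ_mult[OF v] by (metis (no_types, lifting) atMost_iff mult_zero_right sum.neutral)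
      then show ?thesis using f unfolding covers_def by (auto, meson order_trans)
    qed
    then show ?thesis using f g by simp
  qed
  show "f \<otimes>\<^bsub>K\<^esub> g \<in> ?S" if f: "f \<in> ?S" and g: "g \<in> carrier K" for f g
  proof -
    have "covers G x l" if nz: "(f \<otimes>\<^bsub>K\<^esub> g) (x, arr x l) \<noteq> 0" for x l
    proof -
      have v: "valid x l" using nz zero[of "f \<otimes>\<^bsub>K\<^esub> g"] f g by blast
      obtain k where k: "k \<le> l" "f (t x k, arr (t x k) (l - k)) \<noteq> 0"
        using nz unfolding KQ_mult[OF v] by (metis (no_types, lifting) atMost_iff mult_zero_left sum.neutral)
      then have "covers G (t x k) (l - k)" using f by blast
      then obtain i m where im: "i + m \<le> l - k" "(t x (k + i), arr (t x (k + i)) m) \<in> G"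
        unfolding covers_def t_t by blast
      have "k + i + m \<le> l" using im(1) k(1) by simp
      then show ?thesis unfolding covers_def using im(2) by blast
    qed
    then show ?thesis using f g by simp
  qed
qed (auto simp: KQ_simps)

lemma covers_if_generates:
  assumes G: "generates Q G I" and x: "valid x l" "L x \<le> l"
  shows "covers G x l"
proof -
  let ?S = "{f \<in> carrier K. \<forall>x l. f (x, arr x l) \<noteq> 0 \<longrightarrow> covers G x l}"
  have "path_elem ` G \<subseteq> ?S"
  proof
    fix f :: "_ \<Rightarrow> 'k" assume "f \<in> path_elem ` G"
    then obtain p where "p \<in> G" "f = path_elem p" by blast
    moreover then obtain y m where p: "p = (y, arr y m)" "valid y m"
      using G qpathsE by (metis generates_def subsetD)
    ultimately have f: "f = pe y m" "(t y 0, arr (t y 0) m) \<in> G" by (auto simp: pe_def)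
    then have "covers G y m" unfolding covers_def by (intro exI[of _ 0] exI[of _ m]) simp
    then show "f \<in> ?S" using f(1) p(2) by (auto simp: pe_closed pe_apply split: if_splits)
  qed
  then have "I \<subseteq> ?S"
    using G ideal_of_covered_paths[of G] unfolding generates_def genideal_def by blast
  moreover have "pe x l \<in> I" using x valid_V by (intro pe_in_I)
  ultimately have "\<forall>y m. pe x l (y, arr y m) \<noteq> (0 :: 'k) \<longrightarrow> covers G y m" by blast
  then show ?thesis by (metis pe_apply zero_neq_one)
qed

lemma rels_generates: "generates Q rels I"
proof -
  have sub: "rels \<subseteq> qpaths Q" by (auto simp: rels_def)
  have "path_elem ` rels \<subseteq> I"
    using pe_in_I valid_V by (force simp: rels_def simp flip: pe_def)
  moreover have "I \<subseteq> S" if S: "ideal S K" "path_elem ` rels \<subseteq> S" for S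
  proof
    fix f assume f: "f \<in> I"
    interpret S: ideal S K by (rule S(1))
    show "f \<in> S"
    proof (rule mem_ideal_if_support[OF S(1) I.Icarr[OF f]])
      fix x l assume x: "valid x l" "f (x, arr x l) \<noteq> 0"
      then have "L x \<le> l" using coeff_zero[OF valid_V f] by (meson not_less)
      then obtain i k where ik: "i + k \<le> l" "(t x i, arr (t x i) k) \<in> rels"
        using covers_rels[OF x(1)] unfolding covers_def by blast
      have v: "valid x i" "valid (t x i) k" "valid (t x (i + k)) (l - (i + k))" "valid x (i + k)"
        using x(1) ik(1) valid_add[of x i k] valid_add[of x "i + k" "l - (i + k)"] by auto
      have "pe (t x i) k \<in> S" using ik(2) S(2) by (auto simp: pe_def)
      then have "pe (t x (i + k)) (l - (i + k)) \<otimes>\<^bsub>K\<^esub> (pe (t x i) k \<otimes>\<^bsub>K\<^esub> pe x i) \<in> S"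
        by (intro S.I_l_closed S.I_r_closed pe_closed v)
      moreover have "pe (t x i) k \<otimes>\<^bsub>K\<^esub> pe x i = (pe x (i + k) :: _ \<Rightarrow> 'k)"
        by (rule KQ_eqI) (use v in \<open>auto simp: pe_closed mult_pe pe_apply\<close>)
      moreover have "pe (t x (i + k)) (l - (i + k)) \<otimes>\<^bsub>K\<^esub> pe x (i + k) = (pe x l :: _ \<Rightarrow> 'k)"
        by (rule KQ_eqI) (use v x ik in \<open>auto simp: pe_closed mult_pe pe_apply\<close>)
      ultimately show "pe x l \<in> S" by simp
    qed
  qed
  ultimately show ?thesis
    using sub ideal_I unfolding generates_def genideal_def by blast
qed

text \<open>The zero path \<open>arr x (L x)\<close> contains a generator. This cannot start later,
  as the path without its first arrow is nonzero, and it cannot stop earlier, as shorter paths from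
  \<open>x\<close> are nonzero; so it is the path itself.\<close>

lemma rels_subset_if_generates:
  assumes G: "generates Q G I" shows "rels \<subseteq> G"
proof
  fix g assume "g \<in> rels"
  then obtain x where x: "g = (x, arr x (L x))" "valid x (L x)" "L x \<le> L (s x)"
    by (auto simp: rels_def)
  have "covers G x (L x)" using covers_if_generates[OF G x(2)] by simp
  then obtain i k where ik: "i + k \<le> L x" "(t x i, arr (t x i) k) \<in> G"
    unfolding covers_def by blast
  have v: "valid (t x i) k" using ik(2) G by (auto simp: generates_def)
  have "path_elem ` G \<subseteq> I" using G by (auto simp: generates_def genideal_def)
  then have "pe (t x i) k \<in> I" using ik(2) by (auto simp: pe_def)
  then have le: "L (t x i) \<le> k" using v by (simp add: pe_in_I_iff)
  have "i = 0"
  proof (cases i)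
    case (Suc j)
    have "s x \<in> V" using valid_add[of x 1 "L x - 1"] x(2) L_pos[OF valid_V[OF x(2)]] valid_V by auto
    then have "L (s x) \<le> L (t x i) + j" using L_le_shift[of "s x" j] Suc by (simp add: funpow_swap1)
    then show ?thesis using le ik(1) x(3) Suc by simp
  qed
  then show "g \<in> G" using le ik x(1) by auto
qed

text \<open>\<open>rels\<close> generates and is contained in every generating set, so no other set
  is minimal.\<close>

lemma minimal_relations_eq: "minimal_relations Q I = rels"
  unfolding minimal_relations_def
proof (rule the_equality)
  show "generates Q rels I \<and> (\<forall>G'. G' \<subset> rels \<longrightarrow> \<not> generates Q G' I)"
    using rels_generates rels_subset_if_generates by blast
  show "G = rels" if "generates Q G I \<and> (\<forall>G'. G' \<subset> G \<longrightarrow> \<not> generates Q G' I)" for G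
    using that rels_generates rels_subset_if_generates by blast
qed

section \<open>Interior vertices and the Q-set\<close>

lemma Int_verts_arr: "0 < l \<Longrightarrow> set_mset (Int_verts Q (x, arr x l)) = t x ` {0<..<l}"
proof -
  assume "0 < l"
  \<comment> \<open>One occurrence of each end is removed, so further visits to these vertices stay;
    \<open>0 < l\<close> makes the two ends separate entries.\<close>
  then have "[0..<Suc l] = 0 # [1..<l] @ [l]" by (simp add: upt_rec[of 0])
  then have "map (t x) [0..<Suc l] = x # map (t x) [1..<l] @ [t x l]" by simp
  then have "Int_verts Q (x, arr x l) = mset (map (t x) [1..<l])"
    unfolding Int_verts_def Hod_verts_def path_source_arr path_target_arr path_verts_arr by simp
  then show ?thesis by auto
qed

lemma Q_set_eq: "Q_set Q I = V - (\<Union>g\<in>rels. set_mset (Int_verts Q g))"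
proof -
  have "verts Q = V" by (simp add: Q)
  then show ?thesis by (simp add: Q_set_def minimal_relations_eq)
qed

lemma mem_Q_set_iff:
  "x \<in> Q_set Q I \<longleftrightarrow> x \<in> V \<and> (\<forall>y\<in>V. \<forall>j<L y. t y j = x \<longrightarrow> j + L x \<le> L y)" (is "_ \<longleftrightarrow> ?R")
proof
  assume "x \<in> Q_set Q I"
  then have x: "x \<in> V" and notin: "\<And>g. g \<in> rels \<Longrightarrow> x \<notin> set_mset (Int_verts Q g)"
    by (auto simp: Q_set_eq)
  have int: "t y j \<noteq> x" if "(y, arr y k) \<in> rels" "0 < j" "j < k" for y j k
    using notin[OF that(1)] that(2,3) Int_verts_arr[of k y] by force
  have "j + L x \<le> L y" if y: "y \<in> V" and j: "j < L y" "t y j = x" for y j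
  proof (rule ccontr)
    assume "\<not> j + L x \<le> L y"
    then have less: "L y - j < L x" using j by simp
    \<comment> \<open>The path leads from \<open>y\<close> to \<open>x\<close> and then takes fewer
      than \<open>L x\<close> further arrows, so it exists. It is zero and hence contains a
      relation.\<close>
    have "valid y (L y)"
      using valid_add[of y j "L y - j"] valid_if_less_L[OF y j(1)] valid_if_less_L[OF x less] j by simp
    then obtain i k where ik: "i + k \<le> L y" "(t y i, arr (t y i) k) \<in> rels"
      using covers_rels[of y "L y"] unfolding covers_def by blast
    then have k: "k = L (t y i)" by (auto simp: rels_def)
    \<comment> \<open>No shorter path from \<open>y\<close> is zero, so the relation ends where this
      path ends.\<close>
    then have "i + k = L y" using ik(1) L_le_shift[OF y, of i] by simp
    show False
    \<comment> \<open>A relation that starts before \<open>x\<close> has \<open>x\<close> strictly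
      inside it; one that starts at \<open>x\<close> or later would be a zero subpath of a nonzero
      path from \<open>x\<close>.\<close>
    proof (cases "i < j")
      case True
      then have "j - i < k" using j(1) \<open>i + k = L y\<close> by linarith
      then show False using int[OF ik(2), of "j - i"] j(2) True by simp
    next
      case False
      then have "t x (i - j) = t y i" unfolding j(2)[symmetric] t_t by simp
      then have "L x \<le> k + (i - j)" using L_le_shift[OF x, of "i - j"] k by simp
      then show False using less False \<open>i + k = L y\<close> by simp
    qed
  qed
  then show ?R using x by blast
next
  assume R: ?R
  have "x \<notin> set_mset (Int_verts Q g)" if "g \<in> rels" for g
  proof
    assume gx: "x \<in> set_mset (Int_verts Q g)"
    from that obtain y where y: "g = (y, arr y (L y))" "valid y (L y)" "L y \<le> L (s y)"
      by (auto simp: rels_def)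
    have yV: "y \<in> V" using y(2) by (rule valid_V)
    then obtain j where j: "0 < j" "j < L y" "t y j = x"
      using gx Int_verts_arr[of "L y" y] L_pos y(1) by auto
    then obtain i where i: "j = Suc i" by (cases j) auto
    have "s y \<in> V" using valid_add[of y 1 "L y - 1"] y(2) L_pos[OF yV] valid_V by auto
    \<comment> \<open>An interior \<open>x\<close> at position \<open>j\<close> gives
      \<open>L y \<le> L (s y) \<le> L x + (j - 1)\<close>, one less than the copy of
      \<open>P(x)\<close> requires.\<close>
    then have "L (s y) \<le> L x + i" using L_le_shift[of "s y" i] j i by (simp add: funpow_swap1)
    moreover have "j + L x \<le> L y" using R yV j by blast
    ultimately show False using y(3) i by simp
  qed
  then show "x \<in> Q_set Q I" using R by (auto simp: Q_set_eq)
qed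

text \<open>At a sink the projective is simple, so each occurrence of \<open>x\<close> generates a
  copy of it.\<close>

lemma sink_mem_Q_set:
  assumes "x \<in> V" "x \<notin> E" shows "x \<in> Q_set Q I"
proof -
  have "\<not> 1 < L x"
    using valid_if_less_L[OF assms(1), of 1] assms(2) by (auto simp: valid_def)
  then show ?thesis using assms(1) by (auto simp: mem_Q_set_iff)
qed

theorem quasi_hereditary_imp_Q_set_nonempty:
  assumes "quasi_hereditary B (vertex_idem Q I) V" "V \<noteq> {}"
  shows "Q_set Q I \<noteq> {}"
proof -
  interpret T: truncated_path_algebra B "vertex_idem Q I" V s L co
    by (rule truncated_path_algebra_B)
  obtain x where "x \<in> V" "\<And>y j. \<lbrakk>y \<in> V; j < L y; t y j = x\<rbrakk> \<Longrightarrow> j + L x \<le> L y"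
    using T.quasi_hereditaryD[OF assms] by blast
  then have "x \<in> Q_set Q I" by (simp add: mem_Q_set_iff)
  then show ?thesis by blast
qed

theorem quasi_hereditary_if_rank:
  fixes \<rho> :: "'v \<Rightarrow> nat"
  assumes x: "x \<in> Q_set Q I"
    and inj: "inj_on \<rho> V" and top: "\<And>y. y \<in> V \<Longrightarrow> \<rho> y \<le> \<rho> x"
    and up: "\<And>y. \<lbrakk>y \<in> E; y \<noteq> x\<rbrakk> \<Longrightarrow> \<rho> y < \<rho> (s y)"
  shows "quasi_hereditary B (vertex_idem Q I) V"
proof -
  interpret T: truncated_path_algebra B "vertex_idem Q I" V s L co
    by (rule truncated_path_algebra_B)
  have E: "y \<in> E" if "y \<in> V" "1 < L y" for y
    using valid_if_less_L[OF that] by (auto simp: valid_def)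
  show ?thesis
    by (rule T.quasi_hereditaryI[of x \<rho>]) (use x inj top up E in \<open>auto simp: mem_Q_set_iff\<close>)
qed

end

section \<open>The linear and the cyclic quiver\<close>

lemma functional_quiver_linear:
  assumes "n \<ge> 2"
  shows "functional_quiver (linear_quiver n) {1..n} {1..n - 1} (\<lambda>j. j + 1)"
  using assms by unfold_locales (auto simp: linear_quiver_def)

lemma functional_quiver_cyclic:
  "functional_quiver (cyclic_quiver n) {1..n} {1..n} (\<lambda>j. if j = n then 1 else j + 1)"
  by unfold_locales (auto simp: cyclic_quiver_def)

theorem theorem3p4:
  fixes n :: nat and Q :: "(nat, nat) pre_digraph"
    and I :: "((nat, nat) qpath \<Rightarrow> 'k::alg_closed_field) set"
  assumes "n \<ge> 2"
    and "Q = linear_quiver n \<or> Q = cyclic_quiver n"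
    and "admissible Q I"
  shows "quasi_hereditary (bound_quiver_algebra Q I) (vertex_idem Q I) (verts Q)
           \<longleftrightarrow> Q_set Q I \<noteq> {}"
  using assms(2)
proof
  assume Q: "Q = linear_quiver n"
  interpret functional_quiver Q "{1..n}" "{1..n - 1}" "\<lambda>j. j + 1"
    unfolding Q by (rule functional_quiver_linear[OF assms(1)])
  interpret bound_functional_quiver Q "{1..n}" "{1..n - 1}" "\<lambda>j. j + 1" I
    by unfold_locales (rule assms(3))
  \<comment> \<open>The sink \<open>n\<close> settles the linear case: both sides of the equivalence
    hold for every admissible ideal, with the usual order of the numbers as the ordering.\<close>
  have n: "n \<in> Q_set Q I"
    using assms(1) by (intro sink_mem_Q_set) auto
  have "quasi_hereditary (bound_quiver_algebra Q I) (vertex_idem Q I) {1..n}"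
    by (rule quasi_hereditary_if_rank[OF n, of id]) auto
  then show ?thesis using n by (auto simp: Q linear_quiver_def)
next
  assume Q: "Q = cyclic_quiver n"
  interpret functional_quiver Q "{1..n}" "{1..n}" "\<lambda>j. if j = n then 1 else j + 1"
    unfolding Q by (rule functional_quiver_cyclic)
  interpret bound_functional_quiver Q "{1..n}" "{1..n}" "\<lambda>j. if j = n then 1 else j + 1" I
    by unfold_locales (rule assms(3))
  have verts: "verts Q = {1..n}" by (simp add: Q cyclic_quiver_def)
  show ?thesis
  proof
    assume "quasi_hereditary (bound_quiver_algebra Q I) (vertex_idem Q I) (verts Q)"
    then show "Q_set Q I \<noteq> {}"
      using assms(1) by (intro quasi_hereditary_imp_Q_set_nonempty) (auto simp: verts)
  next
    assume "Q_set Q I \<noteq> {}"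
    then obtain x where x: "x \<in> Q_set Q I" by blast
    then have "x \<in> {1..n}" by (simp add: mem_Q_set_iff)
    \<comment> \<open>The rank cuts the cycle behind \<open>x\<close>: the order becomes
      \<open>x + 1, ..., n, 1, ..., x\<close>, which increases along every arrow except the one that
      leaves \<open>x\<close>.\<close>
    then show "quasi_hereditary (bound_quiver_algebra Q I) (vertex_idem Q I) (verts Q)"
      unfolding verts
      by (intro quasi_hereditary_if_rank[OF x, of "\<lambda>y. if y \<le> x then y + n else y"])
         (auto simp: inj_on_def split: if_splits)
  qed
qed

end
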